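(* Let $d_1\ge2$ and $d_2\ge1$ be integers and let $\boldsymbol\kappa=(\kappa_1,\dots,\kappa_{d_2})\in\mathbb{R}^{d_2}$ with $\kappa_i>-1$ for $1\le i\le d_2$. For functions on $\mathbb{S}^{d_1-1}\rtimes\triangle^{d_2}$ define the differential operator $$ \mathfrak{D}_{-1,\boldsymbol\kappa}^{\mathbb{S}\rtimes\triangle}:=\sum_{i=1}^{d_2}\big(y_i\partial_{y_i}^2+(\kappa_i+1)\partial_{y_i}\big)-\langle y,\nabla_y\rangle^2-(|\boldsymbol\kappa|+d_1+d_2-2)\langle y,\nabla_y\rangle+\frac1{1-|y|}\Delta_0^{(x)} . $$ Then, for every $n\in\mathbb{N}_0$, every $u\in\mathcal{V}_n\big(\mathbb{S}^{d_1-1}\rtimes\triangle^{d_2},\mathsf{W}_{-1,\boldsymbol\kappa}^{\mathbb{S}\rtimes\triangle}\big)$ satisfies $$ \mathfrak{D}_{-1,\boldsymbol\kappa}^{\mathbb{S}\rtimes\triangle}u=-n\big(n+|\boldsymbol\kappa|+d_1+d_2-2\big)u . $$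
   Context: Variables are $(x,y)\in\mathbb{R}^{d_1}\times\mathbb{R}^{d_2}$; $|y|=\sum_iy_i$, $|\boldsymbol\kappa|=\sum_{i=1}^{d_2}\kappa_i$, $\langle y,\nabla_y\rangle=\sum_iy_i\partial_{y_i}$, powers mean composition. $\triangle^{d_2}=\{y:y_i\ge0,\ |y|\le1\}$. The surface is $\mathbb{S}^{d_1-1}\rtimes\triangle^{d_2}=\{(x,y)\in\mathbb{R}^{d_1}\times\triangle^{d_2}:\|x\|=1-|y|\}$, with surface measure $\mathrm{d}\sigma$, and the weight on it is $\mathsf{W}_{-1,\boldsymbol\kappa}^{\mathbb{S}\rtimes\triangle}(y)=\prod_{i=1}^{d_2}y_i^{\kappa_i}(1-|y|)^{-1}$. $\mathcal{V}_n(\cdot,\mathsf{W})$ is the space of restrictions to the surface of polynomials in $d_1+d_2$ variables of degree at most $n$ that are orthogonal to all restrictions of polynomials of degree less than $n$ with respect to $\int fg\,\mathsf{W}\,\mathrm{d}\sigma$. The operators act on functions on the surface through the parametrization $x=(1-|y|)\xi$, $\xi\in\mathbb{S}^{d_1-1}$, $y\in\triangle^{d_2}$ (with $|y|<1$): a function $u$ is regarded as a function of $(\xi,y)$, the derivatives $\partial_{y_i}$ are taken with $\xi$ fixed, and $\Delta_0^{(x)}$ is the Laplace–Beltrami operator of the unit sphere $\mathbb{S}^{d_1-1}$ acting on $\xi=x/\|x\|$ with $y$ fixed. *)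

theory Defs
  imports "HOL-Analysis.Analysis"
begin

definition coord_sum :: "real ^ 'd \<Rightarrow> real" where
  "coord_sum y = (\<Sum>i\<in>UNIV. y $ i)"

definition simplex_set :: "(real ^ 'd) set" where
  "simplex_set = {y. (\<forall>i. 0 \<le> y $ i) \<and> coord_sum y \<le> 1}"

definition surface :: "((real ^ 'm) \<times> (real ^ 'd)) set" where
  "surface = {(x, y). y \<in> simplex_set \<and> norm x = 1 - coord_sum y}"

text \<open>Surface measure of the unit sphere, through polar coordinates: the measure of a Borel set
  \<open>A\<close> is the dimension times the volume of the cone \<open>{r \<xi> | \<xi> \<in> A, 0 < r \<le> 1}\<close>.
  It is carried by the unit sphere, since \<open>sgn x = x / \<parallel>x\<parallel>\<close> for \<open>x \<noteq> 0\<close>.\<close>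

definition sphere_measure :: "(real ^ 'm) measure" where
  "sphere_measure =
     scale_measure (of_nat CARD('m)) (distr (restrict_space lborel (cball 0 1)) borel sgn)"

definition surface_param :: "(real ^ 'm) \<times> (real ^ 'd) \<Rightarrow> (real ^ 'm) \<times> (real ^ 'd)" where
  "surface_param = (\<lambda>(\<xi>, y). ((1 - coord_sum y) *\<^sub>R \<xi>, y))"

text \<open>The measure that the surface inherits from the ambient Euclidean space. The tangent vectors
  of \<open>surface_param\<close> in the directions \<open>y\<^sub>i\<close> are \<open>(-\<xi>, e\<^sub>i)\<close>, with Gram matrix
  \<open>I + 1 1\<^sup>T\<close> of determinant \<open>1 + d\<close>. They are orthogonal to those in the directions
  tangent to the sphere, which are scaled by \<open>1 - |y|\<close>.\<close>

definition surface_measure :: "((real ^ 'm) \<times> (real ^ 'd)) measure" where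
  "surface_measure =
     distr
       (density (sphere_measure \<Otimes>\<^sub>M restrict_space lborel simplex_set)
          (\<lambda>(\<xi>, y). ennreal (sqrt (1 + real CARD('d)) * (1 - coord_sum y) ^ (CARD('m) - 1))))
       borel surface_param"

text \<open>The conventions \<open>0 powr a = 0\<close> and \<open>inverse 0 = 0\<close> only affect a null set.\<close>

definition weight :: "real ^ 'd \<Rightarrow> (real ^ 'm) \<times> (real ^ 'd) \<Rightarrow> real" where
  "weight \<kappa> = (\<lambda>(x, y). (\<Prod>i\<in>UNIV. (y $ i) powr (\<kappa> $ i)) * inverse (1 - coord_sum y))"

definition exponents :: "nat \<Rightarrow> (('m::finite \<Rightarrow> nat) \<times> ('d::finite \<Rightarrow> nat)) set" where
  "exponents n = {(\<alpha>, \<beta>). (\<Sum>i\<in>UNIV. \<alpha> i) + (\<Sum>j\<in>UNIV. \<beta> j) \<le> n}"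

lemma finite_exponents: "finite (exponents n :: (('m::finite \<Rightarrow> nat) \<times> ('d::finite \<Rightarrow> nat)) set)"
proof (rule finite_subset)
  show "(exponents n :: (('m \<Rightarrow> nat) \<times> ('d \<Rightarrow> nat)) set)
          \<subseteq> (\<Pi>\<^sub>E i\<in>UNIV. {..n}) \<times> (\<Pi>\<^sub>E j\<in>UNIV. {..n})"
  proof
    fix e :: "('m \<Rightarrow> nat) \<times> ('d \<Rightarrow> nat)" assume "e \<in> exponents n"
    then obtain \<alpha> \<beta> where e: "e = (\<alpha>, \<beta>)" and le: "sum \<alpha> UNIV + sum \<beta> UNIV \<le> n"
      by (auto simp: exponents_def)
    have "\<alpha> i \<le> sum \<alpha> UNIV" "\<beta> j \<le> sum \<beta> UNIV" for i j
      by (auto intro: member_le_sum)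
    then have "\<alpha> i \<le> n" "\<beta> j \<le> n" for i j
      using le by (meson add_leD1 add_leD2 le_trans)+
    then show "e \<in> (\<Pi>\<^sub>E i\<in>UNIV. {..n}) \<times> (\<Pi>\<^sub>E j\<in>UNIV. {..n})"
      by (simp add: e PiE_iff)
  qed
  show "finite ((\<Pi>\<^sub>E i\<in>(UNIV::'m set). {..n}) \<times> (\<Pi>\<^sub>E j\<in>(UNIV::'d set). {..n}))"
    by (intro finite_cartesian_product finite_PiE) auto
qed

definition polys_upto :: "nat \<Rightarrow> ((real ^ 'm) \<times> (real ^ 'd) \<Rightarrow> real) set" where
  "polys_upto n = {p. \<exists>c. \<forall>x y. p (x, y) =
     (\<Sum>(\<alpha>, \<beta>)\<in>exponents n.
        c (\<alpha>, \<beta>) * (\<Prod>i\<in>UNIV. (x $ i) ^ \<alpha> i) * (\<Prod>j\<in>UNIV. (y $ j) ^ \<beta> j))}"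

text \<open>Functions on the surface are represented by functions on the ambient space; their values
  off the surface are irrelevant here and in \<open>diff_op\<close> below.\<close>

definition orth_space ::
    "nat \<Rightarrow> ((real ^ 'm) \<times> (real ^ 'd) \<Rightarrow> real) \<Rightarrow> ((real ^ 'm) \<times> (real ^ 'd) \<Rightarrow> real) set" where
  "orth_space n W = {u.
     (\<exists>p\<in>polys_upto n. \<forall>z\<in>surface. u z = p z) \<and>
     (\<forall>m<n. \<forall>q\<in>polys_upto m.
        (LINT z:surface|surface_measure. u z * q z * W z) = 0)}"

text \<open>Partial derivatives on the part \<open>|y| < 1\<close> of the simplex, one-sided where \<open>y\<^sub>i = 0\<close>.\<close>

definition partial_y :: "'d \<Rightarrow> (real ^ 'd \<Rightarrow> real) \<Rightarrow> real ^ 'd \<Rightarrow> real" where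
  "partial_y i g y =
     vector_derivative (\<lambda>t. g (y + t *\<^sub>R axis i 1))
       (at 0 within {t. y + t *\<^sub>R axis i 1 \<in> simplex_set \<and> coord_sum (y + t *\<^sub>R axis i 1) < 1})"

definition euler_y :: "(real ^ 'd \<Rightarrow> real) \<Rightarrow> real ^ 'd \<Rightarrow> real" where
  "euler_y g y = (\<Sum>i\<in>UNIV. y $ i * partial_y i g y)"

definition laplacian :: "(real ^ 'm \<Rightarrow> real) \<Rightarrow> real ^ 'm \<Rightarrow> real" where
  "laplacian F x = (\<Sum>i\<in>UNIV. (deriv ^^ 2) (\<lambda>t. F (x + t *\<^sub>R axis i 1)) 0)"

text \<open>The Laplace--Beltrami operator of the unit sphere: the Laplacian of the extension that is
  constant along rays.\<close>

definition laplace_beltrami :: "(real ^ 'm \<Rightarrow> real) \<Rightarrow> real ^ 'm \<Rightarrow> real" where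
  "laplace_beltrami f \<xi> = laplacian (\<lambda>x. f (sgn x)) \<xi>"

text \<open>At a point \<open>(x, y)\<close> with \<open>|y| < 1\<close> one has \<open>\<xi> = sgn x\<close>; the operator is
  only meaningful there.\<close>

definition diff_op ::
    "real ^ 'd \<Rightarrow> ((real ^ 'm) \<times> (real ^ 'd) \<Rightarrow> real) \<Rightarrow> (real ^ 'm) \<times> (real ^ 'd) \<Rightarrow> real" where
  "diff_op \<kappa> u = (\<lambda>(x, y).
     let g = (\<lambda>\<eta>. u (surface_param (sgn x, \<eta>))) in
       (\<Sum>i\<in>UNIV. y $ i * partial_y i (partial_y i g) y + (\<kappa> $ i + 1) * partial_y i g y)
       - euler_y (euler_y g) y
       - (coord_sum \<kappa> + real CARD('m) + real CARD('d) - 2) * euler_y g y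
       + 1 / (1 - coord_sum y) * laplace_beltrami (\<lambda>\<xi>. u (surface_param (\<xi>, y))) (sgn x))"

end

theory Submission
  imports Defs
begin

text \<open>
  Write \<open>r = 1 - |y|\<close>, so that points of the surface are \<open>(r \<xi>, y)\<close> with \<open>\<xi>\<close> on the unit sphere, and
  let \<open>c = |\<kappa>| + d\<^sub>1 + d\<^sub>2 - 2\<close>. The operator contains the singular factor \<open>1 / r\<close>, but on the
  restriction of a polynomial \<open>p\<close> of the ambient space the chain rule makes all terms with
  \<open>1 / r\<close> cancel. What is left is the restriction of \<open>L p\<close>, where
  \<open>L = \<Sum>\<^sub>i (y\<^sub>i \<partial>\<^sub>i\<^sup>2 + (\<kappa>\<^sub>i + 1) \<partial>\<^sub>i) + (1 - |y|) \<Delta>\<^sub>x - H - (c + 1) E\<close>; here \<open>E\<close> is the Euler operator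
  in all variables and \<open>H\<close> the Hessian in the direction of the position vector, so that
  \<open>E\<^sup>2 = H + E\<close> (\<open>surface_op\<close>, \<open>simplex_op_param\<close>, \<open>diff_op_eq_surface_op\<close>).

  The first two sums in \<open>L\<close> lower the degree, while \<open>H\<close> and \<open>E\<close> multiply the homogeneous part of
  degree \<open>n\<close> by \<open>n (n - 1)\<close> and \<open>n\<close>. Hence \<open>v = L p + n (n + c) p\<close> has degree less than \<open>n\<close> when \<open>p\<close>
  has degree at most \<open>n\<close> (\<open>surface_op_degree\<close>).

  Moreover \<open>L\<close> is symmetric for the weighted inner product of the surface
  (\<open>surface_op_symmetric\<close>). In the coordinates \<open>(\<xi>, y)\<close> it is the sum of the Jacobi operator of the
  simplex for the Dirichlet weight \<open>y\<^sup>\<kappa> r^(d\<^sub>1 - 2)\<close>, acting for fixed \<open>\<xi>\<close>, and of \<open>1 / r\<close> times the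
  Laplace--Beltrami operator, acting for fixed \<open>y\<close>. Each of the two is a sum of second order terms
  whose symmetry is an integration by parts: along the coordinate directions and their differences
  in the simplex (\<open>simplex_divergence_zero\<close>, \<open>simplex_exchange_zero\<close>), and along infinitesimal
  rotations on the sphere (\<open>integral_sphere_rot_dder\<close>).

  If \<open>p\<close> is orthogonal to all polynomials of degree less than \<open>n\<close>, then, since \<open>v\<close> and \<open>L v\<close> have
  degree less than \<open>n\<close>,
  \<open>\<langle>v, v\<rangle> = \<langle>L p, v\<rangle> + n (n + c) \<langle>p, v\<rangle> = \<langle>p, L v\<rangle> = 0\<close>.
  As the weight is positive inside the simplex, \<open>v\<close> vanishes on the surface
  (\<open>square_integral_zero_imp_zero\<close>), which is the claim.
\<close>

section \<open>Directional derivatives of polynomial functions\<close>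

text \<open>Taking the derivative as a function of the direction, rather than fixing coordinates, lets the
  chain rule for an affine substitution be stated as a change of direction; this is what makes the
  computations in the parametrized surface short.\<close>

definition dder :: "'a::euclidean_space \<Rightarrow> ('a \<Rightarrow> real) \<Rightarrow> 'a \<Rightarrow> real" where
  "dder v f z = frechet_derivative f (at z) v"

abbreviation rpoly :: "('a::euclidean_space \<Rightarrow> real) \<Rightarrow> bool" where
  "rpoly \<equiv> real_polynomial_function"

lemmas rpoly_intros =
  real_polynomial_function.intros(2-4) real_polynomial_function_diff real_polynomial_function_minus
  real_polynomial_function_sum real_polynomial_function_power real_polynomial_function_divide

lemma dder_eqI: "(f has_derivative F) (at z) \<Longrightarrow> dder v f z = F v"
  unfolding dder_def using frechet_derivative_at by metis

lemma rpoly_has_derivative: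
  assumes "rpoly f" shows "(f has_derivative (\<lambda>v. dder v f z)) (at z)"
  using differentiable_at_real_polynomial_function[OF assms, of z UNIV]
  unfolding dder_def by (simp add: frechet_derivative_works)

lemma rpoly_continuous_on: "rpoly f \<Longrightarrow> continuous_on S f"
  by (simp add: real_polynomial_function_eq continuous_on_polymonial_function)

lemma rpoly_measurable: "rpoly f \<Longrightarrow> f \<in> borel_measurable borel"
  by (intro borel_measurable_continuous_onI rpoly_continuous_on)

lemma dder_const: "dder v (\<lambda>z. c) = (\<lambda>z. 0)"
  by (rule ext, rule dder_eqI) (auto intro!: derivative_eq_intros)

lemma dder_linear: "bounded_linear l \<Longrightarrow> dder v l = (\<lambda>z. l v)"
  by (rule ext, rule dder_eqI) (rule bounded_linear_imp_has_derivative)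

lemma dder_add: "rpoly f \<Longrightarrow> rpoly g \<Longrightarrow> dder v (\<lambda>z. f z + g z) = (\<lambda>z. dder v f z + dder v g z)"
  by (rule ext, rule dder_eqI) (auto intro!: derivative_eq_intros rpoly_has_derivative)

lemma dder_diff: "rpoly f \<Longrightarrow> rpoly g \<Longrightarrow> dder v (\<lambda>z. f z - g z) = (\<lambda>z. dder v f z - dder v g z)"
  by (rule ext, rule dder_eqI) (auto intro!: derivative_eq_intros rpoly_has_derivative)

lemma dder_mult: "rpoly f \<Longrightarrow> rpoly g \<Longrightarrow>
    dder v (\<lambda>z. f z * g z) = (\<lambda>z. f z * dder v g z + dder v f z * g z)"
  by (rule ext, rule dder_eqI) (auto intro!: derivative_eq_intros rpoly_has_derivative)

lemma dder_cmult: "rpoly f \<Longrightarrow> dder v (\<lambda>z. c * f z) = (\<lambda>z. c * dder v f z)"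
  by (rule ext, rule dder_eqI) (auto intro!: derivative_eq_intros rpoly_has_derivative)

lemma dder_sum: "(\<And>i. i \<in> I \<Longrightarrow> rpoly (f i)) \<Longrightarrow>
    dder v (\<lambda>z. \<Sum>i\<in>I. f i z) = (\<lambda>z. \<Sum>i\<in>I. dder v (f i) z)"
  by (rule ext, rule dder_eqI) (auto intro!: derivative_eq_intros rpoly_has_derivative)

lemma rpoly_dder: "rpoly f \<Longrightarrow> rpoly (dder v f)"
  by (induction f rule: real_polynomial_function.induct)
     (simp_all add: dder_linear dder_const dder_add dder_mult real_polynomial_function.intros(1)
         rpoly_intros)

text \<open>Symmetry of second derivatives follows by induction on the construction of the polynomial, the
  product rule being symmetric in the two directions.\<close>

lemma dder_commute: "rpoly f \<Longrightarrow> dder v (dder w f) = dder w (dder v f)"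
  by (induction f rule: real_polynomial_function.induct)
     (simp_all add: dder_linear dder_const dder_add dder_mult real_polynomial_function.intros(1)
         rpoly_intros rpoly_dder algebra_simps)

lemma linear_dder:
  assumes "rpoly f" shows "linear (\<lambda>v. dder v f z)"
  using has_derivative_bounded_linear[OF rpoly_has_derivative[OF assms]]
  by (simp add: bounded_linear.linear)

lemma dder_vec_add: "rpoly f \<Longrightarrow> dder (v + w) f = (\<lambda>z. dder v f z + dder w f z)"
  by (rule ext, rule linear_add[OF linear_dder])
lemma dder_vec_diff: "rpoly f \<Longrightarrow> dder (v - w) f = (\<lambda>z. dder v f z - dder w f z)"
  by (rule ext, rule linear_diff[OF linear_dder])
lemma dder_vec_scale: "rpoly f \<Longrightarrow> dder (c *\<^sub>R v) f = (\<lambda>z. c * dder v f z)"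
  by (rule ext) (use linear_scale[OF linear_dder] in \<open>fastforce\<close>)
lemma dder_vec_sum: "rpoly f \<Longrightarrow> dder (\<Sum>i\<in>I. v i) f = (\<lambda>z. \<Sum>i\<in>I. dder (v i) f z)"
  by (rule ext, rule linear_sum[OF linear_dder])

lemma dder_compose:
  assumes "rpoly f" "(h has_derivative H) (at z)"
  shows "dder v (\<lambda>z. f (h z)) z = dder (H v) f (h z)"
  using has_derivative_compose[OF assms(2) rpoly_has_derivative[OF assms(1)]]
  by (rule dder_eqI)

lemma rpoly_compose:
  "polynomial_function h \<Longrightarrow> rpoly f \<Longrightarrow> rpoly (\<lambda>z. f (h z))"
  using real_polynomial_function_compose[of h f] by (simp add: o_def)

section \<open>Degree\<close>

text \<open>Bounding the degree strictly makes the zero polynomial the case \<open>n = 0\<close>, and a derivative then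
  lowers the bound from \<open>n\<close> to \<open>n - 1\<close> for every natural number \<open>n\<close>. Linear functionals take the place
  of coordinates, so that the notion does not refer to a basis.\<close>

inductive deg_less :: "nat \<Rightarrow> ('a::euclidean_space \<Rightarrow> real) \<Rightarrow> bool" where
  zero: "deg_less n (\<lambda>z. 0)"
| const: "deg_less (Suc n) (\<lambda>z. c)"
| linear_mult: "bounded_linear l \<Longrightarrow> deg_less n f \<Longrightarrow> deg_less (Suc n) (\<lambda>z. l z * f z)"
| add: "deg_less n f \<Longrightarrow> deg_less n g \<Longrightarrow> deg_less n (\<lambda>z. f z + g z)"

lemma deg_less_0: "deg_less 0 f \<longleftrightarrow> f = (\<lambda>z. 0)"
proof
  have "n = 0 \<Longrightarrow> f = (\<lambda>z. 0)" if "deg_less n f" for n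
    using that by (induction rule: deg_less.induct) auto
  then show "deg_less 0 f \<Longrightarrow> f = (\<lambda>z. 0)" by simp
qed (simp add: deg_less.zero)

lemma deg_less_rpoly: "deg_less n f \<Longrightarrow> rpoly f"
  by (induction rule: deg_less.induct) (auto intro: real_polynomial_function.intros)

lemma deg_less_mono: "deg_less n f \<Longrightarrow> n \<le> m \<Longrightarrow> deg_less m f"
proof (induction arbitrary: m rule: deg_less.induct)
  case (const n c) then show ?case by (cases m) (auto intro: deg_less.intros)
next
  case (linear_mult l n f) then show ?case by (cases m) (auto intro: deg_less.intros)
qed (auto intro: deg_less.intros)

lemma deg_less_cmult: "deg_less n f \<Longrightarrow> deg_less n (\<lambda>z. c * f z)"
proof (induction rule: deg_less.induct)
  case (linear_mult l n f)
  have "deg_less (Suc n) (\<lambda>z. l z * (c * f z))"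
    by (intro deg_less.linear_mult linear_mult)
  then show ?case by (simp add: mult.left_commute)
qed (auto intro: deg_less.intros simp: distrib_left)

lemma deg_less_diff: "deg_less n f \<Longrightarrow> deg_less n g \<Longrightarrow> deg_less n (\<lambda>z. f z - g z)"
  using deg_less.add[OF _ deg_less_cmult[of n g "-1"]] by simp

lemma deg_less_sum: "(\<And>i. i \<in> I \<Longrightarrow> deg_less n (f i)) \<Longrightarrow> deg_less n (\<lambda>z. \<Sum>i\<in>I. f i z)"
  by (induction I rule: infinite_finite_induct) (auto intro: deg_less.intros)

lemma deg_less_mult: "deg_less n f \<Longrightarrow> deg_less m g \<Longrightarrow> deg_less (n + m) (\<lambda>z. f z * g z)"
proof (induction rule: deg_less.induct)
  case (const n c)
  show ?case by (rule deg_less_mono[OF deg_less_cmult[OF const]]) simp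
next
  case (linear_mult l n f)
  then show ?case using deg_less.linear_mult[of l "n + m" "\<lambda>z. f z * g z"]
    by (simp add: mult.assoc)
qed (auto intro: deg_less.intros simp: distrib_right)

text \<open>Together with \<open>deg_less_rpoly\<close>, this gives the induction rule of \<open>deg_less\<close>, which multiplies by
  one linear functional at a time, for all polynomial functions.\<close>

lemma rpoly_imp_deg_less: "rpoly f \<Longrightarrow> \<exists>n. deg_less n f"
proof (induction f rule: real_polynomial_function.induct)
  case (linear f)
  show ?case using deg_less.linear_mult[OF linear deg_less.const[of 0 1]] by auto
next
  case (const c)
  show ?case using deg_less.const by blast
next
  case (add f g)
  then obtain n m where "deg_less n f" "deg_less m g" by auto
  then have "deg_less (max n m) (\<lambda>z. f z + g z)"
    by (intro deg_less.add) (auto intro: deg_less_mono)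
  then show ?case by blast
next
  case (mult f g)
  then show ?case using deg_less_mult by blast
qed

lemma deg_less_dder: "deg_less n f \<Longrightarrow> deg_less (n - 1) (dder v f)"
proof (induction rule: deg_less.induct)
  case (linear_mult l n f)
  have "deg_less n (\<lambda>z. l z * dder v f z)"
  proof (cases n)
    case 0
    then have "f = (\<lambda>z. 0)" using linear_mult deg_less_0 by auto
    then show ?thesis by (simp add: dder_const deg_less.zero)
  next
    case (Suc m)
    then show ?thesis using deg_less.linear_mult[OF linear_mult(1) linear_mult(3)] by simp
  qed
  moreover have "rpoly l" using linear_mult by (simp add: real_polynomial_function.intros(1))
  ultimately show ?case
    using linear_mult deg_less_rpoly[OF linear_mult(2)]
    by (auto simp: dder_mult dder_linear intro!: deg_less.add deg_less_cmult)
qed (auto simp: dder_const dder_add deg_less_rpoly intro: deg_less.intros)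

text \<open>On a homogeneous polynomial of degree \<open>k\<close> the operators \<open>euler\<close> and \<open>hess_rad\<close> are multiplication
  by \<open>k\<close> and by \<open>k (k - 1)\<close>. The direction of differentiation is frozen in \<open>hess_rad\<close>: it is the
  quadratic form of the Hessian at the position vector, not the square of \<open>euler\<close>.\<close>

definition euler :: "('a::euclidean_space \<Rightarrow> real) \<Rightarrow> 'a \<Rightarrow> real" where
  "euler f z = dder z f z"

definition hess_rad :: "('a::euclidean_space \<Rightarrow> real) \<Rightarrow> 'a \<Rightarrow> real" where
  "hess_rad f z = dder z (dder z f) z"

text \<open>The extra premise handles \<open>n = 0\<close>, where the truncated \<open>n - 1\<close> would otherwise lose information.\<close>

lemma linear_times_lower:
  "bounded_linear l \<Longrightarrow> deg_less (n - 1) f \<Longrightarrow> (n = 0 \<Longrightarrow> f = (\<lambda>z. 0)) \<Longrightarrow> deg_less n (\<lambda>z. l z * f z)"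
  by (cases n) (auto intro: deg_less.intros)

text \<open>For a bound \<open>n\<close> the top degree is \<open>n - 1\<close>, and Euler's identity removes the homogeneous part of that
  degree. The induction step is \<open>E (l f) = l E f + l f\<close> for linear \<open>l\<close>.\<close>

lemma euler_degree:
  "deg_less n f \<Longrightarrow> deg_less (n - 1) (\<lambda>z. euler f z - (real n - 1) * f z)"
proof (induction rule: deg_less.induct)
  case (zero n) then show ?case by (simp add: euler_def dder_const deg_less.zero)
next
  case (const n c)
  then show ?case
    by (cases n) (auto simp: euler_def dder_const deg_less.zero intro: deg_less_cmult deg_less.const)
next
  case (linear_mult l n f)
  have rl: "rpoly l" and rf: "rpoly f" using linear_mult
      by (auto intro: real_polynomial_function.intros(1) deg_less_rpoly)
  have "deg_less n (\<lambda>z. l z * (euler f z - (real n - 1) * f z))"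
    using linear_mult by (intro linear_times_lower) (auto simp: deg_less_0 euler_def dder_const)
  moreover have "euler (\<lambda>z. l z * f z) z = l z * euler f z + l z * f z" for z
    using linear_mult(1) by (simp add: euler_def dder_mult[OF rl rf] dder_linear)
  ultimately show ?case by (simp add: algebra_simps)
next
  case (add n f g)
  have "euler (\<lambda>z. f z + g z) z = euler f z + euler g z" for z
    using add by (simp add: euler_def dder_add deg_less_rpoly)
  then show ?case using deg_less.add[OF add(3,4)] by (simp add: algebra_simps)
qed

text \<open>The induction step is \<open>H (l f) = l H f + 2 l E f\<close>, so \<open>euler_degree\<close> supplies the second summand.\<close>

lemma hess_rad_degree:
  "deg_less n f \<Longrightarrow> deg_less (n - 1) (\<lambda>z. hess_rad f z - (real n - 1) * (real n - 2) * f z)"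
proof (induction rule: deg_less.induct)
  case (zero n) then show ?case by (simp add: hess_rad_def dder_const deg_less.zero)
next
  case (const n c)
  then show ?case
    by (cases n) (auto simp: hess_rad_def dder_const deg_less.zero intro: deg_less_cmult deg_less.const)
next
  case (linear_mult l n f)
  have rl: "rpoly l" and rf: "rpoly f" using linear_mult
      by (auto intro: real_polynomial_function.intros(1) deg_less_rpoly)
  have 1: "deg_less n (\<lambda>z. l z * (hess_rad f z - (real n - 1) * (real n - 2) * f z))"
    using linear_mult by (intro linear_times_lower) (auto simp: deg_less_0 hess_rad_def dder_const)
  have 2: "deg_less n (\<lambda>z. l z * (euler f z - (real n - 1) * f z))"
    using linear_mult euler_degree[OF linear_mult(2)]
    by (intro linear_times_lower) (auto simp: deg_less_0 euler_def dder_const)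
  have "hess_rad (\<lambda>z. l z * f z) z = l z * hess_rad f z + 2 * l z * euler f z" for z
    using linear_mult(1) by (simp add: hess_rad_def euler_def dder_mult dder_add dder_linear dder_const
        rl rf rpoly_dder rpoly_intros)
  then show ?case using deg_less.add[OF 1 deg_less_cmult[OF 2, of 2]] by (simp add: algebra_simps)
next
  case (add n f g)
  have "hess_rad (\<lambda>z. f z + g z) z = hess_rad f z + hess_rad g z" for z
    using add by (simp add: hess_rad_def dder_add deg_less_rpoly rpoly_dder)
  then show ?case using deg_less.add[OF add(3,4)] by (simp add: algebra_simps)
qed

section \<open>The Dirichlet weight on the simplex\<close>

definition open_simplex :: "(real ^ 'd) set" where
  "open_simplex = {y. (\<forall>i. 0 < y $ i) \<and> coord_sum y < 1}"

text \<open>The weight is cut off to the open simplex. This agrees almost everywhere with the weight on the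
  closed simplex and removes all questions about the values of \<open>powr\<close> on the boundary.\<close>

definition dirichlet :: "real ^ 'd \<Rightarrow> nat \<Rightarrow> real ^ 'd \<Rightarrow> real" where
  "dirichlet a k y = indicator open_simplex y * (\<Prod>i\<in>UNIV. (y $ i) powr (a $ i)) * (1 - coord_sum y) ^ k"

lemma bounded_linear_coord_sum: "bounded_linear coord_sum"
  unfolding coord_sum_def by (intro bounded_linear_sum bounded_linear_vec_nth)

lemma continuous_on_coord_sum [continuous_intros]:
  "continuous_on S f \<Longrightarrow> continuous_on S (\<lambda>x. coord_sum (f x))"
  by (rule bounded_linear.continuous_on[OF bounded_linear_coord_sum])

lemma coord_sum_add [simp]: "coord_sum (x + y) = coord_sum x + coord_sum y"
  by (simp add: coord_sum_def sum.distrib)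

lemma coord_sum_scale [simp]: "coord_sum (c *\<^sub>R x) = c * coord_sum x"
  by (simp add: coord_sum_def sum_distrib_left)

lemma coord_sum_axis [simp]: "coord_sum (axis i c) = c"
  by (simp add: coord_sum_def axis_def if_distrib cong: if_cong)

lemma open_open_simplex: "open (open_simplex :: (real ^ 'd) set)"
proof -
  have "open_simplex = (\<Inter>i. {y :: real ^ 'd. 0 < y $ i}) \<inter> {y. coord_sum y < 1}"
    by (auto simp: open_simplex_def)
  also have "open \<dots>"
    by (intro open_Int open_INT open_Collect_less continuous_intros ballI) auto
  finally show ?thesis .
qed

lemma borel_coord_sum [measurable]: "coord_sum \<in> borel_measurable borel"
  by (intro borel_measurable_continuous_onI continuous_intros)

lemma borel_open_simplex [measurable]: "open_simplex \<in> sets borel"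
  by (simp add: open_open_simplex)

lemma borel_dirichlet [measurable]: "dirichlet a k \<in> borel_measurable borel"
  unfolding dirichlet_def by measurable

lemma dirichlet_nonneg: "0 \<le> dirichlet a k y"
  by (auto simp: dirichlet_def open_simplex_def indicator_def intro!: mult_nonneg_nonneg prod_nonneg)

lemma dirichlet_Suc: "dirichlet a (Suc k) y = (1 - coord_sum y) * dirichlet a k y"
  by (simp add: dirichlet_def)

text \<open>Multiplication by a coordinate stays inside the family of Dirichlet weights. Every identity for
  all exponents can therefore be carried from \<open>h\<close> to \<open>y\<^sub>i h\<close>.\<close>

lemma dirichlet_shift: "dirichlet (a + axis i 1) k y = y $ i * dirichlet a k y"
proof (cases "y \<in> open_simplex")
  case True
  then have pos: "0 < y $ j" for j by (simp add: open_simplex_def)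
  have "(\<Prod>j\<in>UNIV. (y $ j) powr ((a + axis i 1) $ j))
      = (\<Prod>j\<in>UNIV. (if j = i then y $ i else 1) * (y $ j) powr (a $ j))"
    by (intro prod.cong) (use pos in \<open>auto simp: powr_add axis_def less_le\<close>)
  also have "\<dots> = y $ i * (\<Prod>j\<in>UNIV. (y $ j) powr (a $ j))"
    by (subst prod.distrib) simp
  finally show ?thesis by (simp add: dirichlet_def)
qed (simp add: dirichlet_def)

lemma axis_component: "axis i c $ j = (if i = j then c else 0)"
  by (simp add: axis_def)

text \<open>The following three lemmas are Fubini's theorem for singling out one coordinate of a vector.\<close>

lemma measurable_vec_lambda:
  "(\<lambda>f. \<chi> i. f i) \<in> (\<Pi>\<^sub>M i\<in>(UNIV::'d::finite set). lborel :: real measure) \<rightarrow>\<^sub>M borel"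
proof (subst borel_measurable_euclidean_space, intro ballI)
  fix b :: "real ^ 'd" assume "b \<in> Basis"
  then obtain i where b: "b = axis i 1" by (auto simp: Basis_vec_def)
  show "(\<lambda>f. (\<chi> i. f i) \<bullet> b) \<in> (\<Pi>\<^sub>M i\<in>(UNIV::'d set). lborel :: real measure) \<rightarrow>\<^sub>M borel"
    unfolding b by (simp add: inner_axis)
qed

lemma lborel_vec: "(lborel :: (real ^ 'd) measure) = distr (\<Pi>\<^sub>M i\<in>UNIV. lborel) borel (\<lambda>f. \<chi> i. f i)"
proof (rule lborel_eqI)
  interpret P: product_sigma_finite "\<lambda>_ :: 'd. lborel :: real measure" ..
  fix l u :: "real ^ 'd" assume le: "\<And>b. b \<in> Basis \<Longrightarrow> l \<bullet> b \<le> u \<bullet> b"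
  have le': "l $ i \<le> u $ i" for i using le[of "axis i 1"] by (simp add: inner_axis)
  have m: "(\<lambda>f. \<chi> i. f i) \<in> (\<Pi>\<^sub>M i\<in>(UNIV::'d set). lborel :: real measure) \<rightarrow>\<^sub>M borel"
    by (rule measurable_vec_lambda)
  have "emeasure (distr (\<Pi>\<^sub>M i\<in>(UNIV::'d set). lborel) borel (\<lambda>f. \<chi> i. f i)) (box l u)
      = emeasure (\<Pi>\<^sub>M i\<in>(UNIV::'d set). lborel) (\<Pi>\<^sub>E i\<in>UNIV. {l $ i <..< u $ i})"
    by (subst emeasure_distr[OF m])
       (auto simp: space_PiM mem_box_cart PiE_iff intro!: arg_cong2[where f = emeasure])
  also have "\<dots> = (\<Prod>i\<in>UNIV. emeasure lborel {l $ i <..< u $ i})"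
    by (rule P.emeasure_PiM) auto
  also have "\<dots> = (\<Prod>i\<in>UNIV. ennreal ((u - l) $ i))"
    using le' by simp
  also have "\<dots> = ennreal (\<Prod>i\<in>UNIV. (u - l) $ i)"
    using le' by (intro prod_ennreal) simp
  also have "(\<Prod>i\<in>UNIV. (u - l) $ i) = (\<Prod>b\<in>(\<lambda>i. axis i 1) ` UNIV. (u - l) \<bullet> b)"
    by (subst prod.reindex) (auto simp: inj_on_def axis_eq_axis inner_axis)
  also have "(\<lambda>i. axis i 1) ` UNIV = (Basis :: (real ^ 'd) set)"
    by (auto simp: Basis_vec_def)
  finally show "emeasure (distr (\<Pi>\<^sub>M i\<in>(UNIV::'d set). lborel) borel (\<lambda>f. \<chi> i. f i)) (box l u)
     = (\<Prod>b\<in>Basis. (u - l) \<bullet> b)" by simp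
qed simp

lemma nn_integral_vec_split:
  fixes f :: "real ^ 'd \<Rightarrow> ennreal"
  assumes [measurable]: "f \<in> borel_measurable borel"
  shows "(\<integral>\<^sup>+ y. f y \<partial>lborel)
    = (\<integral>\<^sup>+ x. (\<integral>\<^sup>+ t. f (\<chi> j. (x(i := t)) j) \<partial>lborel) \<partial>(\<Pi>\<^sub>M j\<in>UNIV - {i}. lborel))"
proof -
  interpret P: product_sigma_finite "\<lambda>_ :: 'd. lborel :: real measure" ..
  have m: "(\<lambda>f. \<chi> i. f i) \<in> (\<Pi>\<^sub>M i\<in>(UNIV::'d set). lborel :: real measure) \<rightarrow>\<^sub>M borel"
    by (rule measurable_vec_lambda)
  have "(\<integral>\<^sup>+ y. f y \<partial>lborel) = (\<integral>\<^sup>+ x. f (\<chi> j. x j) \<partial>(\<Pi>\<^sub>M j\<in>insert i (UNIV - {i}). lborel))"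
    by (subst lborel_vec, subst nn_integral_distr[OF m]) (auto simp: insert_absorb)
  also have "\<dots> = (\<integral>\<^sup>+ x. (\<integral>\<^sup>+ t. f (\<chi> j. (x(i := t)) j) \<partial>lborel) \<partial>(\<Pi>\<^sub>M j\<in>UNIV - {i}. lborel))"
    by (subst P.product_nn_integral_insert)
       (use measurable_compose[OF m assms] in \<open>auto simp: insert_absorb\<close>)
  finally show ?thesis .
qed

lemma has_integral_indicator_mult:
  fixes h :: "real \<Rightarrow> real"
  assumes "(h has_integral I) S"
  shows "((\<lambda>t. indicator S t * h t) has_integral I) UNIV"
proof -
  have "(\<lambda>t. indicator S t * h t) = (\<lambda>t. if t \<in> S then h t else 0)"
    by (auto simp: indicator_def)
  with assms show ?thesis by (simp add: has_integral_restrict_UNIV)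
qed

text \<open>The function \<open>t powr (a + 1) * (s - t) ^ (k + 1)\<close> vanishes at both ends of the interval, so the two
  terms of its derivative have equal integrals. Since both terms are nonnegative, the statement
  can be made for the integral in the extended reals, where Fubini's theorem needs no
  integrability.\<close>

lemma beta_recurrence:
  fixes a s :: real
  assumes a: "a > -1"
  shows "ennreal (a + 1) * (\<integral>\<^sup>+ t. ennreal
      (indicator {0<..<s} t * (t powr a * (s - t) ^ Suc k)) \<partial>lborel)
       = ennreal (Suc k) * (\<integral>\<^sup>+ t. ennreal
           (indicator {0<..<s} t * (t powr (a + 1) * (s - t) ^ k)) \<partial>lborel)"
proof (cases "s > 0")
  case True
  define f where "f t = (a + 1) * (t powr a * (s - t) ^ Suc k)" for t
  define g where "g t = Suc k * (t powr (a + 1) * (s - t) ^ k)" for t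
  have "((\<lambda>t. f t - g t) has_integral
      (s powr (a + 1) * (s - s) ^ Suc k - 0 powr (a + 1) * (s - 0) ^ Suc k)) {0..s}"
  proof (rule fundamental_theorem_of_calculus_interior)
    show "continuous_on {0..s} (\<lambda>t. t powr (a + 1) * (s - t) ^ Suc k)"
      using a by (intro continuous_intros continuous_on_powr') auto
    show "((\<lambda>t. t powr (a + 1) * (s - t) ^ Suc k) has_vector_derivative f t - g t) (at t)"
      if "t \<in> {0<..<s}" for t
    proof -
      have 1: "((\<lambda>t. (s - t) ^ Suc k) has_real_derivative - (Suc k * (s - t) ^ k)) (at t)"
        by (rule derivative_eq_intros refl)+ simp
      have 2: "((\<lambda>t. t powr (a + 1)) has_real_derivative (a + 1) * t powr a) (at t)"
        using that by (auto intro!: derivative_eq_intros)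
      show ?thesis
        unfolding has_real_derivative_iff_has_vector_derivative[symmetric] f_def g_def
        by (rule DERIV_cong[OF DERIV_mult[OF 2 1]]) (simp add: algebra_simps)
    qed
  qed (use True in auto)
  then have fg: "((\<lambda>t. f t - g t) has_integral 0) {0..s}" by simp
  have "g integrable_on {0..s}"
    unfolding g_def using a
    by (intro integrable_continuous_interval continuous_intros continuous_on_powr') auto
  \<comment> \<open>\<open>g\<close> is continuous up to the boundary; the integrability of \<open>f\<close>, which may be unbounded at
    \<open>0\<close>, then comes from that of \<open>f - g\<close>.\<close>
  then obtain I where g: "(g has_integral I) {0..s}" by (auto simp: integrable_on_def)
  have f: "(f has_integral I) {0..s}" using has_integral_add[OF fg g] by simp
  have *: "(\<integral>\<^sup>+ t. ennreal (indicator {0<..<s} t * h t) \<partial>lborel) = ennreal I"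
    if h: "(h has_integral I) {0..s}" "h \<in> borel_measurable borel" "\<And>t. 0 < t \<Longrightarrow> t < s \<Longrightarrow> 0 \<le> h t" for h
  proof (rule nn_integral_has_integral_lborel)
    have "(h has_integral I) {0<..<s}"
      using h(1) by (simp add: has_integral_Icc_iff_Ioo)
    then show "((\<lambda>t. indicator {0<..<s} t * h t) has_integral I) UNIV"
      by (rule has_integral_indicator_mult)
  qed (use h in \<open>auto simp: indicator_def\<close>)
  have "(\<integral>\<^sup>+ t. ennreal (indicator {0<..<s} t * f t) \<partial>lborel)
      = (\<integral>\<^sup>+ t. ennreal (indicator {0<..<s} t * g t) \<partial>lborel)"
  proof -
    have "f \<in> borel_measurable borel" "g \<in> borel_measurable borel"
      unfolding f_def g_def by measurable
    moreover have "0 \<le> f t" "0 \<le> g t" if "0 < t" "t < s" for t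
      using that a by (auto simp: f_def g_def)
    ultimately show ?thesis using *[OF f] *[OF g] by simp
  qed
  also have "(\<lambda>t. ennreal (indicator {0<..<s} t * f t))
      = (\<lambda>t. ennreal (a + 1) * ennreal (indicator {0<..<s} t * (t powr a * (s - t) ^ Suc k)))"
    using a by (auto simp: f_def indicator_def ennreal_mult[symmetric] fun_eq_iff)
  also have "(\<lambda>t. ennreal (indicator {0<..<s} t * g t))
      = (\<lambda>t. ennreal (Suc k) * ennreal (indicator {0<..<s} t * (t powr (a + 1) * (s - t) ^ k)))"
    by (auto simp: g_def indicator_def ennreal_mult[symmetric] fun_eq_iff simp del: of_nat_Suc)
  finally show ?thesis by (simp add: nn_integral_cmult)
qed auto

text \<open>This is \<open>beta_recurrence\<close> in the variable \<open>y\<^sub>i\<close>, the length \<open>s\<close> of the interval being one minus the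
  sum of the other coordinates.\<close>

lemma nn_dirichlet_recurrence:
  fixes a :: "real ^ 'd"
  assumes a: "a $ i > -1"
  shows "ennreal (a $ i + 1) * (\<integral>\<^sup>+ y. ennreal (dirichlet a (Suc k) y) \<partial>lborel)
       = ennreal (Suc k) * (\<integral>\<^sup>+ y. ennreal (dirichlet (a + axis i 1) k y) \<partial>lborel)"
proof -
  define c where "c x = indicator {x. \<forall>j\<in>UNIV - {i}. 0 < x j} x * (\<Prod>j\<in>UNIV - {i}. x j powr (a $ j))"
      for x :: "'d \<Rightarrow> real"
  define s where "s x = 1 - (\<Sum>j\<in>UNIV - {i}. x j)" for x :: "'d \<Rightarrow> real"
  have c0: "0 \<le> c x" for x
    by (auto simp: c_def intro!: mult_nonneg_nonneg prod_nonneg)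
  have *: "dirichlet b m (\<chi> j. (x(i := t)) j)
      = c x * (indicator {0<..<s x} t * (t powr (b $ i) * (s x - t) ^ m))"
    if b: "\<And>j. j \<noteq> i \<Longrightarrow> b $ j = a $ j" for b m x t
  proof -
    let ?y = "\<chi> j. (x(i := t)) j"
    have cs: "coord_sum ?y = t + (\<Sum>j\<in>UNIV - {i}. x j)"
      unfolding coord_sum_def by (subst sum.remove[of _ i]) (auto intro!: sum.cong)
    have pr: "(\<Prod>j\<in>UNIV. (?y $ j) powr (b $ j)) = t powr (b $ i) * (\<Prod>j\<in>UNIV - {i}. x j powr (a $ j))"
      by (subst prod.remove[of _ i]) (auto intro!: prod.cong simp: b)
    have ind: "indicator open_simplex ?y
        = (indicator {x. \<forall>j\<in>UNIV - {i}. 0 < x j} x * indicator {0<..<s x} t :: real)"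
      unfolding open_simplex_def cs s_def mem_Collect_eq indicator_def by (auto split: if_splits)
    show ?thesis
      unfolding dirichlet_def pr ind cs by (simp add: c_def s_def algebra_simps)
  qed
  have split: "(\<integral>\<^sup>+ y. ennreal (dirichlet b m y) \<partial>lborel)
    = (\<integral>\<^sup>+ x. ennreal (c x) * (\<integral>\<^sup>+ t. ennreal
        (indicator {0<..<s x} t * (t powr (b $ i) * (s x - t) ^ m)) \<partial>lborel)
        \<partial>(\<Pi>\<^sub>M j\<in>UNIV - {i}. lborel))"
    if b: "\<And>j. j \<noteq> i \<Longrightarrow> b $ j = a $ j" for b m
  proof -
    have "(\<integral>\<^sup>+ t. ennreal (dirichlet b m (\<chi> j. (x(i := t)) j)) \<partial>lborel)
      = ennreal (c x) * (\<integral>\<^sup>+ t. ennreal (indicator {0<..<s x} t * (t powr (b $ i) * (s x - t) ^ m))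
          \<partial>lborel)" for x
    proof -
      have "(\<integral>\<^sup>+ t. ennreal (dirichlet b m (\<chi> j. (x(i := t)) j)) \<partial>lborel)
        = (\<integral>\<^sup>+ t. ennreal (c x) * ennreal
            (indicator {0<..<s x} t * (t powr (b $ i) * (s x - t) ^ m)) \<partial>lborel)"
        by (subst *[OF b]) (auto simp: ennreal_mult'[OF c0])
      then show ?thesis by (simp add: nn_integral_cmult)
    qed
    then show ?thesis
      by (subst nn_integral_vec_split[where i = i]) (auto simp del: fun_upd_apply)
  qed
  have [measurable]: "c \<in> borel_measurable (\<Pi>\<^sub>M j\<in>UNIV - {i}. lborel)"
    "s \<in> borel_measurable (\<Pi>\<^sub>M j\<in>UNIV - {i}. lborel)"
    unfolding c_def s_def by measurable
  have b: "(a + axis i 1) $ j = a $ j" if "j \<noteq> i" for j using that by (simp add: axis_def)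
  have bi: "(a + axis i 1) $ i = a $ i + 1" by (simp add: axis_def)
  have split2: "(\<integral>\<^sup>+ y. ennreal (dirichlet (a + axis i 1) k y) \<partial>lborel)
    = (\<integral>\<^sup>+ x. ennreal (c x) * (\<integral>\<^sup>+ t. ennreal
        (indicator {0<..<s x} t * (t powr (a $ i + 1) * (s x - t) ^ k)) \<partial>lborel)
        \<partial>(\<Pi>\<^sub>M j\<in>UNIV - {i}. lborel))"
    using split[of "a + axis i 1" k] b by (simp add: bi)
  define G where "G e m x = ennreal (c x)
    * (\<integral>\<^sup>+ t. ennreal (indicator {0<..<s x} t * (t powr e * (s x - t) ^ m)) \<partial>lborel)" for e m x
  have [measurable]: "G e m \<in> borel_measurable (\<Pi>\<^sub>M j\<in>UNIV - {i}. lborel)" for e m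
    unfolding G_def indicator_def greaterThanLessThan_iff by measurable
  have "ennreal (a $ i + 1) * (\<integral>\<^sup>+ y. ennreal (dirichlet a (Suc k) y) \<partial>lborel)
      = (\<integral>\<^sup>+ x. ennreal (a $ i + 1) * G (a $ i) (Suc k) x \<partial>(\<Pi>\<^sub>M j\<in>UNIV - {i}. lborel))"
    unfolding split[OF refl] G_def[symmetric] by (simp add: nn_integral_cmult)
  also have "\<dots> = (\<integral>\<^sup>+ x. ennreal (Suc k) * G (a $ i + 1) k x \<partial>(\<Pi>\<^sub>M j\<in>UNIV - {i}. lborel))"
    unfolding G_def
    by (intro nn_integral_cong, subst mult.left_commute, subst beta_recurrence[OF a],
        subst mult.left_commute) simp
  also have "\<dots> = ennreal (Suc k) * (\<integral>\<^sup>+ y. ennreal (dirichlet (a + axis i 1) k y) \<partial>lborel)"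
    unfolding split2 G_def[symmetric] by (simp add: nn_integral_cmult)
  finally show ?thesis .
qed

text \<open>On the open simplex the factor \<open>(1 - |y|)\<^sup>k\<close> is at most one, so the weight is dominated by a product
  of one-dimensional functions on the unit cube.\<close>

lemma integrable_dirichlet:
  fixes a :: "real ^ 'd"
  assumes a: "\<And>i. a $ i > -1"
  shows "integrable lborel (dirichlet a k)"
proof (rule integrableI_nonneg)
  interpret P: product_sigma_finite "\<lambda>_ :: 'd. lborel :: real measure" ..
  let ?f = "\<lambda>i t. ennreal (indicator {0<..<1} t * t powr (a $ i))"
  have fin: "(\<integral>\<^sup>+ t. ?f i t \<partial>lborel) < \<infinity>" for i
  proof -
    have "((\<lambda>t. t powr (a $ i)) has_integral 1 powr (a $ i + 1) / (a $ i + 1)) {0<..<1::real}"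
      using has_integral_powr_from_0[OF a, of 1 i] by (simp add: has_integral_Icc_iff_Ioo)
    then have "((\<lambda>t. indicator {0<..<1} t * t powr (a $ i)) has_integral 1 powr (a $ i + 1) /
        (a $ i + 1)) UNIV"
      by (rule has_integral_indicator_mult)
    from nn_integral_has_integral_lborel[OF _ _ this] show ?thesis by simp
  qed
  have le: "ennreal (dirichlet a k (\<chi> j. x j)) \<le> (\<Prod>j\<in>UNIV. ?f j (x j))" for x :: "'d \<Rightarrow> real"
  proof (cases "(\<chi> j. x j) \<in> open_simplex")
    case True
    then have pos: "0 < x j" for j by (simp add: open_simplex_def)
    have cs: "(\<Sum>j\<in>UNIV. x j) < 1"
      using True by (simp add: open_simplex_def coord_sum_def)
    have "x j \<le> (\<Sum>j\<in>UNIV. x j)" for j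
      using pos by (intro member_le_sum) (auto intro: less_imp_le)
    then have lt: "x j < 1" for j using cs by (meson le_less_trans)
    have "dirichlet a k (\<chi> j. x j) = (\<Prod>j\<in>UNIV. x j powr (a $ j)) * (1 - (\<Sum>j\<in>UNIV. x j)) ^ k"
      using True by (simp add: dirichlet_def coord_sum_def)
    also have "\<dots> \<le> (\<Prod>j\<in>UNIV. x j powr (a $ j)) * 1"
      using cs by (intro mult_left_mono power_le_one prod_nonneg)
          (auto intro!: sum_nonneg less_imp_le[OF pos])
    also have "\<dots> = (\<Prod>j\<in>UNIV. indicator {0<..<1} (x j) * x j powr (a $ j))"
      using pos lt by simp
    finally have "ennreal (dirichlet a k (\<chi> j. x j)) \<le> ennreal \<dots>" by (rule ennreal_leI)
    then show ?thesis by (subst prod_ennreal) auto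
  qed (simp add: dirichlet_def)
  have "(\<integral>\<^sup>+ y. ennreal (dirichlet a k y) \<partial>lborel)
      = (\<integral>\<^sup>+ x. ennreal (dirichlet a k (\<chi> j. x j)) \<partial>(\<Pi>\<^sub>M j\<in>UNIV. lborel))"
    by (subst lborel_vec, subst nn_integral_distr[OF measurable_vec_lambda]) auto
  also have "\<dots> \<le> (\<integral>\<^sup>+ x. (\<Prod>j\<in>UNIV. ?f j (x j)) \<partial>(\<Pi>\<^sub>M j\<in>UNIV. lborel))"
    by (intro nn_integral_mono le)
  also have "\<dots> = (\<Prod>j\<in>UNIV. \<integral>\<^sup>+ t. ?f j t \<partial>lborel)"
    by (rule P.product_nn_integral_prod) auto
  also have "\<dots> < \<infinity>"
    using fin by (auto simp: less_top[symmetric] ennreal_prod_eq_top)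
  finally show "(\<integral>\<^sup>+ y. ennreal (dirichlet a k y) \<partial>lborel) < \<infinity>" .
qed (simp_all add: dirichlet_nonneg)

lemma simplex_in_cube:
  assumes "y \<in> simplex_set" shows "y \<in> cbox 0 1"
proof -
  have "y $ j \<le> coord_sum y" for j
    unfolding coord_sum_def using assms by (intro member_le_sum) (auto simp: simplex_set_def)
  then show ?thesis using assms
    by (auto simp: mem_box_cart simplex_set_def intro: order_trans)
qed

lemma open_simplex_subset: "open_simplex \<subseteq> simplex_set"
  by (auto simp: open_simplex_def simplex_set_def less_imp_le)

lemma integrable_rpoly_dirichlet:
  fixes a :: "real ^ 'd"
  assumes a: "\<And>i. a $ i > -1" and h: "rpoly h"
  shows "integrable lborel (\<lambda>y. h y * dirichlet a k y)"
proof -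
  have "bounded (h ` cbox 0 1)"
    by (intro compact_imp_bounded compact_continuous_image rpoly_continuous_on h compact_cbox)
  then obtain B where B: "\<And>y. y \<in> cbox 0 1 \<Longrightarrow> \<bar>h y\<bar> \<le> B"
    by (auto simp: bounded_iff)
  have [measurable]: "h \<in> borel_measurable borel" by (rule rpoly_measurable[OF h])
  show ?thesis
  proof (rule Bochner_Integration.integrable_bound[OF
      integrable_mult_right[OF integrable_dirichlet[OF a], of B k]])
    show "AE y in lborel. norm (h y * dirichlet a k y) \<le> norm (B * dirichlet a k y)"
    proof (intro always_eventually allI)
      fix y
      show "norm (h y * dirichlet a k y) \<le> norm (B * dirichlet a k y)"
      proof (cases "y \<in> open_simplex")
        case True
        then have "\<bar>h y\<bar> \<le> B" using B simplex_in_cube open_simplex_subset by blast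
        then show ?thesis by (auto simp: abs_mult intro!: mult_right_mono)
      qed (simp add: dirichlet_def)
    qed
  qed measurable
qed

text \<open>This relation among the moments of the Dirichlet weight is all that is used about the weight in the
  integrations by parts below.\<close>

lemma dirichlet_recurrence:
  fixes a :: "real ^ 'd"
  assumes a: "\<And>i. a $ i > -1"
  shows "(a $ i + 1) * (\<integral>y. (1 - coord_sum y) * dirichlet a k y \<partial>lborel)
       = Suc k * (\<integral>y. y $ i * dirichlet a k y \<partial>lborel)"
proof -
  have a': "(a + axis i 1) $ j > -1" for j
    using a[of j] by (auto simp: axis_def intro: less_trans)
  have "ennreal (a $ i + 1) * ennreal (\<integral>y. dirichlet a (Suc k) y \<partial>lborel)
      = ennreal (Suc k) * ennreal (\<integral>y. dirichlet (a + axis i 1) k y \<partial>lborel)"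
    using nn_dirichlet_recurrence[of a i k, OF a] integrable_dirichlet[OF a] integrable_dirichlet[OF a']
    by (simp add: nn_integral_eq_integral dirichlet_nonneg del: of_nat_Suc)
  then have "ennreal ((a $ i + 1) * (\<integral>y. dirichlet a (Suc k) y \<partial>lborel))
      = ennreal (Suc k * (\<integral>y. dirichlet (a + axis i 1) k y \<partial>lborel))"
    using a[of i] by (simp add: ennreal_mult' integral_nonneg dirichlet_nonneg del: of_nat_Suc)
  then have "(a $ i + 1) * (\<integral>y. dirichlet a (Suc k) y \<partial>lborel)
      = Suc k * (\<integral>y. dirichlet (a + axis i 1) k y \<partial>lborel)"
    using a[of i] by (subst (asm) ennreal_inj)
        (auto intro!: mult_nonneg_nonneg integral_nonneg simp: dirichlet_nonneg)
  then show ?thesis by (simp add: dirichlet_Suc dirichlet_shift)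
qed


lemma linear_functional_coords:
  fixes l :: "real ^ 'd \<Rightarrow> real"
  assumes "bounded_linear l"
  shows "l y = (\<Sum>c\<in>UNIV. l (axis c 1) * y $ c)"
proof -
  interpret bounded_linear l by fact
  have "l y = l (\<Sum>c\<in>UNIV. y $ c *\<^sub>R axis c 1)"
    using basis_expansion[of y] by (simp add: scalar_mult_eq_scaleR)
  then show ?thesis by (simp add: sum scaleR mult.commute)
qed

lemma rpoly_nth [intro, simp]: "rpoly (\<lambda>y. y $ i)"
  by (intro real_polynomial_function.intros(1) bounded_linear_vec_nth)

lemma rpoly_coord_sum [intro, simp]: "rpoly coord_sum"
  by (intro real_polynomial_function.intros(1) bounded_linear_coord_sum)

lemma rpoly_const [intro, simp]: "rpoly (\<lambda>y. c)"
  by (intro rpoly_intros)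

lemma axis_shift_gt:
  fixes a :: "real ^ 'd"
  assumes "\<And>i. a $ i > -1" shows "(a + axis c 1) $ j > -1"
  using assms[of j] by (auto simp: axis_def intro: less_trans)

text \<open>The integrand is \<open>\<partial>\<^sub>i (y\<^sub>i (1 - |y|) h w)\<close> for the weight \<open>w\<close>. For constant \<open>h\<close> the claim is
  \<open>dirichlet_recurrence\<close>. Multiplying \<open>h\<close> by \<open>y\<^sub>c\<close> has the same effect on the integrand as raising the
  exponent \<open>a\<^sub>c\<close> by one, so an induction on \<open>h\<close> for all exponents at once proves the general case; no
  boundary term has to be discussed.\<close>

lemma simplex_divergence_zero:
  fixes a :: "real ^ 'd"
  assumes "deg_less n h" "\<And>i. a $ i > -1"
  shows "(\<integral>y. (y $ i * (1 - coord_sum y) * dder (axis i 1) h y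
      + ((a $ i + 1) * (1 - coord_sum y) - Suc k * y $ i) * h y) * dirichlet a k y \<partial>lborel) = 0"
  using assms
proof (induction arbitrary: a rule: deg_less.induct)
  case (zero n)
  show ?case by (simp add: dder_const)
next
  case (const n c)
  have "integrable lborel (\<lambda>y. (1 - coord_sum y) * dirichlet a k y)"
    "integrable lborel (\<lambda>y. y $ i * dirichlet a k y)"
    by (intro integrable_rpoly_dirichlet const; auto intro!: rpoly_intros)+
  then have "(\<integral>y. c * ((a $ i + 1) * ((1 - coord_sum y) * dirichlet a k y)
      - Suc k * (y $ i * dirichlet a k y)) \<partial>lborel) = 0"
    using dirichlet_recurrence[OF const, of i k] by simp
  then show ?case by (simp add: dder_const algebra_simps)
next
  case (linear_mult l n h)
  have h: "rpoly h" and l: "rpoly l" using linear_mult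
      by (auto intro: deg_less_rpoly real_polynomial_function.intros(1))
  let ?T = "\<lambda>c y. (y $ i * (1 - coord_sum y) * dder (axis i 1) h y
      + (((a + axis c 1) $ i + 1) * (1 - coord_sum y) - Suc k * y $ i) * h y)
          * dirichlet (a + axis c 1) k y"
  have int: "integrable lborel (?T c)" for c
    by (intro integrable_rpoly_dirichlet axis_shift_gt linear_mult)
        (auto intro!: rpoly_intros rpoly_dder h)
  have "(y $ i * (1 - coord_sum y) * dder (axis i 1) (\<lambda>y. l y * h y) y
      + ((a $ i + 1) * (1 - coord_sum y) - Suc k * y $ i) * (l y * h y)) * dirichlet a k y
      = (\<Sum>c\<in>UNIV. l (axis c 1) * ?T c y)" for y
  proof -
    let ?A = "y $ i * (1 - coord_sum y) * dder (axis i 1) h y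
      + ((a $ i + 1) * (1 - coord_sum y) - Suc k * y $ i) * h y"
    have "l (axis c 1) * ?T c y = (l (axis c 1) * y $ c) * (?A * dirichlet a k y)
        + (if c = i then l (axis i 1) * y $ i * (1 - coord_sum y) * h y * dirichlet a k y else 0)" for c
      by (auto simp: dirichlet_shift axis_component algebra_simps)
    then have "(\<Sum>c\<in>UNIV. l (axis c 1) * ?T c y) = l y * (?A * dirichlet a k y)
        + l (axis i 1) * y $ i * (1 - coord_sum y) * h y * dirichlet a k y"
      by (simp add: sum.distrib sum_distrib_right[symmetric]
          linear_functional_coords[OF linear_mult(1), symmetric])
    then show ?thesis
      by (simp only: dder_mult[OF l h] dder_linear[OF linear_mult(1)]) (simp add: algebra_simps)
  qed
  moreover have "(\<integral>y. (\<Sum>c\<in>UNIV. l (axis c 1) * ?T c y) \<partial>lborel) = 0"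
    using int linear_mult.IH[OF axis_shift_gt[OF linear_mult.prems]] by simp
  ultimately show ?case by simp
next
  case (add n f g)
  let ?T = "\<lambda>h y. (y $ i * (1 - coord_sum y) * dder (axis i 1) h y
      + ((a $ i + 1) * (1 - coord_sum y) - Suc k * y $ i) * h y) * dirichlet a k y"
  have r: "rpoly f" "rpoly g" using add by (auto intro: deg_less_rpoly)
  have "integrable lborel (?T f)" "integrable lborel (?T g)"
    by (intro integrable_rpoly_dirichlet add; auto intro!: rpoly_intros rpoly_dder r)+
  then have "(\<integral>y. ?T f y + ?T g y \<partial>lborel) = 0"
    using add by simp
  then show ?case by (simp add: dder_add[OF r] algebra_simps)
qed

text \<open>The integrand is \<open>(\<partial>\<^sub>i - \<partial>\<^sub>j) (y\<^sub>i y\<^sub>j h w)\<close>. For constant \<open>h\<close>, the moments of \<open>y\<^sub>i\<close> and \<open>y\<^sub>j\<close> are compared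
  by \<open>dirichlet_recurrence\<close> through the moment of \<open>1 - |y|\<close>. The induction step is as in
  \<open>simplex_divergence_zero\<close>.\<close>

lemma simplex_exchange_zero:
  fixes a :: "real ^ 'd"
  assumes "deg_less n h" "\<And>i. a $ i > -1"
  shows "(\<integral>y. (y $ i * y $ j * (dder (axis i 1) h y - dder (axis j 1) h y)
      + ((a $ i + 1) * y $ j - (a $ j + 1) * y $ i) * h y) * dirichlet a k y \<partial>lborel) = 0"
  using assms
proof (induction arbitrary: a rule: deg_less.induct)
  case (zero n)
  show ?case by (simp add: dder_const)
next
  case (const n c)
  have int: "integrable lborel (\<lambda>y. y $ i * dirichlet a k y)" for i
    by (intro integrable_rpoly_dirichlet const) auto
  have "(a $ j + 1) * ((a $ i + 1) * (\<integral>y. (1 - coord_sum y) * dirichlet a k y \<partial>lborel))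
      = (a $ i + 1) * ((a $ j + 1) * (\<integral>y. (1 - coord_sum y) * dirichlet a k y \<partial>lborel))"
    by simp
  then have "Suc k * ((a $ i + 1) * (\<integral>y. y $ j * dirichlet a k y \<partial>lborel))
      = Suc k * ((a $ j + 1) * (\<integral>y. y $ i * dirichlet a k y \<partial>lborel))"
    unfolding dirichlet_recurrence[OF const] by (simp only: mult_ac)
  then have "(\<integral>y. c * ((a $ i + 1) * (y $ j * dirichlet a k y)
      - (a $ j + 1) * (y $ i * dirichlet a k y)) \<partial>lborel) = 0"
    using int by (simp del: of_nat_Suc)
  then show ?case by (simp add: dder_const algebra_simps)
next
  case (linear_mult l n h)
  have h: "rpoly h" and l: "rpoly l" using linear_mult
      by (auto intro: deg_less_rpoly real_polynomial_function.intros(1))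
  let ?T = "\<lambda>c y. (y $ i * y $ j * (dder (axis i 1) h y - dder (axis j 1) h y)
      + (((a + axis c 1) $ i + 1) * y $ j - ((a + axis c 1) $ j + 1) * y $ i) * h y)
          * dirichlet (a + axis c 1) k y"
  have int: "integrable lborel (?T c)" for c
    by (intro integrable_rpoly_dirichlet axis_shift_gt linear_mult)
        (auto intro!: rpoly_intros rpoly_dder h)
  have "(y $ i * y $ j * (dder (axis i 1) (\<lambda>y. l y * h y) y - dder (axis j 1) (\<lambda>y. l y * h y) y)
      + ((a $ i + 1) * y $ j - (a $ j + 1) * y $ i) * (l y * h y)) * dirichlet a k y
      = (\<Sum>c\<in>UNIV. l (axis c 1) * ?T c y)" for y
  proof -
    let ?A = "y $ i * y $ j * (dder (axis i 1) h y - dder (axis j 1) h y)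
      + ((a $ i + 1) * y $ j - (a $ j + 1) * y $ i) * h y"
    have "l (axis c 1) * ?T c y = (l (axis c 1) * y $ c) * (?A * dirichlet a k y)
        + (if c = i then l (axis i 1) * y $ i * y $ j * h y * dirichlet a k y else 0)
        - (if c = j then l (axis j 1) * y $ i * y $ j * h y * dirichlet a k y else 0)" for c
      by (auto simp: dirichlet_shift axis_component algebra_simps)
    then have "(\<Sum>c\<in>UNIV. l (axis c 1) * ?T c y) = l y * (?A * dirichlet a k y)
        + l (axis i 1) * y $ i * y $ j * h y * dirichlet a k y
        - l (axis j 1) * y $ i * y $ j * h y * dirichlet a k y"
      by (simp add: sum.distrib sum_subtractf sum_distrib_right[symmetric]
          linear_functional_coords[OF linear_mult(1), symmetric])
    then show ?thesis
      by (simp only: dder_mult[OF l h] dder_linear[OF linear_mult(1)]) (simp add: algebra_simps)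
  qed
  moreover have "(\<integral>y. (\<Sum>c\<in>UNIV. l (axis c 1) * ?T c y) \<partial>lborel) = 0"
    using int linear_mult.IH[OF axis_shift_gt[OF linear_mult.prems]] by simp
  ultimately show ?case by simp
next
  case (add n f g)
  let ?T = "\<lambda>h y. (y $ i * y $ j * (dder (axis i 1) h y - dder (axis j 1) h y)
      + ((a $ i + 1) * y $ j - (a $ j + 1) * y $ i) * h y) * dirichlet a k y"
  have r: "rpoly f" "rpoly g" using add by (auto intro: deg_less_rpoly)
  have "integrable lborel (?T f)" "integrable lborel (?T g)"
    by (intro integrable_rpoly_dirichlet add; auto intro!: rpoly_intros rpoly_dder r)+
  then have "(\<integral>y. ?T f y + ?T g y \<partial>lborel) = 0"
    using add by simp
  then show ?case by (simp add: dder_add[OF r] algebra_simps)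
qed

section \<open>The Jacobi operator of the simplex\<close>

lemma rpoly_dder_curve:
  assumes "rpoly f" "(c has_vector_derivative v) (at t within S)"
  shows "((\<lambda>t. f (c t)) has_real_derivative dder v f (c t)) (at t within S)"
proof -
  have "((\<lambda>t. f (c t)) has_derivative (\<lambda>s. dder (s *\<^sub>R v) f (c t))) (at t within S)"
    using has_derivative_compose[OF assms(2)[unfolded has_vector_derivative_def]
        rpoly_has_derivative[OF assms(1)]] .
  then show ?thesis
    by (simp add: has_field_derivative_def dder_vec_scale[OF assms(1)]
        mult.commute[of _ "dder v f (c t)"])
qed

lemma vec_eq_sum_axis: "(\<Sum>i\<in>UNIV. (y $ i) *\<^sub>R axis i 1) = (y :: real ^ 'd)"
  using basis_expansion[of y] by (simp add: scalar_mult_eq_scaleR)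

lemma dder_coords:
  fixes y :: "real ^ 'd"
  assumes "rpoly f" shows "dder v f z = (\<Sum>i\<in>UNIV. v $ i * dder (axis i 1) f z)"
proof -
  have "dder v f z = dder (\<Sum>i\<in>UNIV. (v $ i) *\<^sub>R axis i 1) f z"
    by (simp only: vec_eq_sum_axis)
  also have "\<dots> = (\<Sum>i\<in>UNIV. v $ i * dder (axis i 1) f z)"
    by (simp add: dder_vec_sum[OF assms] dder_vec_scale[OF assms])
  finally show ?thesis .
qed

lemma euler_coords:
  fixes f :: "real ^ 'd \<Rightarrow> real"
  assumes "rpoly f" shows "euler f = (\<lambda>y. \<Sum>i\<in>UNIV. y $ i * dder (axis i 1) f y)"
  unfolding euler_def by (intro ext dder_coords assms)

lemma hess_rad_coords:
  fixes f :: "real ^ 'd \<Rightarrow> real"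
  assumes "rpoly f"
  shows "hess_rad f = (\<lambda>y. \<Sum>i\<in>UNIV. \<Sum>j\<in>UNIV. y $ i * y $ j * dder (axis i 1) (dder (axis j 1) f) y)"
proof
  fix y
  have "dder y f = (\<lambda>z. \<Sum>j\<in>UNIV. y $ j * dder (axis j 1) f z)"
    by (intro ext dder_coords assms)
  then have "hess_rad f y = (\<Sum>j\<in>UNIV. y $ j * dder y (dder (axis j 1) f) y)"
    unfolding hess_rad_def
    by (simp add: dder_sum dder_mult dder_const rpoly_intros rpoly_dder assms)
  also have "\<dots> = (\<Sum>j\<in>UNIV. \<Sum>i\<in>UNIV. y $ i * y $ j * dder (axis i 1) (dder (axis j 1) f) y)"
    by (subst dder_coords[OF rpoly_dder[OF assms]]) (simp add: sum_distrib_left mult_ac)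
  also have "\<dots> = (\<Sum>i\<in>UNIV. \<Sum>j\<in>UNIV. y $ i * y $ j * dder (axis i 1) (dder (axis j 1) f) y)"
    by (rule sum.swap)
  finally show "hess_rad f y = \<dots>" .
qed

lemma rpoly_euler:
  fixes f :: "real ^ 'd \<Rightarrow> real" shows "rpoly f \<Longrightarrow> rpoly (euler f)"
  by (subst euler_coords) (auto intro!: rpoly_intros rpoly_dder)

lemma rpoly_hess_rad:
  fixes f :: "real ^ 'd \<Rightarrow> real" shows "rpoly f \<Longrightarrow> rpoly (hess_rad f)"
  by (subst hess_rad_coords) (auto intro!: rpoly_intros rpoly_dder)

text \<open>This is the second order operator whose eigenfunctions are the orthogonal polynomials for the
  weight \<open>dirichlet a k\<close>. It is usually written with the square of the Euler operator; replacing
  \<open>E\<^sup>2\<close> by \<open>hess_rad + euler\<close> adds one to the coefficient of \<open>euler\<close>.\<close>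

definition simplex_op :: "real ^ 'd \<Rightarrow> nat \<Rightarrow> (real ^ 'd \<Rightarrow> real) \<Rightarrow> real ^ 'd \<Rightarrow> real" where
  "simplex_op a k f y =
     (\<Sum>i\<in>UNIV. y $ i * dder (axis i 1) (dder (axis i 1) f) y + (a $ i + 1) * dder (axis i 1) f y)
     - hess_rad f y - (coord_sum a + real CARD('d) + real k + 1) * euler f y"

lemma rpoly_simplex_op: "rpoly f \<Longrightarrow> rpoly (simplex_op a k f)"
  unfolding simplex_op_def by (auto intro!: rpoly_intros rpoly_dder rpoly_euler rpoly_hess_rad)

text \<open>The pointwise form of the integration by parts. Here \<open>Y\<close>, \<open>F\<close>, \<open>G\<close> and \<open>H\<close> stand for the
  coordinates of a point, the gradients of \<open>f\<close> and \<open>g\<close>,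
      and the Hessian of \<open>g\<close>. The left side consists of the
  integrands of \<open>simplex_divergence_zero\<close> for \<open>f \<partial>\<^sub>i g\<close> and of \<open>simplex_exchange_zero\<close> for
  \<open>f (\<partial>\<^sub>i g - \<partial>\<^sub>j g)\<close>; the last summand of the right side is symmetric in \<open>F\<close> and \<open>G\<close>.\<close>

lemma simplex_op_sum_identity:
  fixes Y F G A :: "'d::finite \<Rightarrow> real" and H :: "'d \<Rightarrow> 'd \<Rightarrow> real"
  assumes H: "\<And>i j. H i j = H j i"
  defines "s \<equiv> \<Sum>i\<in>UNIV. Y i"
  shows "(\<Sum>i\<in>UNIV. Y i * (1 - s) * (f * H i i + F i * G i)
      + ((A i + 1) * (1 - s) - (k + 1) * Y i) * (f * G i))
     + (\<Sum>i\<in>UNIV. \<Sum>j\<in>UNIV. Y i * Y j * ((f * (H i i - H i j) + F i * (G i - G j))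
         - (f * (H j i - H j j) + F j * (G i - G j)))
          + ((A i + 1) * Y j - (A j + 1) * Y i) * (f * (G i - G j))) / 2
   = f * ((\<Sum>i\<in>UNIV. Y i * H i i + (A i + 1) * G i) - (\<Sum>i\<in>UNIV. \<Sum>j\<in>UNIV. Y i * Y j * H i j)
         - ((\<Sum>i\<in>UNIV. A i) + real CARD('d) + k + 1) * (\<Sum>i\<in>UNIV. Y i * G i))
     + ((1 - s) * (\<Sum>i\<in>UNIV. Y i * F i * G i)
         + (\<Sum>i\<in>UNIV. \<Sum>j\<in>UNIV. Y i * Y j * (F i - F j) * (G i - G j)) / 2)"
proof -
  define A1 where "A1 i = A i + 1" for i
  have sA1: "(\<Sum>i\<in>UNIV. A1 i) = (\<Sum>i\<in>UNIV. A i) + real CARD('d)"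
    by (simp add: A1_def sum.distrib)
  have Ak: "((\<Sum>i\<in>UNIV. A i) + real CARD('d) + k + 1) = sum A1 UNIV + k + 1"
    by (simp add: sA1)
  have e: "Y i * Y j * ((f * (H i i - H i j) + F i * (G i - G j))
      - (f * (H j i - H j j) + F j * (G i - G j)))
          + (A1 i * Y j - A1 j * Y i) * (f * (G i - G j))
     = f * ((Y i * H i i) * Y j + Y i * (Y j * H j j) - 2 * (Y i * Y j * H i j)
         + (A1 i * G i) * Y j + Y i * (A1 j * G j) - A1 i * (Y j * G j) - (Y i * G i) * A1 j)
       + Y i * Y j * (F i - F j) * (G i - G j)" for i j
    using H[of j i] by (simp add: algebra_simps)
  have "(\<Sum>i\<in>UNIV. \<Sum>j\<in>UNIV. Y i * Y j * ((f * (H i i - H i j) + F i * (G i - G j))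
      - (f * (H j i - H j j) + F j * (G i - G j)))
          + (A1 i * Y j - A1 j * Y i) * (f * (G i - G j)))
     = f * (2 * s * (\<Sum>i\<in>UNIV. Y i * H i i) - 2 * (\<Sum>i\<in>UNIV. \<Sum>j\<in>UNIV. Y i * Y j * H i j)
         + 2 * s * (\<Sum>i\<in>UNIV. A1 i * G i) - 2 * sum A1 UNIV * (\<Sum>i\<in>UNIV. Y i * G i))
       + (\<Sum>i\<in>UNIV. \<Sum>j\<in>UNIV. Y i * Y j * (F i - F j) * (G i - G j))"
    unfolding e
    by (simp only: sum.distrib sum_subtractf sum_distrib_left[symmetric] sum_distrib_right[symmetric]
        s_def)
       (simp add: algebra_simps)
  moreover have "(\<Sum>i\<in>UNIV. Y i * (1 - s) * (f * H i i + F i * G i)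
      + (A1 i * (1 - s) - (k + 1) * Y i) * (f * G i))
    = f * ((1 - s) * (\<Sum>i\<in>UNIV. Y i * H i i) + (1 - s) * (\<Sum>i\<in>UNIV. A1 i * G i)
        - (k + 1) * (\<Sum>i\<in>UNIV. Y i * G i))
      + (1 - s) * (\<Sum>i\<in>UNIV. Y i * F i * G i)"
    by (simp add: sum_distrib_left sum.distrib[symmetric] sum_subtractf[symmetric] algebra_simps)
  moreover have "(\<Sum>i\<in>UNIV. Y i * H i i + A1 i * G i) = (\<Sum>i\<in>UNIV. Y i * H i i) + (\<Sum>i\<in>UNIV. A1 i * G i)"
    by (rule sum.distrib)
  ultimately show ?thesis
    unfolding A1_def[symmetric] Ak by (simp only:) (simp add: field_simps)
qed

text \<open>By \<open>simplex_op_sum_identity\<close>, the integral of \<open>f\<close> times the operator applied to \<open>g\<close> is minus the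
  Dirichlet form of \<open>f\<close> and \<open>g\<close>, called \<open>S\<close> below.\<close>

lemma simplex_op_symmetric:
  fixes a :: "real ^ 'd"
  assumes a: "\<And>i. a $ i > -1" and f: "rpoly f" and g: "rpoly g"
  shows "(\<integral>y. f y * simplex_op a k g y * dirichlet a k y \<partial>lborel)
       = (\<integral>y. g y * simplex_op a k f y * dirichlet a k y \<partial>lborel)"
proof -
  define S where "S f g y = (1 - coord_sum y)
      * (\<Sum>i\<in>UNIV. y $ i * dder (axis i 1) f y * dder (axis i 1) g y)
     + (\<Sum>i\<in>UNIV. \<Sum>j\<in>UNIV. y $ i * y $ j * (dder (axis i 1) f y - dder (axis j 1) f y)
          * (dder (axis i 1) g y - dder (axis j 1) g y)) / 2" for f g :: "real ^ 'd \<Rightarrow> real" and y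
  have *: "(\<integral>y. f y * simplex_op a k g y * dirichlet a k y \<partial>lborel)
      = - (\<integral>y. S f g y * dirichlet a k y \<partial>lborel)"
    if f: "rpoly f" and g: "rpoly g" for f g
  proof -
    note r = rpoly_intros rpoly_dder f g
    have rS: "rpoly (S f g)" unfolding S_def by (auto intro!: r)
    have rfg: "rpoly (\<lambda>y. f y * simplex_op a k g y)" by (auto intro!: r rpoly_simplex_op)
    define I where "I i y = (y $ i * (1 - coord_sum y)
        * dder (axis i 1) (\<lambda>y. f y * dder (axis i 1) g y) y
      + ((a $ i + 1) * (1 - coord_sum y) - Suc k * y $ i) * (f y * dder (axis i 1) g y))" for i y
    define J where "J i j y = y $ i * y $ j
        * (dder (axis i 1) (\<lambda>y. f y * (dder (axis i 1) g y - dder (axis j 1) g y)) y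
          - dder (axis j 1) (\<lambda>y. f y * (dder (axis i 1) g y - dder (axis j 1) g y)) y)
      + ((a $ i + 1) * y $ j - (a $ j + 1) * y $ i)
          * (f y * (dder (axis i 1) g y - dder (axis j 1) g y))" for i j y
    have rI: "rpoly (I i)" and rJ: "rpoly (J i j)" for i j
      unfolding I_def J_def by (auto intro!: r)
    have I0: "(\<integral>y. I i y * dirichlet a k y \<partial>lborel) = 0" for i
    proof -
      have "rpoly (\<lambda>y. f y * dder (axis i 1) g y)" by (auto intro!: r)
      then obtain n where "deg_less n (\<lambda>y. f y * dder (axis i 1) g y)" using rpoly_imp_deg_less by blast
      from simplex_divergence_zero[OF this a, of i k] show ?thesis unfolding I_def .
    qed
    have J0: "(\<integral>y. J i j y * dirichlet a k y \<partial>lborel) = 0" for i j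
    proof -
      have "rpoly (\<lambda>y. f y * (dder (axis i 1) g y - dder (axis j 1) g y))" by (auto intro!: r)
      then obtain n where "deg_less n (\<lambda>y. f y * (dder (axis i 1) g y - dder (axis j 1) g y))"
          using rpoly_imp_deg_less by blast
      from simplex_exchange_zero[OF this a, of i j k] show ?thesis unfolding J_def .
    qed
    have sum_eq: "f y * simplex_op a k g y + S f g y
        = (\<Sum>i\<in>UNIV. I i y) + (\<Sum>i\<in>UNIV. \<Sum>j\<in>UNIV. J i j y) / 2" for y
      unfolding I_def J_def S_def simplex_op_def euler_coords[OF g] hess_rad_coords[OF g]
      using simplex_op_sum_identity[of "\<lambda>i j. dder (axis i 1) (dder (axis j 1) g) y" "\<lambda>i. y $ i" "f y"
          "\<lambda>i. dder (axis i 1) f y"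
          "\<lambda>i. dder (axis i 1) g y" "\<lambda>i. a $ i" "real k"]
      by (simp add: dder_mult dder_diff r dder_commute[OF g] coord_sum_def add.commute[of 1])
    have eq: "f y * simplex_op a k g y * dirichlet a k y + S f g y * dirichlet a k y
        = (\<Sum>i\<in>UNIV. I i y * dirichlet a k y) + (\<Sum>i\<in>UNIV. \<Sum>j\<in>UNIV. J i j y * dirichlet a k y) / 2" for y
      using arg_cong[OF sum_eq[of y], of "\<lambda>t. t * dirichlet a k y"]
      by (simp add: sum_distrib_right distrib_right)
    have "(\<integral>y. f y * simplex_op a k g y * dirichlet a k y + S f g y * dirichlet a k y \<partial>lborel) = 0"
      unfolding eq using integrable_rpoly_dirichlet[OF a rI] integrable_rpoly_dirichlet[OF a rJ] I0 J0
          by simp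
    then show ?thesis
      using integrable_rpoly_dirichlet[OF a rfg] integrable_rpoly_dirichlet[OF a rS] by simp
  qed
  have "S f g = S g f"
    unfolding S_def by (simp add: mult_ac fun_eq_iff)
  then show ?thesis using *[OF f g] *[OF g f] by simp
qed


section \<open>Rotations in a coordinate plane\<close>

definition shear :: "'d \<Rightarrow> 'd \<Rightarrow> real \<Rightarrow> real ^ 'd \<Rightarrow> real ^ 'd" where
  "shear i j c x = x + (c * x $ j) *\<^sub>R axis i 1"

lemma borel_shear [measurable]: "shear i j c \<in> borel_measurable borel"
  unfolding shear_def by (intro borel_measurable_continuous_onI continuous_intros)

text \<open>On each line in the direction of the coordinate \<open>i\<close> a shear is a translation.\<close>

lemma distr_lborel_shear:
  fixes i j :: "'d::finite"
  assumes "i \<noteq> j"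
  shows "distr lborel borel (shear i j c) = lborel"
proof (rule measure_eqI)
  fix A :: "(real ^ 'd) set" assume "A \<in> sets (distr lborel borel (shear i j c))"
  then have A [measurable]: "A \<in> sets borel" by simp
  have "emeasure (distr lborel borel (shear i j c)) A = (\<integral>\<^sup>+ x. indicator A (shear i j c x) \<partial>lborel)"
    by (subst nn_integral_indicator[symmetric], simp, subst nn_integral_distr) auto
  also have "\<dots> = (\<integral>\<^sup>+ x. (\<integral>\<^sup>+ t. indicator A (shear i j c (\<chi> k. (x(i := t)) k)) \<partial>lborel)
      \<partial>(\<Pi>\<^sub>M j\<in>UNIV - {i}. lborel))"
    by (rule nn_integral_vec_split) measurable
  also have "\<dots> = (\<integral>\<^sup>+ x. (\<integral>\<^sup>+ t. indicator A (\<chi> k. (x(i := t)) k) \<partial>lborel) \<partial>(\<Pi>\<^sub>M j\<in>UNIV - {i}. lborel))"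
  proof (rule nn_integral_cong)
    fix x :: "'d \<Rightarrow> real"
    have eq: "shear i j c (\<chi> k. (x(i := t)) k) = (\<chi> k. (x(i := c * x j + 1 * t)) k)" for t
      using assms by (auto simp: shear_def vec_eq_iff axis_component)
    have [measurable]: "(\<lambda>t. \<chi> k. (x(i := t)) k) \<in> borel_measurable borel"
    proof -
      have "(\<lambda>t. \<chi> k. (x(i := t)) k) = (\<lambda>t. (\<chi> k. (x(i := 0)) k) + t *\<^sub>R axis i 1)"
        by (auto simp: fun_eq_iff vec_eq_iff axis_component)
      then show ?thesis by simp
    qed
    show "(\<integral>\<^sup>+ t. indicator A (shear i j c (\<chi> k. (x(i := t)) k)) \<partial>lborel)
        = (\<integral>\<^sup>+ t. indicator A (\<chi> k. (x(i := t)) k) \<partial>lborel)"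
      unfolding eq
      using nn_integral_real_affine[of "\<lambda>t. indicator A (\<chi> k. (x(i := t)) k)" 1 "c * x j"]
      by (simp del: fun_upd_apply)
  qed
  also have "\<dots> = (\<integral>\<^sup>+ x. indicator A x \<partial>lborel)"
    by (rule nn_integral_vec_split[symmetric]) measurable
  finally show "emeasure (distr lborel borel (shear i j c)) A = emeasure lborel A" by simp
qed simp

definition rot :: "'d \<Rightarrow> 'd \<Rightarrow> real \<Rightarrow> real ^ 'd \<Rightarrow> real ^ 'd" where
  "rot i j \<theta> x = x + ((cos \<theta> - 1) * x $ i - sin \<theta> * x $ j) *\<^sub>R axis i 1
                   + (sin \<theta> * x $ i + (cos \<theta> - 1) * x $ j) *\<^sub>R axis j 1"

lemma continuous_on_rot [continuous_intros]:
  fixes S :: "'a::t2_space set"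
  shows "continuous_on S t \<Longrightarrow> continuous_on S f \<Longrightarrow> continuous_on S (\<lambda>z. rot i j (t z) (f z))"
  unfolding rot_def by (intro continuous_intros)

lemma borel_rot [measurable]: "rot i j \<theta> \<in> borel_measurable borel"
  by (intro borel_measurable_continuous_onI continuous_intros)

lemma norm_rot:
  assumes "i \<noteq> j" shows "norm (rot i j \<theta> x) = norm x"
proof -
  define a where "a = (cos \<theta> - 1) * x $ i - sin \<theta> * x $ j"
  define b where "b = sin \<theta> * x $ i + (cos \<theta> - 1) * x $ j"
  have "rot i j \<theta> x \<bullet> rot i j \<theta> x = x \<bullet> x + (2 * a * x $ i + 2 * b * x $ j + a\<^sup>2 + b\<^sup>2)"
    using assms unfolding rot_def a_def[symmetric] b_def[symmetric]
    by (simp add: inner_add_left inner_add_right inner_axis inner_axis' axis_component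
        power2_eq_square algebra_simps)
  also have "2 * a * x $ i + 2 * b * x $ j + a\<^sup>2 + b\<^sup>2
      = ((x $ i)\<^sup>2 + (x $ j)\<^sup>2) * ((sin \<theta>)\<^sup>2 + (cos \<theta>)\<^sup>2 - 1)"
    unfolding a_def b_def by algebra
  finally show ?thesis by (simp add: norm_eq_sqrt_inner)
qed

lemma rot_scale: "rot i j \<theta> (c *\<^sub>R x) = c *\<^sub>R rot i j \<theta> x"
  by (simp add: rot_def algebra_simps)

lemma rot_sgn: "i \<noteq> j \<Longrightarrow> rot i j \<theta> (sgn x) = sgn (rot i j \<theta> x)"
  by (simp add: sgn_div_norm rot_scale norm_rot)

text \<open>The classical factorization of a plane rotation. It reduces the invariance of Lebesgue measure
  under rotations to shears; the half turn is excluded because \<open>t = tan (\<theta> / 2)\<close>.\<close>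

lemma rot_eq_shears:
  assumes "i \<noteq> j" "cos \<theta> \<noteq> -1"
  defines "t \<equiv> sin \<theta> / (1 + cos \<theta>)"
  shows "rot i j \<theta> = shear i j (- t) \<circ> shear j i (sin \<theta>) \<circ> shear i j (- t)"
proof
  fix x
  have nz: "1 + cos \<theta> \<noteq> 0" using assms(2) by auto
  have 1: "sin \<theta> * t = 1 - cos \<theta>"
    using nz sin_cos_squared_add[of \<theta>] unfolding t_def
    by (simp add: field_simps power2_eq_square)
  have 2: "t * cos \<theta> = sin \<theta> - t"
    using nz unfolding t_def by (simp add: field_simps)
  have xj: "x $ j + sin \<theta> * (x $ i - t * x $ j) = sin \<theta> * x $ i + cos \<theta> * x $ j"
  proof -
    have "x $ j + sin \<theta> * (x $ i - t * x $ j) = sin \<theta> * x $ i + (1 - sin \<theta> * t) * x $ j"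
      by (simp add: algebra_simps)
    then show ?thesis by (simp add: 1)
  qed
  have xi: "x $ i - t * x $ j - t * (sin \<theta> * x $ i + cos \<theta> * x $ j) = cos \<theta> * x $ i - sin \<theta> * x $ j"
  proof -
    have "x $ i - t * x $ j - t * (sin \<theta> * x $ i + cos \<theta> * x $ j)
      = (1 - sin \<theta> * t) * x $ i - (t + t * cos \<theta>) * x $ j" by (simp add: algebra_simps)
    then show ?thesis by (simp add: 1 2)
  qed
  define x' where "x' = shear i j (- t) x"
  define x'' where "x'' = shear j i (sin \<theta>) x'"
  have x': "x' $ k = (if k = i then x $ i - t * x $ j else x $ k)" for k
    using assms(1) by (auto simp: x'_def shear_def axis_component)
  have x'': "x'' $ k = (if k = j then sin \<theta> * x $ i + cos \<theta> * x $ j else x' $ k)" for k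
    using assms(1) by (auto simp: x''_def shear_def axis_component x' xj)
  have "shear i j (- t) x'' $ k = (if k = i then cos \<theta> * x $ i - sin \<theta> * x $ j else x'' $ k)" for k
    using assms(1) by (auto simp: shear_def axis_component x'' x' xi)
  moreover have "rot i j \<theta> x $ k = (if k = i then cos \<theta> * x $ i - sin \<theta> * x $ j
      else if k = j then sin \<theta> * x $ i + cos \<theta> * x $ j else x $ k)" for k
    using assms(1) by (auto simp: rot_def axis_component algebra_simps)
  ultimately show "rot i j \<theta> x = (shear i j (- t) \<circ> shear j i (sin \<theta>) \<circ> shear i j (- t)) x"
    by (simp add: vec_eq_iff x''_def[symmetric] x'_def[symmetric]) (auto simp: x'' x')
qed

lemma distr_lborel_rot:
  assumes "i \<noteq> j" "cos \<theta> \<noteq> -1"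
  shows "distr lborel borel (rot i j \<theta>) = lborel"
proof -
  let ?t = "sin \<theta> / (1 + cos \<theta>)"
  have "distr lborel borel (rot i j \<theta>)
    = distr (distr (distr lborel borel (shear i j (- ?t))) borel (shear j i (sin \<theta>))) borel
        (shear i j (- ?t))"
    unfolding rot_eq_shears[OF assms] by (simp add: distr_distr comp_assoc)
  then show ?thesis using assms(1) by (simp add: distr_lborel_shear)
qed

text \<open>The infinitesimal rotation in the plane of the coordinates \<open>i\<close> and \<open>j\<close>.\<close>

definition rot_dder :: "'d \<Rightarrow> 'd \<Rightarrow> (real ^ 'd \<Rightarrow> real) \<Rightarrow> real ^ 'd \<Rightarrow> real" where
  "rot_dder i j h x = x $ i * dder (axis j 1) h x - x $ j * dder (axis i 1) h x"

lemma rpoly_rot_dder: "rpoly h \<Longrightarrow> rpoly (rot_dder i j h)"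
  unfolding rot_dder_def by (auto intro!: rpoly_intros rpoly_dder)

lemma rot_dder_curve:
  assumes "rpoly h" "i \<noteq> j"
  shows "((\<lambda>\<theta>. h (rot i j \<theta> x)) has_real_derivative rot_dder i j h (rot i j \<theta> x)) (at \<theta> within S)"
proof -
  let ?r = "rot i j \<theta> x"
  have "((\<lambda>\<theta>. rot i j \<theta> x) has_vector_derivative ((?r $ i) *\<^sub>R axis j 1 - (?r $ j) *\<^sub>R axis i 1))
      (at \<theta> within S)"
    unfolding rot_def using assms(2)
    by (auto intro!: derivative_eq_intros simp: axis_component algebra_simps)
  from rpoly_dder_curve[OF assms(1) this] show ?thesis
    by (simp add: dder_vec_diff[OF assms(1)] dder_vec_scale[OF assms(1)] rot_dder_def)
qed

section \<open>Integration over the unit sphere\<close>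

definition unit_ball :: "(real ^ 'm) measure" where
  "unit_ball = restrict_space lborel (cball 0 1)"

lemma finite_measure_unit_ball: "finite_measure (unit_ball :: (real ^ 'm) measure)"
proof (rule finite_measureI)
  have "emeasure (unit_ball :: (real ^ 'm) measure) (space unit_ball)
      = emeasure lborel (cball 0 1 :: (real ^ 'm) set)"
    unfolding unit_ball_def by (subst emeasure_restrict_space) auto
  then show "emeasure (unit_ball :: (real ^ 'm) measure) (space unit_ball) \<noteq> \<infinity>"
    using emeasure_bounded_finite[OF bounded_cball, of "0 :: real ^ 'm" 1] by auto
qed

lemma measurable_unit_ball: "f \<in> borel_measurable borel \<Longrightarrow> f \<in> borel_measurable unit_ball"
  unfolding unit_ball_def by (intro measurable_restrict_space1) simp

lemma measurable_sgn_unit_ball [measurable]: "(sgn :: real ^ 'm \<Rightarrow> _) \<in> unit_ball \<rightarrow>\<^sub>M borel"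
  by (rule measurable_unit_ball) measurable

text \<open>In this form the library's rules for \<open>density\<close> and \<open>distr\<close> apply.\<close>

lemma sphere_measure_density:
  "sphere_measure = density (distr (unit_ball :: (real ^ 'm) measure) borel sgn)
      (\<lambda>_. ennreal (real CARD('m)))"
  unfolding sphere_measure_def unit_ball_def[symmetric]
  by (rule measure_eqI) (auto simp: emeasure_density_const ennreal_of_nat_eq_real_of_nat)

lemma sets_sphere_measure [measurable_cong, simp]: "sets sphere_measure = sets borel"
  by (simp add: sphere_measure_density)

lemma space_sphere_measure [simp]: "space sphere_measure = UNIV"
  by (simp add: sphere_measure_density)

lemma integral_sphere:
  fixes F :: "real ^ 'm \<Rightarrow> real"
  assumes [measurable]: "F \<in> borel_measurable borel"
  shows "integral\<^sup>L sphere_measure F = real CARD('m) * (\<integral>x. F (sgn x) \<partial>unit_ball)"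
  unfolding sphere_measure_density by (subst integral_density) (auto simp: integral_distr)

lemma finite_measure_sphere: "finite_measure (sphere_measure :: (real ^ 'm) measure)"
proof (rule finite_measureI)
  interpret finite_measure "unit_ball :: (real ^ 'm) measure" by (rule finite_measure_unit_ball)
  show "emeasure (sphere_measure :: (real ^ 'm) measure) (space sphere_measure) \<noteq> \<infinity>"
    unfolding sphere_measure_density
    by (simp add: emeasure_density_const emeasure_distr ennreal_mult_eq_top_iff)
qed

lemma AE_sphere_norm: "AE \<xi> in (sphere_measure :: (real ^ 'm) measure). norm \<xi> = 1"
proof -
  have "AE x in (unit_ball :: (real ^ 'm) measure). norm (sgn x) = 1"
    unfolding unit_ball_def using AE_lborel_singleton[of "0 :: real ^ 'm"]
    by (subst AE_restrict_space_iff) (auto simp: norm_sgn elim!: eventually_mono)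
  then have "AE \<xi> in distr (unit_ball :: (real ^ 'm) measure) borel sgn. norm \<xi> = 1"
    by (subst AE_distr_iff) auto
  then show ?thesis
    unfolding sphere_measure_density by (subst AE_density) (auto elim!: eventually_mono)
qed

lemma continuous_bounded_on_unit_ball:
  fixes F :: "real ^ 'm \<Rightarrow> real"
  assumes "continuous_on UNIV F"
  obtains B where "\<And>x. norm x \<le> 1 \<Longrightarrow> \<bar>F x\<bar> \<le> B"
proof -
  have "bounded (F ` cball 0 1)"
    by (intro compact_imp_bounded compact_continuous_image compact_cball
        continuous_on_subset[OF assms]) auto
  then obtain B where "\<forall>x\<in>cball 0 1. \<bar>F x\<bar> \<le> B" by (auto simp: bounded_iff)
  then show ?thesis using that[of B] by (simp add: mem_cball_0)
qed

lemma integrable_sphere_continuous: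
  fixes F :: "real ^ 'm \<Rightarrow> real"
  assumes "continuous_on UNIV F" shows "integrable sphere_measure F"
proof -
  interpret finite_measure "sphere_measure :: (real ^ 'm) measure" by (rule finite_measure_sphere)
  obtain B where B: "\<And>x. norm x \<le> 1 \<Longrightarrow> \<bar>F x\<bar> \<le> B"
    using continuous_bounded_on_unit_ball[OF assms] by blast
  show ?thesis
  proof (rule integrable_const_bound[where B = B])
    show "AE x in sphere_measure. norm (F x) \<le> B"
      using AE_sphere_norm by eventually_elim (use B in auto)
    show "F \<in> borel_measurable sphere_measure"
      using borel_measurable_continuous_onI[OF assms] by (simp cong: measurable_cong_sets)
  qed
qed

lemma integral_unit_ball_rot:
  fixes F :: "real ^ 'm \<Rightarrow> real"
  assumes "i \<noteq> j" "cos \<theta> \<noteq> -1" and [measurable]: "F \<in> borel_measurable borel"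
  shows "(\<integral>x. F (rot i j \<theta> x) \<partial>unit_ball) = (\<integral>x. F x \<partial>unit_ball)"
proof -
  have "(\<integral>x. F x \<partial>unit_ball) = (\<integral>x. indicator (cball 0 1) x *\<^sub>R F x \<partial>distr lborel borel (rot i j \<theta>))"
    unfolding unit_ball_def distr_lborel_rot[OF assms(1,2)] by (subst integral_restrict_space) auto
  also have "\<dots> = (\<integral>x. indicator (cball 0 1) (rot i j \<theta> x) *\<^sub>R F (rot i j \<theta> x) \<partial>lborel)"
    using assms(3) by (intro integral_distr borel_measurable_scaleR borel_measurable_indicator
        borel_rot) auto
  also have "\<dots> = (\<integral>x. indicator (cball 0 1) x *\<^sub>R F (rot i j \<theta> x) \<partial>lborel)"
    by (simp add: indicator_def norm_rot[OF assms(1)])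
  also have "\<dots> = (\<integral>x. F (rot i j \<theta> x) \<partial>unit_ball)"
    unfolding unit_ball_def by (subst integral_restrict_space) auto
  finally show ?thesis ..
qed

text \<open>Integrate \<open>rot_dder i j h\<close> along the orbit of a point under the rotations by the angles from \<open>0\<close> to
  \<open>1\<close>. Along a single orbit this gives the difference of the values of \<open>h\<close> at the two ends. Averaged
  over the sphere, that difference is zero and, by Fubini's theorem, the integral is the one in
  question, both by rotation invariance.\<close>

lemma integral_sphere_rot_dder:
  fixes h :: "real ^ 'm \<Rightarrow> real"
  assumes h: "rpoly h"
  shows "(\<integral>\<xi>. rot_dder i j h \<xi> \<partial>sphere_measure) = 0"
proof (cases "i = j")
  case True
  then show ?thesis by (simp add: rot_dder_def)
next
  case ij: False
  let ?D = "rot_dder i j h"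
  let ?L = "restrict_space lborel {0..1::real}"
  have [measurable]: "h \<in> borel_measurable borel" "?D \<in> borel_measurable borel"
    by (intro rpoly_measurable rpoly_rot_dder h)+
  \<comment> \<open>The interval \<open>{0..1}\<close> stays away from the half turn, which \<open>integral_unit_ball_rot\<close> excludes.\<close>
  have cos: "cos \<theta> \<noteq> -1" if "\<theta> \<in> {0..1}" for \<theta> :: real
    using cos_gt_zero_pi[of \<theta>] that pi_gt3 by auto
  interpret C: finite_measure "unit_ball :: (real ^ 'm) measure" by (rule finite_measure_unit_ball)
  interpret L: finite_measure ?L
    by (rule finite_measureI) (simp add: emeasure_restrict_space space_restrict_space)
  interpret P: pair_sigma_finite "unit_ball :: (real ^ 'm) measure" ?L ..
  interpret CL: finite_measure "(unit_ball :: (real ^ 'm) measure) \<Otimes>\<^sub>M ?L"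
    by (rule finite_measure_pair_measure[OF L.finite_measure_axioms C.finite_measure_axioms])
  have int: "integrable (unit_ball \<Otimes>\<^sub>M ?L) (\<lambda>(x, \<theta>). ?D (rot i j \<theta> (sgn x)))"
  proof -
    obtain B where B: "\<And>x. norm x \<le> 1 \<Longrightarrow> \<bar>?D x\<bar> \<le> B"
      using continuous_bounded_on_unit_ball[OF rpoly_continuous_on[OF rpoly_rot_dder[OF h]]] by blast
    have "norm (sgn x) \<le> 1" for x :: "real ^ 'm" by (simp add: norm_sgn)
    then have "\<bar>?D (rot i j \<theta> (sgn x))\<bar> \<le> B" for x \<theta>
      by (intro B) (simp add: norm_rot[OF ij])
    moreover have "(\<lambda>(x, \<theta>). ?D (rot i j \<theta> (sgn x))) \<in> borel_measurable (unit_ball \<Otimes>\<^sub>M ?L)"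
    proof -
      have "(\<lambda>z :: real \<times> (real ^ 'm). rot i j (fst z) (snd z)) \<in> borel_measurable borel"
        by (intro borel_measurable_continuous_onI continuous_intros)
      then have [measurable]: "(\<lambda>z. rot i j (fst z) (snd z))
          \<in> borel \<Otimes>\<^sub>M borel \<rightarrow>\<^sub>M (borel :: (real ^ 'm) measure)"
        by (simp add: borel_prod)
      have [measurable]: "(\<lambda>z. (snd z, sgn (fst z)))
          \<in> unit_ball \<Otimes>\<^sub>M ?L \<rightarrow>\<^sub>M borel \<Otimes>\<^sub>M (borel :: (real ^ 'm) measure)"
        by (intro measurable_Pair measurable_compose[OF measurable_fst]
            measurable_compose[OF measurable_snd]
            measurable_sgn_unit_ball measurable_restrict_space1) auto
      have "(\<lambda>z. ?D ((\<lambda>z. rot i j (fst z) (snd z)) (snd z, sgn (fst z))))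
          \<in> borel_measurable (unit_ball \<Otimes>\<^sub>M ?L)"
        by measurable
      then show ?thesis by (simp add: case_prod_beta)
    qed
    ultimately show ?thesis
      by (intro CL.integrable_const_bound[where B = B]) auto
  qed
  have inner: "(\<integral>\<theta>. ?D (rot i j \<theta> \<xi>) \<partial>?L) = h (rot i j 1 \<xi>) - h \<xi>" for \<xi>
  proof -
    have "(\<integral>\<theta>. ?D (rot i j \<theta> \<xi>) \<partial>?L) = (\<integral>\<theta>. indicator {0..1} \<theta> *\<^sub>R ?D (rot i j \<theta> \<xi>) \<partial>lborel)"
      by (subst integral_restrict_space) auto
    also have "\<dots> = h (rot i j 1 \<xi>) - h (rot i j 0 \<xi>)"
    proof (rule integral_FTC_Icc)
      show "((\<lambda>\<theta>. h (rot i j \<theta> \<xi>)) has_vector_derivative ?D (rot i j \<theta> \<xi>)) (at \<theta> within {0..1})" for \<theta>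
        using rot_dder_curve[OF h ij] by (simp add: has_real_derivative_iff_has_vector_derivative)
      show "continuous_on {0..1} (\<lambda>\<theta>. ?D (rot i j \<theta> \<xi>))"
        by (rule continuous_on_compose2[OF rpoly_continuous_on[OF rpoly_rot_dder[OF h], of UNIV]])
           (auto intro!: continuous_intros)
    qed simp
    also have "rot i j 0 \<xi> = \<xi>" by (simp add: rot_def)
    finally show ?thesis .
  qed
  have inth: "integrable unit_ball (\<lambda>x. h (sgn x))" "integrable unit_ball (\<lambda>x. h (rot i j 1 (sgn x)))"
  proof -
    obtain B where B: "\<And>x. norm x \<le> 1 \<Longrightarrow> \<bar>h x\<bar> \<le> B"
      using continuous_bounded_on_unit_ball[OF rpoly_continuous_on[OF h]] by blast
    have "norm (sgn x) \<le> 1" for x :: "real ^ 'm" by (simp add: norm_sgn)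
    then have "\<bar>h (sgn x)\<bar> \<le> B" "\<bar>h (rot i j 1 (sgn x))\<bar> \<le> B" for x
      by (auto intro!: B simp: norm_rot[OF ij])
    then show "integrable unit_ball (\<lambda>x. h (sgn x))" "integrable unit_ball (\<lambda>x. h (rot i j 1 (sgn x)))"
      by (intro C.integrable_const_bound[where B = B]; (intro measurable_unit_ball)?; auto)+
  qed
  have "(\<integral>x. ?D (sgn x) \<partial>unit_ball) = (\<integral>\<theta>. (\<integral>x. ?D (sgn x) \<partial>unit_ball) \<partial>?L)"
    by (simp add: measure_restrict_space space_restrict_space)
  also have "\<dots> = (\<integral>\<theta>. (\<integral>x. ?D (rot i j \<theta> (sgn x)) \<partial>unit_ball) \<partial>?L)"
  proof (rule Bochner_Integration.integral_cong[OF refl])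
    fix \<theta> assume "\<theta> \<in> space ?L"
    then have "\<theta> \<in> {0..1}" by (simp add: space_restrict_space)
    from integral_unit_ball_rot[OF ij cos[OF this], of "\<lambda>x. ?D (sgn x)"]
    show "(\<integral>x. ?D (sgn x) \<partial>unit_ball) = (\<integral>x. ?D (rot i j \<theta> (sgn x)) \<partial>unit_ball)"
      by (simp add: rot_sgn[OF ij])
  qed
  also have "\<dots> = (\<integral>x. (\<integral>\<theta>. ?D (rot i j \<theta> (sgn x)) \<partial>?L) \<partial>unit_ball)"
    by (rule P.Fubini_integral[OF int])
  also have "\<dots> = (\<integral>x. h (rot i j 1 (sgn x)) - h (sgn x) \<partial>unit_ball)"
    by (simp add: inner)
  also have "\<dots> = (\<integral>x. h (rot i j 1 (sgn x)) \<partial>unit_ball) - (\<integral>x. h (sgn x) \<partial>unit_ball)"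
    using inth by simp
  also have "(\<integral>x. h (rot i j 1 (sgn x)) \<partial>unit_ball) = (\<integral>x. h (sgn x) \<partial>unit_ball)"
    using integral_unit_ball_rot[OF ij cos, of 1 "\<lambda>x. h (sgn x)"] by (simp add: rot_sgn[OF ij])
  finally show ?thesis by (simp add: integral_sphere)
qed

text \<open>The Laplacian minus its radial part, as an operator on functions of the ambient space. On the unit
  sphere it is the Laplace--Beltrami operator (\<open>laplace_beltrami_eq_sphere_op\<close>).\<close>

definition sphere_op :: "(real ^ 'm \<Rightarrow> real) \<Rightarrow> real ^ 'm \<Rightarrow> real" where
  "sphere_op f \<xi> = (\<Sum>k\<in>UNIV. dder (axis k 1) (dder (axis k 1) f) \<xi>) - hess_rad f \<xi>
     - (real CARD('m) - 1) * euler f \<xi>"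

lemma rpoly_sphere_op: "rpoly f \<Longrightarrow> rpoly (sphere_op f)"
  unfolding sphere_op_def by (auto intro!: rpoly_intros rpoly_dder rpoly_euler rpoly_hess_rad)

text \<open>The double sum counts every coordinate plane twice, and its diagonal terms are zero.\<close>

lemma sphere_op_eq_rot_dder:
  fixes f :: "real ^ 'm \<Rightarrow> real"
  assumes f: "rpoly f" and xi: "norm \<xi> = 1"
  shows "sphere_op f \<xi> = (\<Sum>i\<in>UNIV. \<Sum>j\<in>UNIV. rot_dder i j (rot_dder i j f) \<xi>) / 2"
proof -
  note r = rpoly_intros rpoly_dder f
  define G where "G i = dder (axis i 1) f \<xi>" for i
  define H where "H i j = dder (axis i 1) (dder (axis j 1) f) \<xi>" for i j
  have Hs: "H i j = H j i" for i j unfolding H_def by (simp add: dder_commute[OF f])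
  have d: "dder v (rot_dder i j f) \<xi> = v $ i * G j + \<xi> $ i * dder v (dder (axis j 1) f) \<xi>
      - v $ j * G i - \<xi> $ j * dder v (dder (axis i 1) f) \<xi>" for v i j
    unfolding rot_dder_def[abs_def] G_def
    by (simp add: dder_diff dder_mult dder_linear[OF bounded_linear_vec_nth] r)
  have e: "rot_dder i j (rot_dder i j f) \<xi>
     = (\<xi> $ i * \<xi> $ i) * H j j + H i i * (\<xi> $ j * \<xi> $ j) - 2 * (\<xi> $ i * \<xi> $ j * H i j)
       - \<xi> $ i * G i - \<xi> $ j * G j + (if i = j then 2 * (\<xi> $ i * G i) else 0)" for i j
    unfolding rot_dder_def[of i j "rot_dder i j f"] d H_def[symmetric]
    using Hs[of i j] by (auto simp: axis_component algebra_simps)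
  have n1: "(\<Sum>i\<in>UNIV. \<xi> $ i * \<xi> $ i) = 1"
    using xi by (simp add: norm_eq_sqrt_inner inner_vec_def)
  have "(\<Sum>i\<in>UNIV. \<Sum>j\<in>UNIV. rot_dder i j (rot_dder i j f) \<xi>)
     = 2 * (\<Sum>i\<in>UNIV. H i i) - 2 * (\<Sum>i\<in>UNIV. \<Sum>j\<in>UNIV. \<xi> $ i * \<xi> $ j * H i j)
       - 2 * (real CARD('m) - 1) * (\<Sum>i\<in>UNIV. \<xi> $ i * G i)"
    unfolding e
    by (simp only: sum.distrib sum_subtractf sum_distrib_left[symmetric] sum_distrib_right[symmetric]
          sum.delta sum.delta' sum_constant finite_class.finite_UNIV UNIV_I if_True n1)
              (simp add: sum_distrib_left algebra_simps)
  then show ?thesis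
    unfolding sphere_op_def euler_coords[OF f] hess_rad_coords[OF f] G_def H_def
    by (simp add: algebra_simps)
qed

text \<open>Each infinitesimal rotation is a derivation with vanishing integral, hence skew-symmetric, and so its
  square is symmetric.\<close>

lemma sphere_op_symmetric:
  fixes f g :: "real ^ 'm \<Rightarrow> real"
  assumes f: "rpoly f" and g: "rpoly g"
  shows "(\<integral>\<xi>. f \<xi> * sphere_op g \<xi> \<partial>sphere_measure) = (\<integral>\<xi>. g \<xi> * sphere_op f \<xi> \<partial>sphere_measure)"
proof -
  define S where "S f g \<xi> = (\<Sum>i\<in>UNIV. \<Sum>j\<in>UNIV. rot_dder i j f \<xi> * rot_dder i j g \<xi>) / 2"
    for f g :: "real ^ 'm \<Rightarrow> real" and \<xi>
  have *: "(\<integral>\<xi>. f \<xi> * sphere_op g \<xi> \<partial>sphere_measure) = - (\<integral>\<xi>. S f g \<xi> \<partial>sphere_measure)"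
    if f: "rpoly f" and g: "rpoly g" for f g
  proof -
    note r = rpoly_intros rpoly_dder rpoly_rot_dder f g
    have int: "integrable sphere_measure F" if "rpoly F" for F :: "real ^ 'm \<Rightarrow> real"
      using that by (intro integrable_sphere_continuous rpoly_continuous_on)
    have prod: "rot_dder i j (\<lambda>x. f x * rot_dder i j g x) \<xi>
        = f \<xi> * rot_dder i j (rot_dder i j g) \<xi> + rot_dder i j f \<xi> * rot_dder i j g \<xi>" for i j \<xi>
      unfolding rot_dder_def[of i j "\<lambda>x. f x * rot_dder i j g x"] rot_dder_def[of i j "rot_dder i j g"]
        rot_dder_def[of i j f]
      by (simp add: dder_mult r algebra_simps)
    have rS: "rpoly (S f g)" unfolding S_def by (auto intro!: r)
    have rfg: "rpoly (\<lambda>\<xi>. f \<xi> * sphere_op g \<xi>)" by (auto intro!: r rpoly_sphere_op)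
    have rP: "rpoly (rot_dder i j (\<lambda>x. f x * rot_dder i j g x))" for i j by (auto intro!: r)
    have "(\<integral>\<xi>. f \<xi> * sphere_op g \<xi> + S f g \<xi> \<partial>sphere_measure)
      = (\<integral>\<xi>. (\<Sum>i\<in>UNIV. \<Sum>j\<in>UNIV. rot_dder i j (\<lambda>x. f x * rot_dder i j g x) \<xi>) / 2 \<partial>sphere_measure)"
    proof (rule integral_cong_AE)
      show "AE \<xi> in sphere_measure. f \<xi> * sphere_op g \<xi> + S f g \<xi>
          = (\<Sum>i\<in>UNIV. \<Sum>j\<in>UNIV. rot_dder i j (\<lambda>x. f x * rot_dder i j g x) \<xi>) / 2"
        using AE_sphere_norm
        by eventually_elim
           (simp add: sphere_op_eq_rot_dder[OF g] S_def prod sum.distrib sum_distrib_left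
               add_divide_distrib)
    next
      show "(\<lambda>\<xi>. f \<xi> * sphere_op g \<xi> + S f g \<xi>) \<in> borel_measurable sphere_measure"
        by (intro borel_measurable_integrable int rpoly_intros rfg rS)
      show "(\<lambda>\<xi>. (\<Sum>i\<in>UNIV. \<Sum>j\<in>UNIV. rot_dder i j (\<lambda>x. f x * rot_dder i j g x) \<xi>) / 2)
          \<in> borel_measurable sphere_measure"
        by (intro borel_measurable_integrable int) (auto intro!: rpoly_intros rP)
    qed
    also have "\<dots> = 0"
      using int[OF rP] integral_sphere_rot_dder[of "\<lambda>x. f x * rot_dder i j g x" i j for i j]
      by (simp add: r)
    finally show ?thesis using int[OF rfg] int[OF rS] by simp
  qed
  have "S f g = S g f" unfolding S_def by (simp add: mult_ac fun_eq_iff)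
  then show ?thesis using *[OF f g] *[OF g f] by simp
qed

section \<open>The operator on the surface\<close>

text \<open>Moving \<open>y\<close> in the direction \<open>v\<close> with \<open>\<xi>\<close> fixed also moves the point \<open>x = (1 - |y|) \<xi>\<close>, by \<open>- |v| \<xi>\<close>.\<close>

lemma surface_param_derivative_y:
  "((\<lambda>y. surface_param (\<xi>, y)) has_derivative (\<lambda>v. (0, v) - coord_sum v *\<^sub>R (\<xi>, 0))) (at y)"
proof -
  have "((\<lambda>y. ((1 - coord_sum y) *\<^sub>R \<xi>, y)) has_derivative (\<lambda>v. ((0 - coord_sum v) *\<^sub>R \<xi>, v))) (at y)"
    by (intro has_derivative_Pair has_derivative_scaleR_left has_derivative_diff has_derivative_const
        bounded_linear_imp_has_derivative bounded_linear_coord_sum has_derivative_ident)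
  then show ?thesis by (simp add: surface_param_def)
qed

lemma surface_param_derivative_x:
  "((\<lambda>\<xi>. surface_param (\<xi>, y)) has_derivative (\<lambda>v. (1 - coord_sum y) *\<^sub>R (v, 0))) (at \<xi>)"
proof -
  have "((\<lambda>\<xi>. ((1 - coord_sum y) *\<^sub>R \<xi>, y)) has_derivative (\<lambda>v. ((1 - coord_sum y) *\<^sub>R v, 0))) (at \<xi>)"
    by (intro has_derivative_Pair has_derivative_scaleR_right has_derivative_const has_derivative_ident)
  then show ?thesis by (simp add: surface_param_def)
qed

lemma polynomial_surface_param: "polynomial_function surface_param"
  unfolding polynomial_function_iff_Basis_inner
proof
  fix b :: "(real ^ 'a) \<times> (real ^ 'b)" assume "b \<in> Basis"
  have "rpoly (\<lambda>z :: (real ^ 'a) \<times> (real ^ 'b). (1 - coord_sum (snd z)) * (fst z \<bullet> fst b)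
      + snd z \<bullet> snd b)"
    by (intro rpoly_intros real_polynomial_function.intros(1) bounded_linear_intros
        bounded_linear_compose[OF bounded_linear_coord_sum bounded_linear_snd])
  then show "rpoly (\<lambda>z. surface_param z \<bullet> b)"
    by (simp add: surface_param_def case_prod_beta inner_prod_def)
qed

lemma rpoly_param_y:
  fixes f :: "(real ^ 'm) \<times> (real ^ 'd) \<Rightarrow> real"
  assumes "rpoly f" shows "rpoly (\<lambda>y. f (surface_param (\<xi>, y)))"
proof (rule rpoly_compose[where f = f, OF _ assms])
  have "rpoly (\<lambda>y. \<xi> \<bullet> fst b + y \<bullet> snd b)" for b :: "(real ^ 'm) \<times> (real ^ 'd)"
    by (intro rpoly_intros real_polynomial_function.intros(1) bounded_linear_inner_left)
  then have "polynomial_function (\<lambda>y. (\<xi>, y) :: (real ^ 'm) \<times> (real ^ 'd))"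
    by (simp add: polynomial_function_iff_Basis_inner inner_prod_def)
  from polynomial_function_compose[OF this polynomial_surface_param]
  show "polynomial_function (\<lambda>y :: real ^ 'd. surface_param (\<xi>, y))" by (simp add: o_def)
qed

lemma rpoly_param_x:
  fixes f :: "(real ^ 'm) \<times> (real ^ 'd) \<Rightarrow> real"
  assumes "rpoly f" shows "rpoly (\<lambda>\<xi>. f (surface_param (\<xi>, y)))"
proof (rule rpoly_compose[where f = f, OF _ assms])
  have "rpoly (\<lambda>\<xi>. \<xi> \<bullet> fst b + y \<bullet> snd b)" for b :: "(real ^ 'm) \<times> (real ^ 'd)"
    by (intro rpoly_intros real_polynomial_function.intros(1) bounded_linear_inner_left)
  then have "polynomial_function (\<lambda>\<xi>. (\<xi>, y) :: (real ^ 'm) \<times> (real ^ 'd))"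
    by (simp add: polynomial_function_iff_Basis_inner inner_prod_def)
  from polynomial_function_compose[OF this polynomial_surface_param]
  show "polynomial_function (\<lambda>\<xi> :: real ^ 'm. surface_param (\<xi>, y))" by (simp add: o_def)
qed

lemma dder_param_y:
  assumes "rpoly f"
  shows "dder v (\<lambda>y. f (surface_param (\<xi>, y)))
    = (\<lambda>y. dder ((0, v) - coord_sum v *\<^sub>R (\<xi>, 0)) f (surface_param (\<xi>, y)))"
  by (rule ext, rule dder_compose[OF assms surface_param_derivative_y])

lemma dder_param_x:
  assumes "rpoly f"
  shows "dder v (\<lambda>\<xi>. f (surface_param (\<xi>, y)))
    = (\<lambda>\<xi>. dder ((1 - coord_sum y) *\<^sub>R (v, 0)) f (surface_param (\<xi>, y)))"
  by (rule ext, rule dder_compose[OF assms surface_param_derivative_x])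

text \<open>The ambient operator \<open>L\<close> of the introduction.\<close>

definition surface_op :: "real ^ 'd \<Rightarrow> ((real ^ 'm) \<times> (real ^ 'd) \<Rightarrow> real) \<Rightarrow> (real ^ 'm) \<times>
    (real ^ 'd) \<Rightarrow> real" where
  "surface_op \<kappa> f z =
     (\<Sum>i\<in>UNIV. snd z $ i * dder (0, axis i 1) (dder (0, axis i 1) f) z
         + (\<kappa> $ i + 1) * dder (0, axis i 1) f z)
     + (1 - coord_sum (snd z)) * (\<Sum>k\<in>UNIV. dder (axis k 1, 0) (dder (axis k 1, 0) f) z)
     - hess_rad f z - (coord_sum \<kappa> + real CARD('m) + real CARD('d) - 1) * euler f z"

text \<open>This is \<open>(1 - |y|)\<^sup>-\<^sup>1\<close> times \<open>sphere_op\<close> applied to the pulled back function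
  (\<open>sphere_op_param\<close>), with the denominator cancelled. In this form it is continuous up to \<open>|y| = 1\<close>,
  and therefore integrable against the weight.\<close>

definition angular_part :: "((real ^ 'm) \<times> (real ^ 'd) \<Rightarrow> real) \<Rightarrow> (real ^ 'm) \<times> (real ^ 'd) \<Rightarrow> real" where
  "angular_part f = (\<lambda>(\<xi>, y). let z = surface_param (\<xi>, y); r = 1 - coord_sum y in
     r * (\<Sum>k\<in>UNIV. dder (axis k 1, 0) (dder (axis k 1, 0) f) z)
     - r * dder (\<xi>, 0) (dder (\<xi>, 0) f) z - (real CARD('m) - 1) * dder (\<xi>, 0) f z)"

lemma sphere_op_param:
  fixes f :: "(real ^ 'm) \<times> (real ^ 'd) \<Rightarrow> real"
  assumes f: "rpoly f"
  shows "sphere_op (\<lambda>\<xi>. f (surface_param (\<xi>, y))) \<xi> = (1 - coord_sum y) * angular_part f (\<xi>, y)"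
  unfolding sphere_op_def hess_rad_def euler_def angular_part_def Let_def prod.case
  by (simp only: dder_param_x rpoly_dder f dder_vec_scale dder_cmult rpoly_param_x)
     (simp add: sum_distrib_left algebra_simps)

lemma dder_vec_sum_scale:
  "rpoly f \<Longrightarrow> dder (\<Sum>i\<in>I. c i *\<^sub>R v i) f = (\<lambda>z. \<Sum>i\<in>I. c i * dder (v i) f z)"
  by (simp add: dder_vec_sum dder_vec_scale)

text \<open>Everything is expressed by the values of the Hessian and of the gradient of \<open>f\<close> on the vectors
  \<open>X = (\<xi>, 0)\<close>, \<open>Y = (0, y)\<close> and \<open>E i = (0, axis i 1)\<close>. The direction \<open>axis i 1\<close> of the simplex becomes
  \<open>E i - X\<close> in the ambient space, its radial direction \<open>y\<close> becomes \<open>Y - |y| X\<close>, and the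
  position vector is \<open>(1 - |y|) X + Y\<close>. Comparing coefficients of the resulting bilinear expressions
  gives the claim.\<close>

lemma simplex_op_param:
  fixes f :: "(real ^ 'm) \<times> (real ^ 'd) \<Rightarrow> real"
  assumes f: "rpoly f" and m: "CARD('m) \<ge> 2"
  shows "simplex_op \<kappa> (CARD('m) - 2) (\<lambda>y. f (surface_param (\<xi>, y))) y + angular_part f (\<xi>, y)
       = surface_op \<kappa> f (surface_param (\<xi>, y))"
proof -
  define z where "z = surface_param (\<xi>, y)"
  define X :: "(real ^ 'm) \<times> (real ^ 'd)" where "X = (\<xi>, 0)"
  define Y :: "(real ^ 'm) \<times> (real ^ 'd)" where "Y = (0, y)"
  define E :: "'d \<Rightarrow> (real ^ 'm) \<times> (real ^ 'd)" where "E i = (0, axis i 1)" for i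
  define s where "s = coord_sum y"
  note r = f rpoly_dder rpoly_intros
  have zXY: "z = (1 - s) *\<^sub>R X + Y" by (simp add: z_def X_def Y_def s_def surface_param_def)
  have YE: "Y = (\<Sum>i\<in>UNIV. (y $ i) *\<^sub>R E i)"
    by (simp add: Y_def E_def prod_eq_iff fst_sum snd_sum vec_eq_sum_axis)
  have s: "s = (\<Sum>i\<in>UNIV. y $ i)" by (simp add: s_def coord_sum_def)
  have B: "dder (v - c *\<^sub>R X) (dder (v - c *\<^sub>R X) f) z
      = dder v (dder v f) z - 2 * c * dder v (dder X f) z + c\<^sup>2 * dder X (dder X f) z" for v c
    by (simp add: dder_vec_diff dder_vec_scale r dder_diff dder_mult dder_const
        dder_commute[OF f, of X v] power2_eq_square algebra_simps)
  have Bz: "dder z (dder z f) z = (1 - s)\<^sup>2 * dder X (dder X f) z + 2 * (1 - s) * dder Y (dder X f) z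
      + dder Y (dder Y f) z"
    using B[of Y "s - 1"] unfolding zXY[symmetric]
    by (simp add: zXY algebra_simps power2_eq_square)
  have Gz: "dder z f z = (1 - s) * dder X f z + dder Y f z"
    by (subst (1) zXY) (simp add: dder_vec_add dder_vec_scale f)
  have YX: "dder Y (dder X f) z = (\<Sum>i\<in>UNIV. y $ i * dder (E i) (dder X f) z)"
    unfolding YE by (simp add: dder_vec_sum_scale r)
  have YG: "dder Y f z = (\<Sum>i\<in>UNIV. y $ i * dder (E i) f z)"
    unfolding YE by (simp add: dder_vec_sum_scale r)
  have k: "real (CARD('m) - 2) = real CARD('m) - 2" using m by simp
  have sum1: "(\<Sum>i\<in>UNIV. y $ i * (dder (E i) (dder (E i) f) z - 2 * dder (E i) (dder X f) z
      + dder X (dder X f) z)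
        + (\<kappa> $ i + 1) * (dder (E i) f z - dder X f z))
    = (\<Sum>i\<in>UNIV. y $ i * dder (E i) (dder (E i) f) z + (\<kappa> $ i + 1) * dder (E i) f z)
      - 2 * dder Y (dder X f) z + s * dder X (dder X f) z - (coord_sum \<kappa> + real CARD('d)) * dder X f z"
  proof -
    have "coord_sum \<kappa> + real CARD('d) = (\<Sum>i\<in>UNIV. \<kappa> $ i + 1)" by (simp add: coord_sum_def sum.distrib)
    then show ?thesis
      unfolding YX s by (simp add: sum.distrib sum_subtractf sum_distrib_left sum_distrib_right
          algebra_simps)
  qed
  have "simplex_op \<kappa> (CARD('m) - 2) (\<lambda>y. f (surface_param (\<xi>, y))) y
    = (\<Sum>i\<in>UNIV. y $ i * dder (E i - 1 *\<^sub>R X) (dder (E i - 1 *\<^sub>R X) f) z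
        + (\<kappa> $ i + 1) * dder (E i - 1 *\<^sub>R X) f z)
      - dder (Y - s *\<^sub>R X) (dder (Y - s *\<^sub>R X) f) z
      - (coord_sum \<kappa> + real CARD('d) + real CARD('m) - 1) * dder (Y - s *\<^sub>R X) f z"
    unfolding simplex_op_def hess_rad_def euler_def k
    by (simp only: dder_param_y rpoly_dder f coord_sum_axis X_def Y_def E_def s_def z_def)
        (simp add: algebra_simps)
  also have "\<dots> = (\<Sum>i\<in>UNIV. y $ i * dder (E i) (dder (E i) f) z + (\<kappa> $ i + 1) * dder (E i) f z)
      - 2 * dder Y (dder X f) z + s * dder X (dder X f) z - (coord_sum \<kappa> + real CARD('d)) * dder X f z
      - (dder Y (dder Y f) z - 2 * s * dder Y (dder X f) z + s\<^sup>2 * dder X (dder X f) z)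
      - (coord_sum \<kappa> + real CARD('d) + real CARD('m) - 1) * (dder Y f z - s * dder X f z)"
    unfolding B unfolding dder_vec_diff[OF f] dder_vec_scale[OF f] by (simp add: sum1)
  finally have 1: "simplex_op \<kappa> (CARD('m) - 2) (\<lambda>y. f (surface_param (\<xi>, y))) y = \<dots>" .
  have 2: "angular_part f (\<xi>, y) = (1 - s) * (\<Sum>k\<in>UNIV. dder (axis k 1, 0) (dder (axis k 1, 0) f) z)
     - (1 - s) * dder X (dder X f) z - (real CARD('m) - 1) * dder X f z"
    by (simp add: angular_part_def Let_def z_def X_def s_def)
  have sz: "snd z = y" by (simp add: z_def surface_param_def)
  have 3: "surface_op \<kappa> f z = (\<Sum>i\<in>UNIV. y $ i * dder (E i) (dder (E i) f) z
      + (\<kappa> $ i + 1) * dder (E i) f z)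
     + (1 - s) * (\<Sum>k\<in>UNIV. dder (axis k 1, 0) (dder (axis k 1, 0) f) z)
     - ((1 - s)\<^sup>2 * dder X (dder X f) z + 2 * (1 - s) * dder Y (dder X f) z + dder Y (dder Y f) z)
     - (coord_sum \<kappa> + real CARD('m) + real CARD('d) - 1) * ((1 - s) * dder X f z + dder Y f z)"
    unfolding surface_op_def hess_rad_def euler_def Bz Gz by (simp add: sz E_def s_def)
  show ?thesis
    unfolding z_def[symmetric] 1 2 3 by (simp add: algebra_simps power2_eq_square)
qed

text \<open>Of the terms of \<open>surface_op\<close> only \<open>hess_rad\<close> and \<open>euler\<close> preserve the degree, and
  \<open>n (n - 1) + (c + 1) n = n (n + c)\<close> with \<open>c = |\<kappa>| + d\<^sub>1 + d\<^sub>2 - 2\<close>.\<close>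

lemma surface_op_degree:
  fixes f :: "(real ^ 'm) \<times> (real ^ 'd) \<Rightarrow> real"
  assumes f: "deg_less (Suc n) f"
  shows "deg_less n (\<lambda>z. surface_op \<kappa> f z
    + real n * (real n + coord_sum \<kappa> + real CARD('m) + real CARD('d) - 2) * f z)"
proof -
  let ?c = "coord_sum \<kappa> + real CARD('m) + real CARD('d) - 1"
  have d1: "deg_less n (dder v f)" for v using deg_less_dder[OF f] by simp
  have d2: "deg_less (n - 1) (dder v (dder w f))" for v w using deg_less_dder[OF d1] by simp
  have d0: "dder v (dder w f) = (\<lambda>z. 0)" if "n = 0" for v w
    using d2 that by (simp add: deg_less_0)
  have l2: "deg_less n (\<lambda>z. l z * dder v (dder w f) z)" if "bounded_linear l" for l v w
    using that d2 d0 by (intro linear_times_lower) auto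
  have b1: "bounded_linear (\<lambda>z :: (real ^ 'm) \<times> (real ^ 'd). snd z $ i)" for i
    by (intro bounded_linear_compose[OF bounded_linear_vec_nth bounded_linear_snd])
  have b2: "bounded_linear (\<lambda>z :: (real ^ 'm) \<times> (real ^ 'd). coord_sum (snd z))"
    by (intro bounded_linear_compose[OF bounded_linear_coord_sum bounded_linear_snd])
  have A: "deg_less n (\<lambda>z. \<Sum>i\<in>UNIV. snd z $ i * dder (0, axis i 1) (dder (0, axis i 1) f) z
      + (\<kappa> $ i + 1) * dder (0, axis i 1) f z)"
    by (intro deg_less_sum deg_less.add l2 b1 deg_less_cmult d1)
  have B: "deg_less n (\<lambda>z. \<Sum>k\<in>UNIV. dder (axis k 1, 0) (dder (axis k 1, 0) f) z)"
    by (intro deg_less_sum deg_less_mono[OF d2]) simp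
  have C: "deg_less n (\<lambda>z. \<Sum>k\<in>UNIV. coord_sum (snd z) * dder (axis k 1, 0) (dder (axis k 1, 0) f) z)"
    by (intro deg_less_sum l2 b2)
  have D: "deg_less n (\<lambda>z. hess_rad f z - real n * (real n - 1) * f z)"
    using hess_rad_degree[OF f] by simp
  have E: "deg_less n (\<lambda>z. ?c * (euler f z - real n * f z))"
    using deg_less_cmult[OF euler_degree[OF f], of ?c] by simp
  note deg_less_diff[OF deg_less_diff[OF deg_less_diff[OF deg_less.add[OF A B] C] D] E]
  moreover have "surface_op \<kappa> f z + real n
      * (real n + coord_sum \<kappa> + real CARD('m) + real CARD('d) - 2) * f z =
     (\<Sum>i\<in>UNIV. snd z $ i * dder (0, axis i 1) (dder (0, axis i 1) f) z
         + (\<kappa> $ i + 1) * dder (0, axis i 1) f z)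
     + (\<Sum>k\<in>UNIV. dder (axis k 1, 0) (dder (axis k 1, 0) f) z)
     - (\<Sum>k\<in>UNIV. coord_sum (snd z) * dder (axis k 1, 0) (dder (axis k 1, 0) f) z)
     - (hess_rad f z - real n * (real n - 1) * f z) - ?c * (euler f z - real n * f z)" for z
    unfolding surface_op_def sum_distrib_left[symmetric] by (simp add: algebra_simps)
  ultimately show ?thesis by simp
qed

text \<open>The one-sided derivative is taken within an interval that contains points to the right of \<open>0\<close>, so it
  is determined by the values of \<open>g\<close> there, even where \<open>y\<^sub>i = 0\<close>.\<close>

lemma partial_y_eq_dder:
  fixes g G :: "real ^ 'd \<Rightarrow> real"
  assumes eq: "\<And>\<eta>. \<eta> \<in> simplex_set \<Longrightarrow> coord_sum \<eta> < 1 \<Longrightarrow> g \<eta> = G \<eta>"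
    and G: "rpoly G" and y: "y \<in> simplex_set" "coord_sum y < 1"
  shows "partial_y i g y = dder (axis i 1) G y"
proof -
  let ?S = "{t. y + t *\<^sub>R axis i 1 \<in> simplex_set \<and> coord_sum (y + t *\<^sub>R axis i 1) < 1}"
  have "((\<lambda>t. y + t *\<^sub>R axis i 1) has_vector_derivative axis i 1) (at 0 within ?S)"
    by (auto intro!: derivative_eq_intros)
  from rpoly_dder_curve[OF G this]
  have "((\<lambda>t. G (y + t *\<^sub>R axis i 1)) has_vector_derivative dder (axis i 1) G y) (at 0 within ?S)"
    by (simp add: has_real_derivative_iff_has_vector_derivative)
  then have "((\<lambda>t. g (y + t *\<^sub>R axis i 1)) has_vector_derivative dder (axis i 1) G y) (at 0 within ?S)"
    by (rule has_vector_derivative_transform[rotated 2]) (use y in \<open>simp_all add: eq\<close>)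
  moreover have "at 0 within ?S \<noteq> bot"
  proof -
    have "{0<..<1 - coord_sum y} \<subseteq> ?S"
      using y unfolding simplex_set_def by (simp add: subset_iff axis_component)
    then have "at 0 within {0<..<1 - coord_sum y} \<le> at 0 within ?S" by (rule at_le)
    moreover have "at (0::real) within {0<..<1 - coord_sum y} \<noteq> bot"
      using islimpt_greaterThanLessThan1[of 0 "1 - coord_sum y"] y by (simp add: trivial_limit_within)
    ultimately show ?thesis by (auto simp: bot_unique)
  qed
  ultimately show ?thesis unfolding partial_y_def by (intro vector_derivative_within)
qed

lemma euler_euler:
  fixes f :: "real ^ 'd \<Rightarrow> real"
  assumes "rpoly f" shows "euler (euler f) y = hess_rad f y + euler f y"
proof -
  note r = rpoly_intros rpoly_dder assms
  have "dder (axis i 1) (euler f) y = dder (axis i 1) f y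
      + (\<Sum>j\<in>UNIV. y $ j * dder (axis i 1) (dder (axis j 1) f) y)" for i
  proof -
    have "dder (axis i 1) (euler f) y
      = (\<Sum>j\<in>UNIV. y $ j * dder (axis i 1) (dder (axis j 1) f) y
          + (if i = j then dder (axis i 1) f y else 0))"
      unfolding euler_coords[OF assms]
      by (subst dder_sum) (auto simp: dder_mult r dder_linear[OF bounded_linear_vec_nth]
          axis_component intro!: sum.cong)
    then show ?thesis by (simp add: sum.distrib)
  qed
  then show ?thesis
    by (subst euler_coords[OF rpoly_euler[OF assms]])
       (simp add: hess_rad_coords[OF assms] euler_coords[OF assms] distrib_left sum.distrib
           sum_distrib_left mult_ac)
qed

text \<open>The curve \<open>c t = (\<xi> + t e) / \<parallel>\<xi> + t e\<parallel>\<close> has \<open>c 0 = \<xi>\<close>, velocity \<open>e - \<xi>\<^sub>k \<xi>\<close> and acceleration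
  \<open>(3 \<xi>\<^sub>k\<^sup>2 - 1) \<xi> - 2 \<xi>\<^sub>k e\<close> at \<open>t = 0\<close>; the right side is the chain rule of second order for \<open>q \<circ> c\<close>.\<close>

lemma second_derivative_radial:
  fixes q :: "real ^ 'm \<Rightarrow> real"
  assumes q: "rpoly q" and xi: "norm \<xi> = 1" and f: "\<And>x. norm x = 1 \<Longrightarrow> f x = q x"
  shows "(deriv ^^ 2) (\<lambda>t. f (sgn (\<xi> + t *\<^sub>R axis k 1))) 0
    = dder (axis k 1) (dder (axis k 1) q) \<xi> - 2 * (\<xi> $ k * dder (axis k 1) (dder \<xi> q) \<xi>)
      + (\<xi> $ k)\<^sup>2 * dder \<xi> (dder \<xi> q) \<xi> + (3 * (\<xi> $ k)\<^sup>2 - 1) * dder \<xi> q \<xi>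
          - 2 * (\<xi> $ k * dder (axis k 1) q \<xi>)"
proof -
  define e :: "real ^ 'm" where "e = axis k 1"
  define a where "a = \<xi> $ k"
  define N where "N t = 1 + 2 * a * t + t\<^sup>2" for t
  define s where "s t = inverse (sqrt (N t))" for t
  define s' where "s' t = - ((a + t) * s t ^ 3)" for t
  define c where "c t = s t *\<^sub>R (\<xi> + t *\<^sub>R e)" for t
  define F where "F t = f (sgn (\<xi> + t *\<^sub>R e))" for t
  \<comment> \<open>The derivative of \<open>q \<circ> c\<close>, since the velocity of \<open>c\<close> is \<open>s' t (\<xi> + t e) + s t e\<close>.\<close>
  define F1 where "F1 t = s' t * (dder \<xi> q (c t) + t * dder e q (c t)) + s t * dder e q (c t)" for t
  have norm_N: "norm (\<xi> + t *\<^sub>R e) = sqrt (N t)" for t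
  proof -
    have "(\<xi> + t *\<^sub>R e) \<bullet> (\<xi> + t *\<^sub>R e) = \<xi> \<bullet> \<xi> + 2 * a * t + t\<^sup>2"
      by (simp add: inner_add_left inner_add_right e_def a_def inner_axis inner_axis' axis_component
          power2_eq_square algebra_simps)
    also have "\<xi> \<bullet> \<xi> = 1" using xi by (simp add: norm_eq_sqrt_inner)
    finally show ?thesis by (simp add: norm_eq_sqrt_inner N_def)
  qed
  have e1: "norm e = 1" by (simp add: e_def)
  have Npos: "0 < N t" if "\<bar>t\<bar> < 1" for t
  proof -
    have "norm \<xi> - norm (t *\<^sub>R e) \<le> norm (\<xi> + t *\<^sub>R e)" by (metis norm_diff_ineq)
    then have "1 - \<bar>t\<bar> \<le> sqrt (N t)" using xi e1 by (simp add: norm_N)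
    then have "0 < sqrt (N t)" using that by linarith
    then show ?thesis by simp
  qed
  have Fq: "F t = q (c t)" if "\<bar>t\<bar> < 1" for t
  proof -
    have "sgn (\<xi> + t *\<^sub>R e) = c t" by (simp add: sgn_div_norm norm_N c_def s_def)
    moreover have "norm (sgn (\<xi> + t *\<^sub>R e)) = 1"
      using norm_N[of t] Npos[OF that] by (simp add: norm_sgn)
          (metis less_irrefl norm_zero real_sqrt_gt_0_iff)
    ultimately show ?thesis by (simp add: F_def f)
  qed
  have ds: "(s has_real_derivative s' t) (at t)" if "\<bar>t\<bar> < 1" for t
  proof -
    have "((\<lambda>t. inverse (sqrt (N t))) has_real_derivative
        - (inverse (sqrt (N t)) * ((2 * a + 2 * t) * (inverse (sqrt (N t)) / 2))
            * inverse (sqrt (N t)))) (at t)"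
      using Npos[OF that] unfolding N_def
      by (auto intro!: derivative_eq_intros simp: power2_eq_square)
    then show ?thesis
      unfolding s_def[abs_def] by (rule DERIV_cong)
          (simp add: s'_def s_def power3_eq_cube algebra_simps)
  qed
  have dc: "(c has_vector_derivative s' t *\<^sub>R (\<xi> + t *\<^sub>R e) + s t *\<^sub>R e) (at t)" if "\<bar>t\<bar> < 1" for t
    unfolding c_def[abs_def] using ds[OF that]
    by (auto intro!: derivative_eq_intros simp: add.commute)
  have dq: "((\<lambda>t. h (c t)) has_real_derivative s' t * (dder \<xi> h (c t) + t * dder e h (c t))
      + s t * dder e h (c t)) (at t)"
    if "rpoly h" "\<bar>t\<bar> < 1" for h t
    using rpoly_dder_curve[OF that(1) dc[OF that(2)]]
    by (simp add: dder_vec_add dder_vec_scale that)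
  have near: "eventually (\<lambda>t. \<bar>t\<bar> < 1) (nhds t)" if "\<bar>t\<bar> < 1" for t :: real
  proof -
    have "eventually (\<lambda>u. u \<in> {-1<..<1}) (nhds t)"
      by (rule eventually_nhds_in_open) (use that in auto)
    then show ?thesis by (rule eventually_mono) auto
  qed
  have dF: "deriv F t = F1 t" if "\<bar>t\<bar> < 1" for t
  proof -
    have "deriv F t = deriv (\<lambda>t. q (c t)) t"
      by (rule deriv_cong_ev) (use near[OF that] Fq in \<open>auto elim!: eventually_mono\<close>)
    also have "\<dots> = F1 t" unfolding F1_def by (rule DERIV_imp_deriv) (rule dq[OF q that])
    finally show ?thesis .
  qed
  have at0: "s 0 = 1" "s' 0 = - a" "c 0 = \<xi>"
    by (simp_all add: s_def s'_def c_def N_def)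
  have ds': "(s' has_real_derivative 3 * a\<^sup>2 - 1) (at 0)"
  proof -
    have 1: "((\<lambda>t. a + t) has_real_derivative 1) (at 0)"
      by (auto intro!: derivative_eq_intros)
    have 2: "((\<lambda>t. s t ^ 3) has_real_derivative - 3 * a) (at 0)"
      by (rule DERIV_cong[OF DERIV_power[OF ds]]) (simp_all add: at0)
    show ?thesis
      unfolding s'_def[abs_def]
      by (rule DERIV_cong[OF DERIV_minus[OF DERIV_mult[OF 1 2]]]) (simp add: at0 power2_eq_square)
  qed
  note r = q rpoly_dder
  have "(F1 has_real_derivative
      ((3 * a\<^sup>2 - 1) * dder \<xi> q \<xi> + - a * (- a * dder \<xi> (dder \<xi> q) \<xi> + dder e (dder \<xi> q) \<xi> + dder e q \<xi>)
       + (- a * dder e q \<xi> + (- a * dder \<xi> (dder e q) \<xi> + dder e (dder e q) \<xi>)))) (at 0)"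
    unfolding F1_def[abs_def]
    by (rule derivative_eq_intros refl ds ds' dq r | simp)+ (simp add: at0 algebra_simps)
  then have "deriv F1 0 = (3 * a\<^sup>2 - 1) * dder \<xi> q \<xi> +
      - a * (- a * dder \<xi> (dder \<xi> q) \<xi> + dder e (dder \<xi> q) \<xi> + dder e q \<xi>)
       + (- a * dder e q \<xi> + (- a * dder \<xi> (dder e q) \<xi> + dder e (dder e q) \<xi>))"
    by (rule DERIV_imp_deriv)
  moreover have "deriv (deriv F) 0 = deriv F1 0"
    by (rule deriv_cong_ev) (use near[of 0] dF in \<open>auto elim!: eventually_mono\<close>)
  ultimately show ?thesis
    by (simp add: numeral_2_eq_2 F_def[symmetric] e_def[symmetric] a_def[symmetric]
        dder_commute[OF q, of \<xi> e] power2_eq_square[unfolded numeral_2_eq_2] algebra_simps)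
qed

text \<open>Summing \<open>second_derivative_radial\<close> over \<open>k\<close>, with \<open>\<Sum>\<^sub>k \<xi>\<^sub>k\<^sup>2 = 1\<close>, the coefficient of the gradient in
  the direction \<open>\<xi>\<close> is \<open>(3 - d) - 2 = - (d - 1)\<close>.\<close>

lemma laplace_beltrami_eq_sphere_op:
  fixes q :: "real ^ 'm \<Rightarrow> real"
  assumes q: "rpoly q" and xi: "norm \<xi> = 1" and f: "\<And>x. norm x = 1 \<Longrightarrow> f x = q x"
  shows "laplace_beltrami f \<xi> = sphere_op q \<xi>"
proof -
  have n1: "(\<Sum>k\<in>UNIV. (\<xi> $ k)\<^sup>2) = 1"
    using xi by (simp add: norm_eq_sqrt_inner inner_vec_def power2_eq_square)
  have 1: "(\<Sum>k\<in>UNIV. \<xi> $ k * dder (axis k 1) (dder \<xi> q) \<xi>) = dder \<xi> (dder \<xi> q) \<xi>"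
    by (rule dder_coords[symmetric]) (rule rpoly_dder[OF q])
  have 2: "(\<Sum>k\<in>UNIV. \<xi> $ k * dder (axis k 1) q \<xi>) = dder \<xi> q \<xi>"
    by (rule dder_coords[symmetric]) (rule q)
  have sd: "(deriv ^^ 2) (\<lambda>t. f (sgn (\<xi> + t *\<^sub>R axis k 1))) 0
    = dder (axis k 1) (dder (axis k 1) q) \<xi> - 2 * (\<xi> $ k * dder (axis k 1) (dder \<xi> q) \<xi>)
      + (\<xi> $ k)\<^sup>2 * dder \<xi> (dder \<xi> q) \<xi> + (3 * (\<xi> $ k)\<^sup>2 - 1) * dder \<xi> q \<xi>
          - 2 * (\<xi> $ k * dder (axis k 1) q \<xi>)" for k
    using second_derivative_radial[OF q xi] f by blast
  have "laplace_beltrami f \<xi> = (\<Sum>k\<in>UNIV. dder (axis k 1) (dder (axis k 1) q) \<xi>)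
      - 2 * dder \<xi> (dder \<xi> q) \<xi>
      + 1 * dder \<xi> (dder \<xi> q) \<xi> + (3 * 1 - real CARD('m)) * dder \<xi> q \<xi> - 2 * dder \<xi> q \<xi>"
    unfolding laplace_beltrami_def laplacian_def sd
    by (simp only: sum.distrib sum_subtractf sum_distrib_left[symmetric] sum_distrib_right[symmetric]
        n1 1 2) simp
  then show ?thesis
    by (simp add: sphere_op_def hess_rad_def euler_def algebra_simps)
qed

lemma diff_op_eq_surface_op:
  fixes p u :: "(real ^ 'm) \<times> (real ^ 'd) \<Rightarrow> real"
  assumes m: "CARD('m) \<ge> 2" and p: "rpoly p" and u: "\<And>z. z \<in> surface \<Longrightarrow> u z = p z"
    and xy: "(x, y) \<in> surface" "coord_sum y < 1"
  shows "diff_op \<kappa> u (x, y) = surface_op \<kappa> p (x, y)"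
proof -
  define \<xi> where "\<xi> = sgn x"
  define g where "g = (\<lambda>\<eta>. u (surface_param (\<xi>, \<eta>)))"
  define G where "G = (\<lambda>\<eta>. p (surface_param (\<xi>, \<eta>)))"
  have y: "y \<in> simplex_set" and nx: "norm x = 1 - coord_sum y" using xy by (auto simp: surface_def)
  have nx0: "norm x \<noteq> 0" using nx xy(2) by linarith
  have xi: "norm \<xi> = 1" using nx xy(2) by (auto simp: \<xi>_def norm_sgn)
  have on_surface: "surface_param (\<zeta>, \<eta>) \<in> surface"
      if "norm \<zeta> = 1" "\<eta> \<in> simplex_set" "coord_sum \<eta> < 1" for \<zeta> :: "real ^ 'm" and \<eta> :: "real ^ 'd"
    using that by (simp add: surface_def surface_param_def)
  have G: "rpoly G" unfolding G_def by (rule rpoly_param_y[OF p])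
  have gG: "g \<eta> = G \<eta>" if "\<eta> \<in> simplex_set" "coord_sum \<eta> < 1" for \<eta>
    unfolding g_def G_def by (rule u[OF on_surface[OF xi that]])
  have p1: "partial_y i g \<eta> = dder (axis i 1) G \<eta>" if "\<eta> \<in> simplex_set" "coord_sum \<eta> < 1" for i \<eta>
    by (rule partial_y_eq_dder[OF gG G that])
  have p2: "partial_y i (partial_y i g) y = dder (axis i 1) (dder (axis i 1) G) y" for i
    by (rule partial_y_eq_dder[OF p1 rpoly_dder[OF G] y xy(2)])
  have e1: "euler_y g \<eta> = euler G \<eta>" if "\<eta> \<in> simplex_set" "coord_sum \<eta> < 1" for \<eta>
    unfolding euler_y_def euler_coords[OF G] by (simp add: p1[OF that])
  have e2: "euler_y (euler_y g) y = hess_rad G y + euler G y"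
    unfolding euler_euler[OF G, symmetric] euler_y_def[of "euler_y g"]
        euler_coords[OF rpoly_euler[OF G]]
    by (simp add: partial_y_eq_dder[OF e1 rpoly_euler[OF G] y xy(2)])
  have "laplace_beltrami (\<lambda>\<zeta>. u (surface_param (\<zeta>, y))) \<xi> = (1 - coord_sum y) * angular_part p (\<xi>, y)"
    unfolding sphere_op_param[OF p, symmetric]
    by (rule laplace_beltrami_eq_sphere_op[OF rpoly_param_x[OF p] xi])
        (rule u[OF on_surface[OF _ y xy(2)]])
  then have lb: "1 / (1 - coord_sum y) * laplace_beltrami (\<lambda>\<zeta>. u (surface_param (\<zeta>, y))) \<xi>
      = angular_part p (\<xi>, y)"
    using xy(2) by simp
  have k: "real (CARD('m) - 2) = real CARD('m) - 2" using m by simp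
  have "diff_op \<kappa> u (x, y) = simplex_op \<kappa> (CARD('m) - 2) G y + angular_part p (\<xi>, y)"
    unfolding diff_op_def prod.case Let_def \<xi>_def[symmetric] g_def[symmetric] lb
    by (simp add: p1[OF y xy(2)] p2 e1[OF y xy(2)] e2 simplex_op_def k algebra_simps)
  also have "\<dots> = surface_op \<kappa> p (surface_param (\<xi>, y))"
    unfolding G_def by (rule simplex_op_param[OF p m])
  also have "surface_param (\<xi>, y) = (x, y)"
    using nx0 by (simp add: surface_param_def \<xi>_def sgn_div_norm nx[symmetric])
  finally show ?thesis .
qed

section \<open>Polynomials as combinations of monomials\<close>

definition monomial :: "('m::finite \<Rightarrow> nat) \<times> ('d::finite \<Rightarrow> nat) \<Rightarrow> (real ^ 'm) \<times> (real ^ 'd) \<Rightarrow> real"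
    where
  "monomial e z = (\<Prod>i\<in>UNIV. (fst z $ i) ^ fst e i) * (\<Prod>j\<in>UNIV. (snd z $ j) ^ snd e j)"

lemma polys_upto_iff:
  "p \<in> polys_upto n \<longleftrightarrow> (\<exists>c. p = (\<lambda>z. \<Sum>e\<in>exponents n. c e * monomial e z))"
  by (auto simp: polys_upto_def monomial_def fun_eq_iff case_prod_beta mult.assoc)

text \<open>The two nested inductions, over the exponent of one coordinate and over the set of coordinates, build
  the monomial from the constant one by multiplications with coordinates.\<close>

lemma deg_less_monomial:
  fixes e :: "('m::finite \<Rightarrow> nat) \<times> ('d::finite \<Rightarrow> nat)"
  assumes "e \<in> exponents n"
  shows "deg_less (Suc n) (monomial e)"
proof -
  have pow: "deg_less (n + k) (\<lambda>z. l z ^ k * f z)" if "bounded_linear l" "deg_less n f"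
    for n k and l f :: "(real ^ 'm) \<times> (real ^ 'd) \<Rightarrow> real"
  proof (induction k)
    case (Suc k)
    have "deg_less (Suc (n + k)) (\<lambda>z. l z * (l z ^ k * f z))"
      by (rule deg_less.linear_mult[OF that(1) Suc])
    then show ?case by (simp add: mult.assoc)
  qed (use that in simp)
  have prod: "deg_less (n + sum a I) (\<lambda>z. (\<Prod>i\<in>I. l i z ^ a i) * f z)"
    if "finite I" "\<And>i. bounded_linear (l i)" "deg_less n f"
    for n I and a :: "'i \<Rightarrow> nat" and l and f :: "(real ^ 'm) \<times> (real ^ 'd) \<Rightarrow> real"
    using that(1)
  proof (induction I rule: finite_induct)
    case (insert i I)
    have "deg_less (n + sum a I + a i) (\<lambda>z. l i z ^ a i * ((\<Prod>i\<in>I. l i z ^ a i) * f z))"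
      by (rule pow[OF that(2) insert.IH])
    moreover have "n + sum a I + a i = n + sum a (insert i I)" using insert.hyps by simp
    moreover have "(\<Prod>i\<in>insert i I. l i z ^ a i) * f z = l i z ^ a i * ((\<Prod>i\<in>I. l i z ^ a i) * f z)" for z
      using insert.hyps by (simp add: mult.assoc)
    ultimately show ?case by (simp only:)
  qed (use that in simp)
  have b1: "bounded_linear (\<lambda>z :: (real ^ 'm) \<times> (real ^ 'd). snd z $ i)" for i
    by (intro bounded_linear_compose[OF bounded_linear_vec_nth bounded_linear_snd])
  have b2: "bounded_linear (\<lambda>z :: (real ^ 'm) \<times> (real ^ 'd). fst z $ i)" for i
    by (intro bounded_linear_compose[OF bounded_linear_vec_nth bounded_linear_fst])
  have "deg_less (Suc 0 + sum (snd e) UNIV + sum (fst e) UNIV)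
     (\<lambda>z. (\<Prod>i\<in>UNIV. fst z $ i ^ fst e i) * ((\<Prod>j\<in>UNIV. snd z $ j ^ snd e j) * 1))"
    by (intro prod b1 b2 deg_less.const) auto
  then have "deg_less (Suc 0 + sum (snd e) UNIV + sum (fst e) UNIV) (monomial e)"
    by (simp add: monomial_def[abs_def])
  then show ?thesis
    by (rule deg_less_mono) (use assms in \<open>auto simp: exponents_def\<close>)
qed

lemma polys_upto_imp_deg_less: "p \<in> polys_upto n \<Longrightarrow> deg_less (Suc n) p"
  by (auto simp: polys_upto_iff intro!: deg_less_sum deg_less_cmult deg_less_monomial)

lemma monomial_in_polys_upto:
  assumes "e \<in> exponents n" shows "monomial e \<in> polys_upto n"
proof -
  have "monomial e z = (\<Sum>e'\<in>exponents n. (if e' = e then 1 else 0) * monomial e' z)" for z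
    using assms by (simp add: if_distrib[of "\<lambda>c. c * _"] finite_exponents cong: if_cong)
  then show ?thesis unfolding polys_upto_iff by (intro exI ext)
qed

lemma polys_upto_add: "p \<in> polys_upto n \<Longrightarrow> q \<in> polys_upto n \<Longrightarrow> (\<lambda>z. p z + q z) \<in> polys_upto n"
proof -
  assume "p \<in> polys_upto n" "q \<in> polys_upto n"
  then obtain c d where "p = (\<lambda>z. \<Sum>e\<in>exponents n. c e * monomial e z)"
      "q = (\<lambda>z. \<Sum>e\<in>exponents n. d e * monomial e z)"
    by (auto simp: polys_upto_iff)
  then have "(\<lambda>z. p z + q z) = (\<lambda>z. \<Sum>e\<in>exponents n. (c e + d e) * monomial e z)"
    by (simp add: sum.distrib distrib_right)
  then show ?thesis unfolding polys_upto_iff by (rule exI[of _ "\<lambda>e. c e + d e"])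
qed

lemma polys_upto_cmult: "p \<in> polys_upto n \<Longrightarrow> (\<lambda>z. c * p z) \<in> polys_upto n"
proof -
  assume "p \<in> polys_upto n"
  then obtain d where "p = (\<lambda>z. \<Sum>e\<in>exponents n. d e * monomial e z)"
    by (auto simp: polys_upto_iff)
  then have "(\<lambda>z. c * p z) = (\<lambda>z. \<Sum>e\<in>exponents n. (c * d e) * monomial e z)"
    by (simp add: sum_distrib_left mult.assoc)
  then show ?thesis unfolding polys_upto_iff by (rule exI[of _ "\<lambda>e. c * d e"])
qed

lemma polys_upto_zero: "(\<lambda>z. 0) \<in> polys_upto n"
  unfolding polys_upto_iff by (rule exI[of _ "\<lambda>e. 0"]) simp

lemma polys_upto_sum: "(\<And>i. i \<in> I \<Longrightarrow> p i \<in> polys_upto n) \<Longrightarrow> (\<lambda>z. \<Sum>i\<in>I. p i z) \<in> polys_upto n"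
  by (induction I rule: infinite_finite_induct) (auto intro: polys_upto_zero polys_upto_add)

text \<open>Multiplication by a coordinate raises one exponent of each monomial.\<close>

lemma polys_upto_coord_mult:
  assumes "p \<in> polys_upto n"
  shows "(\<lambda>z. fst z $ i * p z) \<in> polys_upto (Suc n)" "(\<lambda>z. snd z $ j * p z) \<in> polys_upto (Suc n)"
proof -
  obtain c where p: "p = (\<lambda>z. \<Sum>e\<in>exponents n. c e * monomial e z)"
    using assms by (auto simp: polys_upto_iff)
  have upd: "t $ k * (\<Prod>i\<in>UNIV. t $ i ^ a i) = (\<Prod>i\<in>UNIV. t $ i ^ (a(k := Suc (a k))) i)"
    for t :: "real ^ 'n" and k a
  proof -
    have "(\<Prod>i\<in>UNIV. t $ i ^ (a(k := Suc (a k))) i)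
        = (\<Prod>i\<in>UNIV. (if i = k then t $ k else 1) * t $ i ^ a i)"
      by (intro prod.cong) auto
    also have "\<dots> = t $ k * (\<Prod>i\<in>UNIV. t $ i ^ a i)" by (subst prod.distrib) simp
    finally show ?thesis ..
  qed
  have sum_upd: "sum (a(k := Suc (a k))) UNIV = Suc (sum a UNIV)" for a :: "'n::finite \<Rightarrow> nat" and k
  proof -
    have "sum (a(k := Suc (a k))) UNIV = (\<Sum>i\<in>UNIV. (if i = k then 1 else 0) + a i)"
      by (intro sum.cong) auto
    then show ?thesis by (simp add: sum.distrib)
  qed
  have m1: "fst z $ i * monomial e z = monomial ((fst e)(i := Suc (fst e i)), snd e) z"
      for e and z :: "(real ^ 'a) \<times> (real ^ 'b)"
    by (simp add: monomial_def upd[symmetric] mult.assoc del: fun_upd_apply)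
  have m2: "snd z $ j * monomial e z = monomial (fst e, (snd e)(j := Suc (snd e j))) z"
      for e and z :: "(real ^ 'a) \<times> (real ^ 'b)"
    by (simp add: monomial_def upd[symmetric] ac_simps del: fun_upd_apply)
  have "(\<lambda>z. \<Sum>e\<in>exponents n. c e * (fst z $ i * monomial e z)) \<in> polys_upto (Suc n)"
    "(\<lambda>z. \<Sum>e\<in>exponents n. c e * (snd z $ j * monomial e z)) \<in> polys_upto (Suc n)"
    unfolding m1 m2
    by (intro polys_upto_sum polys_upto_cmult monomial_in_polys_upto;
        auto simp: exponents_def sum_upd simp del: fun_upd_apply)+
  then show "(\<lambda>z. fst z $ i * p z) \<in> polys_upto (Suc n)" "(\<lambda>z. snd z $ j * p z) \<in> polys_upto (Suc n)"
    by (simp_all add: p sum_distrib_left mult.left_commute)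
qed

lemma deg_less_imp_polys_upto:
  fixes p :: "(real ^ 'm) \<times> (real ^ 'd) \<Rightarrow> real"
  assumes "deg_less (Suc n) p" shows "p \<in> polys_upto n"
proof -
  have "p \<in> polys_upto (N - 1)" if "deg_less N p" for N and p :: "(real ^ 'm) \<times> (real ^ 'd) \<Rightarrow> real"
    using that
  proof (induction rule: deg_less.induct)
    case (zero n)
    show ?case by (rule polys_upto_zero)
  next
    case (const n c)
    have "monomial ((\<lambda>_. 0, \<lambda>_. 0) :: ('m \<Rightarrow> nat) \<times> ('d \<Rightarrow> nat)) \<in> polys_upto n"
      by (rule monomial_in_polys_upto) (simp add: exponents_def)
    from polys_upto_cmult[OF this, of c] show ?case by (simp add: monomial_def)
  next
    case (linear_mult l n f)
    show ?case
    proof (cases n)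
      case 0
      with linear_mult(2) show ?thesis by (simp add: deg_less_0 polys_upto_zero)
    next
      case (Suc k)
      interpret bounded_linear l by fact
      have lz: "l z = (\<Sum>i\<in>UNIV. l (axis i 1, 0) * fst z $ i) + (\<Sum>j\<in>UNIV. l (0, axis j 1) * snd z $ j)"
          for z
      proof -
        have "l z = l ((fst z, 0) + (0, snd z))" by simp
        then have "l z = l (fst z, 0) + l (0, snd z)" by (simp only: add)
        moreover have "l (fst z, 0) = (\<Sum>i\<in>UNIV. l (axis i 1, 0) * fst z $ i)"
          by (rule linear_functional_coords[of "\<lambda>x. l (x, 0)"])
             (rule bounded_linear_compose[OF linear_mult(1)
                 bounded_linear_Pair[OF bounded_linear_ident bounded_linear_zero]])
        moreover have "l (0, snd z) = (\<Sum>j\<in>UNIV. l (0, axis j 1) * snd z $ j)"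
          by (rule linear_functional_coords[of "\<lambda>y. l (0, y)"])
             (rule bounded_linear_compose[OF linear_mult(1)
                 bounded_linear_Pair[OF bounded_linear_zero bounded_linear_ident]])
        ultimately show ?thesis by simp
      qed
      have "(\<lambda>z. l z * f z) = (\<lambda>z. (\<Sum>i\<in>UNIV. l (axis i 1, 0) * (fst z $ i * f z))
          + (\<Sum>j\<in>UNIV. l (0, axis j 1) * (snd z $ j * f z)))"
        by (rule ext, subst lz) (simp add: distrib_right sum_distrib_right mult.assoc)
      moreover have "\<dots> \<in> polys_upto (Suc k)"
        using linear_mult.IH Suc
        by (intro polys_upto_add polys_upto_sum polys_upto_cmult polys_upto_coord_mult) auto
      ultimately show ?thesis using Suc by simp
    qed
  next
    case (add n f g)
    then show ?case by (intro polys_upto_add)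
  qed
  from this[OF assms] show ?thesis by simp
qed

section \<open>The inner product of the surface\<close>

lemma pair_sigma_finite_sphere: "sigma_finite_measure N \<Longrightarrow> pair_sigma_finite sphere_measure N"
  by (intro pair_sigma_finite.intro finite_measure.axioms(1)[OF finite_measure_sphere])

lemma measurable_sphere_pair:
  fixes F :: "(real ^ 'm) \<times> (real ^ 'd) \<Rightarrow> real"
  assumes "F \<in> borel_measurable borel" "(\<lambda>y. y) \<in> N \<rightarrow>\<^sub>M borel"
  shows "F \<in> borel_measurable (sphere_measure \<Otimes>\<^sub>M N)"
proof -
  have "(\<lambda>w. (fst w, snd w)) \<in> sphere_measure \<Otimes>\<^sub>M N \<rightarrow>\<^sub>M borel \<Otimes>\<^sub>M borel"
    by (intro measurable_Pair measurable_compose[OF measurable_snd assms(2)])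
       (simp_all cong: measurable_cong_sets)
  then show ?thesis
    using measurable_compose[OF _ assms(1)] by (simp add: borel_prod)
qed

text \<open>On the support of the measure \<open>F\<close> is bounded, so the absolute value of the integrand is at most a
  multiple of the integrable weight.\<close>

lemma integrable_sphere_dirichlet:
  fixes F :: "(real ^ 'm) \<times> (real ^ 'd) \<Rightarrow> real" and \<kappa> :: "real ^ 'd"
  assumes F: "continuous_on UNIV F" and \<kappa>: "\<And>i. \<kappa> $ i > -1"
  shows "integrable (sphere_measure \<Otimes>\<^sub>M lborel) (\<lambda>w. F w * dirichlet \<kappa> k (snd w))"
proof -
  interpret P: pair_sigma_finite "sphere_measure :: (real ^ 'm) measure" "lborel :: (real ^ 'd) measure"
    by (rule pair_sigma_finite_sphere) (rule sigma_finite_lborel)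
  interpret S: finite_measure "sphere_measure :: (real ^ 'm) measure" by (rule finite_measure_sphere)
  have "bounded (F ` (cball 0 1 \<times> cbox 0 1))"
    by (intro compact_imp_bounded compact_continuous_image continuous_on_subset[OF F] compact_Times
        compact_cball compact_cbox) auto
  then obtain B where "\<forall>w\<in>cball 0 1 \<times> cbox 0 1. \<bar>F w\<bar> \<le> B"
    by (auto simp: bounded_iff)
  then have B: "\<bar>F (\<xi>, y)\<bar> \<le> B" if "norm \<xi> \<le> 1" "y \<in> open_simplex" for \<xi> y
    using that simplex_in_cube open_simplex_subset by (fastforce simp: mem_cball_0)
  have le: "norm (F (\<xi>, y) * dirichlet \<kappa> k y) \<le> B * dirichlet \<kappa> k y" if "norm \<xi> \<le> 1" for \<xi> y
  proof (cases "y \<in> open_simplex")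
    case True
    then show ?thesis using B[OF that True] dirichlet_nonneg[of \<kappa> k y]
        by (simp add: abs_mult mult_right_mono)
  qed (simp add: dirichlet_def)
  have meas: "(\<lambda>w. F w * dirichlet \<kappa> k (snd w)) \<in> borel_measurable (sphere_measure \<Otimes>\<^sub>M lborel)"
    by (intro borel_measurable_times measurable_sphere_pair borel_measurable_continuous_onI F
        measurable_compose[OF measurable_snd]) auto
  have int: "integrable lborel (\<lambda>y. B * dirichlet \<kappa> k y)"
    using integrable_dirichlet[OF \<kappa>] by simp
  have measy: "(\<lambda>y. F (\<xi>, y) * dirichlet \<kappa> k y) \<in> borel_measurable lborel" for \<xi>
    using measurable_Pair2[OF meas, of \<xi>] by simp
  have inty: "integrable lborel (\<lambda>y. F (\<xi>, y) * dirichlet \<kappa> k y)" if "norm \<xi> \<le> 1" for \<xi>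
    by (rule Bochner_Integration.integrable_bound[OF int measy])
       (use le[OF that] in \<open>auto intro: order_trans[OF _ abs_ge_self]\<close>)
  show ?thesis
  proof (rule P.Fubini_integrable[OF meas])
    show "AE \<xi> in sphere_measure. integrable lborel (\<lambda>y. F (\<xi>, y) * dirichlet \<kappa> k (snd (\<xi>, y)))"
      using AE_sphere_norm by eventually_elim (simp add: inty)
    show "integrable sphere_measure (\<lambda>\<xi>. \<integral>y. norm (F (\<xi>, y) * dirichlet \<kappa> k (snd (\<xi>, y))) \<partial>lborel)"
    proof (rule S.integrable_const_bound[where B = "\<integral>y. B * dirichlet \<kappa> k y \<partial>lborel"])
      show "AE \<xi> in sphere_measure. norm (\<integral>y. norm (F (\<xi>, y) * dirichlet \<kappa> k (snd (\<xi>, y))) \<partial>lborel)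
          \<le> (\<integral>y. B * dirichlet \<kappa> k y \<partial>lborel)"
        using AE_sphere_norm
      proof eventually_elim
        case (elim \<xi>)
        then have "(\<integral>y. norm (F (\<xi>, y) * dirichlet \<kappa> k y) \<partial>lborel) \<le> (\<integral>y. B * dirichlet \<kappa> k y \<partial>lborel)"
          by (intro integral_mono integrable_norm inty int le) simp_all
        moreover have "0 \<le> (\<integral>y. norm (F (\<xi>, y) * dirichlet \<kappa> k y) \<partial>lborel)"
          by (rule Bochner_Integration.integral_nonneg) simp
        ultimately show ?case by simp
      qed
      show "(\<lambda>\<xi>. \<integral>y. norm (F (\<xi>, y) * dirichlet \<kappa> k (snd (\<xi>, y))) \<partial>lborel)
          \<in> borel_measurable sphere_measure"
        by (intro lborel.borel_measurable_lebesgue_integral)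
            (use measurable_compose[OF meas borel_measurable_norm] in \<open>simp add: case_prod_unfold\<close>)
    qed
  qed
qed

lemma continuous_surface_param: "continuous_on UNIV surface_param"
  by (rule continuous_on_polymonial_function[OF polynomial_surface_param])

lemma rpoly_surface_continuous:
  fixes f :: "(real ^ 'm) \<times> (real ^ 'd) \<Rightarrow> real"
  assumes "rpoly f" shows "continuous_on UNIV (\<lambda>w. f (surface_param w))"
  by (rule continuous_on_compose2[OF rpoly_continuous_on[OF assms, of UNIV] continuous_surface_param])
      auto

lemma angular_part_continuous:
  fixes f :: "(real ^ 'm) \<times> (real ^ 'd) \<Rightarrow> real"
  assumes f: "rpoly f" shows "continuous_on UNIV (angular_part f)"
proof -
  note r = rpoly_intros rpoly_dder f
  have 1: "dder (\<xi>, 0) h z = (\<Sum>i\<in>UNIV. \<xi> $ i * dder (axis i 1, 0) h z)"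
    if "rpoly h" for h :: "(real ^ 'm) \<times> (real ^ 'd) \<Rightarrow> real" and \<xi> z
  proof -
    have "(\<xi>, 0) = (\<Sum>i\<in>UNIV. (\<xi> $ i) *\<^sub>R (axis i 1, 0 :: real ^ 'd))"
      by (simp add: prod_eq_iff fst_sum snd_sum vec_eq_sum_axis)
    then show ?thesis using dder_vec_sum_scale[OF that, of "\<lambda>i. \<xi> $ i" "\<lambda>i. (axis i 1, 0)" UNIV] by simp
  qed
  have 2: "dder (\<xi>, 0) (dder (\<xi>, 0) f) z
      = (\<Sum>i\<in>UNIV. \<xi> $ i * (\<Sum>j\<in>UNIV. \<xi> $ j * dder (axis j 1, 0) (dder (axis i 1, 0) f) z))" for \<xi> z
  proof -
    have "dder (\<xi>, 0) f = (\<lambda>z. \<Sum>i\<in>UNIV. \<xi> $ i * dder (axis i 1, 0) f z)"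
      using 1[OF f] by blast
    then have "dder (\<xi>, 0) (dder (\<xi>, 0) f) z = (\<Sum>i\<in>UNIV. \<xi> $ i * dder (\<xi>, 0) (dder (axis i 1, 0) f) z)"
      by (simp add: r dder_sum dder_cmult)
    then show ?thesis by (simp only: 1[OF rpoly_dder[OF f], of \<xi>])
  qed
  have "continuous_on UNIV (\<lambda>w. (1 - coord_sum (snd w))
      * (\<Sum>k\<in>UNIV. dder (axis k 1, 0) (dder (axis k 1, 0) f) (surface_param w))
     - (1 - coord_sum (snd w)) * (\<Sum>i\<in>UNIV. fst w $ i
         * (\<Sum>j\<in>UNIV. fst w $ j * dder (axis j 1, 0) (dder (axis i 1, 0) f) (surface_param w)))
     - (real CARD('m) - 1) * (\<Sum>i\<in>UNIV. fst w $ i * dder (axis i 1, 0) f (surface_param w)))"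
    by (intro continuous_intros rpoly_surface_continuous r)
  moreover have "angular_part f = (\<lambda>w. (1 - coord_sum (snd w))
      * (\<Sum>k\<in>UNIV. dder (axis k 1, 0) (dder (axis k 1, 0) f) (surface_param w))
     - (1 - coord_sum (snd w)) * (\<Sum>i\<in>UNIV. fst w $ i
         * (\<Sum>j\<in>UNIV. fst w $ j * dder (axis j 1, 0) (dder (axis i 1, 0) f) (surface_param w)))
     - (real CARD('m) - 1) * (\<Sum>i\<in>UNIV. fst w $ i * dder (axis i 1, 0) f (surface_param w)))"
  proof
    fix w
    show "angular_part f w = (1 - coord_sum (snd w))
        * (\<Sum>k\<in>UNIV. dder (axis k 1, 0) (dder (axis k 1, 0) f) (surface_param w))
     - (1 - coord_sum (snd w)) * (\<Sum>i\<in>UNIV. fst w $ i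
         * (\<Sum>j\<in>UNIV. fst w $ j * dder (axis j 1, 0) (dder (axis i 1, 0) f) (surface_param w)))
     - (real CARD('m) - 1) * (\<Sum>i\<in>UNIV. fst w $ i * dder (axis i 1, 0) f (surface_param w))"
      unfolding angular_part_def case_prod_unfold Let_def 2[of "fst w"] 1[OF f, of "fst w"] by simp
  qed
  ultimately show ?thesis by (simp only:)
qed

lemma rpoly_surface_op:
  fixes f :: "(real ^ 'm) \<times> (real ^ 'd) \<Rightarrow> real"
  assumes "rpoly f" shows "rpoly (surface_op \<kappa> f)"
proof -
  obtain n where "deg_less (Suc n) f" using rpoly_imp_deg_less[OF assms] deg_less_mono le_SucI
      order_refl by metis
  from deg_less_rpoly[OF surface_op_degree[OF this, of \<kappa>]]
  have "rpoly (\<lambda>z. surface_op \<kappa> f z + real n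
      * (real n + coord_sum \<kappa> + real CARD('m) + real CARD('d) - 2) * f z)" .
  from real_polynomial_function_diff[OF this,
      of "\<lambda>z. real n * (real n + coord_sum \<kappa> + real CARD('m) + real CARD('d) - 2) * f z"]
  show ?thesis using assms by (simp add: rpoly_intros)
qed

text \<open>Fubini's theorem is used in both orders: for fixed \<open>\<xi>\<close> the Jacobi part \<open>A\<close> is symmetric by
  \<open>simplex_op_symmetric\<close>, and for fixed \<open>y\<close> the angular part \<open>C\<close> by \<open>sphere_op_symmetric\<close>.\<close>

lemma surface_op_symmetric:
  fixes f g :: "(real ^ 'm) \<times> (real ^ 'd) \<Rightarrow> real"
  assumes f: "rpoly f" and g: "rpoly g" and m: "CARD('m) \<ge> 2" and \<kappa>: "\<And>i. \<kappa> $ i > -1"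
  defines "k \<equiv> CARD('m) - 2"
  shows "(\<integral>w. f (surface_param w) * surface_op \<kappa> g (surface_param w)
      * dirichlet \<kappa> k (snd w) \<partial>(sphere_measure \<Otimes>\<^sub>M lborel))
       = (\<integral>w. g (surface_param w) * surface_op \<kappa> f (surface_param w)
           * dirichlet \<kappa> k (snd w) \<partial>(sphere_measure \<Otimes>\<^sub>M lborel))"
proof -
  interpret P: pair_sigma_finite "sphere_measure :: (real ^ 'm) measure" "lborel :: (real ^ 'd) measure"
    by (rule pair_sigma_finite_sphere) (rule sigma_finite_lborel)
  let ?s = surface_param
  define A where "A f g w = f (?s w) * (surface_op \<kappa> g (?s w) - angular_part g w)"
      for f g :: "(real ^ 'm) \<times> (real ^ 'd) \<Rightarrow> real" and w
  define C where "C f g w = f (?s w) * angular_part g w"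
      for f g :: "(real ^ 'm) \<times> (real ^ 'd) \<Rightarrow> real" and w
  have intA: "integrable (sphere_measure \<Otimes>\<^sub>M lborel) (\<lambda>w. A f g w * dirichlet \<kappa> k (snd w))"
    and intC: "integrable (sphere_measure \<Otimes>\<^sub>M lborel) (\<lambda>w. C f g w * dirichlet \<kappa> k (snd w))"
        if "rpoly f" "rpoly g" for f g
    unfolding A_def C_def
    by (intro integrable_sphere_dirichlet \<kappa> continuous_intros rpoly_surface_continuous
        angular_part_continuous rpoly_surface_op that)+
  have split: "(\<integral>w. f (?s w) * surface_op \<kappa> g (?s w)
      * dirichlet \<kappa> k (snd w) \<partial>(sphere_measure \<Otimes>\<^sub>M lborel))
      = (\<integral>w. A f g w * dirichlet \<kappa> k (snd w) \<partial>(sphere_measure \<Otimes>\<^sub>M lborel))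
          + (\<integral>w. C f g w * dirichlet \<kappa> k (snd w) \<partial>(sphere_measure \<Otimes>\<^sub>M lborel))"
    if "rpoly f" "rpoly g" for f g
  proof -
    have "f (?s w) * surface_op \<kappa> g (?s w) * dirichlet \<kappa> k (snd w)
        = A f g w * dirichlet \<kappa> k (snd w) + C f g w * dirichlet \<kappa> k (snd w)" for w
      by (simp add: A_def C_def algebra_simps)
    then show ?thesis using intA[OF that] intC[OF that] by simp
  qed
  have symA: "(\<integral>w. A f g w * dirichlet \<kappa> k (snd w) \<partial>(sphere_measure \<Otimes>\<^sub>M lborel))
      = (\<integral>w. A g f w * dirichlet \<kappa> k (snd w) \<partial>(sphere_measure \<Otimes>\<^sub>M lborel))"
  proof -
    have A: "A f g (\<xi>, y) = f (?s (\<xi>, y)) * simplex_op \<kappa> k (\<lambda>y. g (?s (\<xi>, y))) y" if "rpoly g"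
        for f g \<xi> y
      unfolding A_def simplex_op_param[OF that m, symmetric] k_def by simp
    have "(\<integral>y. A f g (\<xi>, y) * dirichlet \<kappa> k y \<partial>lborel) = (\<integral>y. A g f (\<xi>, y) * dirichlet \<kappa> k y \<partial>lborel)"
        for \<xi>
      unfolding A[OF f] A[OF g]
      by (rule simplex_op_symmetric[OF \<kappa> rpoly_param_y[OF f] rpoly_param_y[OF g]])
    then show ?thesis
      unfolding P.integral_fst'[OF intA[OF f g], symmetric]
          P.integral_fst'[OF intA[OF g f], symmetric] by simp
  qed
  have symC: "(\<integral>w. C f g w * dirichlet \<kappa> k (snd w) \<partial>(sphere_measure \<Otimes>\<^sub>M lborel))
      = (\<integral>w. C g f w * dirichlet \<kappa> k (snd w) \<partial>(sphere_measure \<Otimes>\<^sub>M lborel))"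
  proof -
    have "(\<integral>\<xi>. C f g (\<xi>, y) * dirichlet \<kappa> k y \<partial>sphere_measure)
        = (\<integral>\<xi>. C g f (\<xi>, y) * dirichlet \<kappa> k y \<partial>sphere_measure)" for y
    proof (cases "y \<in> open_simplex")
      case True
      then have r: "1 - coord_sum y \<noteq> 0" by (auto simp: open_simplex_def)
      have C: "C f g (\<xi>, y) = f (?s (\<xi>, y)) * sphere_op (\<lambda>\<xi>. g (?s (\<xi>, y))) \<xi> / (1 - coord_sum y)"
          if "rpoly g" for f g \<xi>
        using r unfolding C_def sphere_op_param[OF that] by simp
      show ?thesis
        unfolding C[OF f] C[OF g]
        using sphere_op_symmetric[OF rpoly_param_x[OF f] rpoly_param_x[OF g], of y y] by simp
    qed (simp add: dirichlet_def)
    then have "(\<integral>y. (\<integral>\<xi>. C f g (\<xi>, y) * dirichlet \<kappa> k y \<partial>sphere_measure) \<partial>lborel)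
        = (\<integral>y. (\<integral>\<xi>. C g f (\<xi>, y) * dirichlet \<kappa> k y \<partial>sphere_measure) \<partial>lborel)"
      by (simp only:)
    then show ?thesis
      using P.integral_snd[of "\<lambda>\<xi> y. C f g (\<xi>, y) * dirichlet \<kappa> k y"]
          P.integral_snd[of "\<lambda>\<xi> y. C g f (\<xi>, y) * dirichlet \<kappa> k y"]
        intC[OF f g] intC[OF g f]
      by (simp only: case_prod_beta' snd_conv prod.collapse)
  qed
  show ?thesis using split[OF f g] split[OF g f] symA symC by simp
qed

lemma closed_surface: "closed (surface :: ((real ^ 'm) \<times> (real ^ 'd)) set)"
proof -
  have "surface = (\<Inter>i. {z :: (real ^ 'm) \<times> (real ^ 'd). 0 \<le> snd z $ i}) \<inter> {z. coord_sum (snd z) \<le> 1}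
      \<inter> {z. norm (fst z) = 1 - coord_sum (snd z)}"
    by (auto simp: surface_def simplex_set_def)
  also have "closed \<dots>"
    by (intro closed_Int closed_INT ballI closed_Collect_le closed_Collect_eq continuous_intros)
  finally show ?thesis .
qed

lemma borel_simplex_set: "simplex_set \<in> sets (borel :: (real ^ 'd) measure)"
proof -
  have "simplex_set = (\<Inter>i. {z :: real ^ 'd. 0 \<le> z $ i}) \<inter> {z. coord_sum z \<le> 1}"
    by (auto simp: simplex_set_def)
  also have "closed \<dots>"
    by (intro closed_Int closed_INT ballI closed_Collect_le continuous_intros)
  finally show ?thesis by simp
qed

text \<open>On the boundary of the simplex the left side is zero because \<open>0 powr b = 0\<close> and \<open>inverse 0 = 0\<close>, so
  the identity holds at every point of the closed simplex.\<close>

lemma weight_density_eq_dirichlet: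
  assumes "y \<in> simplex_set" and m: "CARD('m::finite) \<ge> 2"
  shows "(1 - coord_sum y) ^ (CARD('m) - 1) * weight \<kappa> (x :: real ^ 'm, y)
      = dirichlet \<kappa> (CARD('m) - 2) y"
proof (cases "y \<in> open_simplex")
  case True
  have "CARD('m) - 1 = Suc (CARD('m) - 2)" using m by simp
  then have "(1 - coord_sum y) ^ (CARD('m) - 1)
      = (1 - coord_sum y) * (1 - coord_sum y) ^ (CARD('m) - 2)" by simp
  then show ?thesis using True by (simp add: weight_def dirichlet_def open_simplex_def)
next
  case False
  then have "coord_sum y = 1 \<or> (\<exists>i. y $ i = 0)"
    using assms by (auto simp: open_simplex_def simplex_set_def less_le)
  then have "weight \<kappa> (x, y) = 0" by (auto simp: weight_def)
  then show ?thesis using False by (simp add: dirichlet_def)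
qed

text \<open>Unfolding the push-forward and the density gives an integral over the product of the sphere and the
  closed simplex. Its integrand \<open>G\<close> agrees with \<open>H\<close>, extended
      by zero to all \<open>y\<close>, only where \<open>\<xi>\<close> has norm
  one, that is for almost all \<open>\<xi>\<close>; so the two are compared as iterated integrals.\<close>

lemma surface_integral:
  fixes f h :: "(real ^ 'm) \<times> (real ^ 'd) \<Rightarrow> real" and \<kappa> :: "real ^ 'd"
  assumes m: "CARD('m) \<ge> 2" and \<kappa>: "\<And>i. \<kappa> $ i > -1" and h: "rpoly h"
      and f: "\<And>z. z \<in> surface \<Longrightarrow> f z = h z"
  shows "(LINT z:surface|surface_measure. f z * weight \<kappa> z)
    = sqrt (1 + real CARD('d)) * (\<integral>w. h (surface_param w)
        * dirichlet \<kappa> (CARD('m) - 2) (snd w) \<partial>(sphere_measure \<Otimes>\<^sub>M lborel))"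
proof -
  let ?R = "restrict_space lborel simplex_set :: (real ^ 'd) measure"
  let ?q = "sqrt (1 + real CARD('d))"
  define I where "I z = indicator surface z * (h z * weight \<kappa> z)" for z
  define \<rho> where "\<rho> w = ?q * (1 - coord_sum (snd w)) ^ (CARD('m) - 1)"
      for w :: "(real ^ 'm) \<times> (real ^ 'd)"
  define G where "G w = \<rho> w * I (surface_param w)" for w
  define H where "H w = ?q * (h (surface_param w) * dirichlet \<kappa> (CARD('m) - 2) (snd w))" for w
  have R: "sigma_finite_measure ?R"
    by (rule sigma_finite_measure_restrict_space) (auto simp: borel_simplex_set sigma_finite_lborel)
  interpret PR: pair_sigma_finite "sphere_measure :: (real ^ 'm) measure" ?R
    by (rule pair_sigma_finite_sphere[OF R])
  interpret P: pair_sigma_finite "sphere_measure :: (real ^ 'm) measure" "lborel :: (real ^ 'd) measure"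
    by (rule pair_sigma_finite_sphere) (rule sigma_finite_lborel)
  have idR: "(\<lambda>y. y) \<in> ?R \<rightarrow>\<^sub>M borel" by (intro measurable_restrict_space1) simp
  have bs [measurable]: "surface_param \<in> borel \<rightarrow>\<^sub>M (borel :: ((real ^ 'm) \<times> (real ^ 'd)) measure)"
    by (intro borel_measurable_continuous_onI continuous_surface_param)
  have [measurable]: "surface \<in> sets (borel :: ((real ^ 'm) \<times> (real ^ 'd)) measure)"
    by (rule borel_closed[OF closed_surface])
  have [measurable]: "h \<in> borel_measurable borel" by (rule rpoly_measurable[OF h])
  have msnd: "(snd :: (real ^ 'm) \<times> (real ^ 'd) \<Rightarrow> _) \<in> borel \<rightarrow>\<^sub>M borel"
    by (intro borel_measurable_continuous_onI continuous_intros)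
  have mW: "weight \<kappa> \<in> borel_measurable (borel :: ((real ^ 'm) \<times> (real ^ 'd)) measure)"
  proof -
    have "(\<lambda>y. (\<Prod>i\<in>UNIV. (y $ i) powr (\<kappa> $ i)) * inverse (1 - coord_sum y)) \<in> borel_measurable borel"
      by measurable
    from measurable_compose[OF msnd this] show ?thesis by (simp add: weight_def case_prod_beta')
  qed
  have mI [measurable]: "I \<in> borel_measurable borel" unfolding I_def using mW by measurable
  have m\<rho>: "\<rho> \<in> borel_measurable borel"
    unfolding \<rho>_def by (intro borel_measurable_continuous_onI continuous_intros)
  have mG: "G \<in> borel_measurable borel" unfolding G_def using m\<rho> by measurable
  have GH: "indicator simplex_set y * G (\<xi>, y) = H (\<xi>, y)" if "norm \<xi> = 1" for \<xi> y
  proof (cases "y \<in> simplex_set")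
    case True
    then have "surface_param (\<xi>, y) \<in> surface"
      using that by (auto simp: surface_def surface_param_def simplex_set_def)
    then have "G (\<xi>, y) = ?q * (h (surface_param (\<xi>, y))
        * ((1 - coord_sum y) ^ (CARD('m) - 1) * weight \<kappa> ((1 - coord_sum y) *\<^sub>R \<xi>, y)))"
      by (simp add: G_def \<rho>_def I_def) (simp add: surface_param_def)
    then show ?thesis using True weight_density_eq_dirichlet[OF True m] by (simp add: H_def)
  next
    case False
    then have "y \<notin> open_simplex" using open_simplex_subset by blast
    then show ?thesis using False by (simp add: H_def dirichlet_def)
  qed
  have intH: "integrable (sphere_measure \<Otimes>\<^sub>M lborel) H"
    unfolding H_def by (intro integrable_mult_right integrable_sphere_dirichlet
        rpoly_surface_continuous h \<kappa>)
  have restr: "(\<integral>y. F y \<partial>?R) = (\<integral>y. indicator simplex_set y * F y \<partial>lborel)" for F :: "real ^ 'd \<Rightarrow> real"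
    by (subst integral_restrict_space) (auto simp: borel_simplex_set)
  have mGR: "G \<in> borel_measurable (sphere_measure \<Otimes>\<^sub>M ?R)"
    by (rule measurable_sphere_pair[OF mG idR])
  have intG: "integrable (sphere_measure \<Otimes>\<^sub>M ?R) G"
  proof (rule PR.Fubini_integrable[OF mGR])
    have "AE \<xi> in sphere_measure. integrable lborel (\<lambda>y. H (\<xi>, y))"
      using P.AE_integrable_fst'[OF intH] .
    with AE_sphere_norm show "AE \<xi> in sphere_measure. integrable ?R (\<lambda>y. G (\<xi>, y))"
      by eventually_elim (subst integrable_restrict_space, auto simp: borel_simplex_set GH)
    have "integrable sphere_measure (\<lambda>\<xi>. \<integral>y. norm (H (\<xi>, y)) \<partial>lborel)"
      by (rule P.integrable_fst'[OF integrable_norm[OF intH]])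
    then show "integrable sphere_measure (\<lambda>\<xi>. \<integral>y. norm (G (\<xi>, y)) \<partial>?R)"
    proof (rule integrable_cong_AE_imp)
      show "(\<lambda>\<xi>. \<integral>y. norm (G (\<xi>, y)) \<partial>?R) \<in> borel_measurable sphere_measure"
        by (intro PR.M2.borel_measurable_lebesgue_integral)
            (use measurable_compose[OF mGR borel_measurable_norm] in \<open>simp add: case_prod_unfold\<close>)
      show "AE \<xi> in sphere_measure. (\<integral>y. norm (H (\<xi>, y)) \<partial>lborel) = (\<integral>y. norm (G (\<xi>, y)) \<partial>?R)"
        using AE_sphere_norm
        by eventually_elim (simp add: restr GH[symmetric] abs_mult)
    qed
  qed
  have "(LINT z:surface|surface_measure. f z * weight \<kappa> z) = (\<integral>z. I z \<partial>surface_measure)"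
    unfolding set_lebesgue_integral_def I_def
    by (intro Bochner_Integration.integral_cong) (auto simp: f indicator_def)
  also have "\<dots> = (\<integral>w. I (surface_param w) \<partial>density (sphere_measure \<Otimes>\<^sub>M ?R) (\<lambda>w. ennreal (\<rho> w)))"
  proof -
    have "surface_param \<in> density (sphere_measure \<Otimes>\<^sub>M ?R) (\<lambda>w. ennreal (\<rho> w)) \<rightarrow>\<^sub>M
        (borel :: ((real ^ 'm) \<times> (real ^ 'd)) measure)"
    proof -
      have "(\<lambda>w. (fst w, snd w)) \<in> (sphere_measure :: (real ^ 'm) measure) \<Otimes>\<^sub>M ?R \<rightarrow>\<^sub>M borel \<Otimes>\<^sub>M borel"
        by (intro measurable_Pair measurable_compose[OF measurable_snd idR])
            (simp_all cong: measurable_cong_sets)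
      then show ?thesis using measurable_compose[OF _ bs] by (simp add: borel_prod)
    qed
    then show ?thesis
      unfolding surface_measure_def \<rho>_def[symmetric]
      by (subst integral_distr[OF _ mI]) (simp_all add: \<rho>_def case_prod_beta')
  qed
  also have "\<dots> = (\<integral>w. G w \<partial>(sphere_measure \<Otimes>\<^sub>M ?R))"
  proof (subst integral_density)
    show "(\<lambda>w. I (surface_param w)) \<in> borel_measurable (sphere_measure \<Otimes>\<^sub>M ?R)"
      by (rule measurable_sphere_pair[OF _ idR]) measurable
    show "\<rho> \<in> borel_measurable (sphere_measure \<Otimes>\<^sub>M ?R)"
      by (rule measurable_sphere_pair[OF m\<rho> idR])
    show "AE w in sphere_measure \<Otimes>\<^sub>M ?R. 0 \<le> \<rho> w"
      by (rule AE_I2) (auto simp: \<rho>_def space_pair_measure space_restrict_space simplex_set_def)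
  qed (simp add: G_def[abs_def])
  also have "\<dots> = (\<integral>\<xi>. (\<integral>y. G (\<xi>, y) \<partial>?R) \<partial>sphere_measure)"
    by (rule PR.integral_fst'[OF intG, symmetric])
  also have "\<dots> = (\<integral>\<xi>. (\<integral>y. H (\<xi>, y) \<partial>lborel) \<partial>sphere_measure)"
  proof (rule integral_cong_AE)
    show "(\<lambda>\<xi>. \<integral>y. G (\<xi>, y) \<partial>?R) \<in> borel_measurable sphere_measure"
      using PR.integrable_fst'[OF intG] by simp
    show "(\<lambda>\<xi>. \<integral>y. H (\<xi>, y) \<partial>lborel) \<in> borel_measurable sphere_measure"
      using P.integrable_fst'[OF intH] by simp
    show "AE \<xi> in sphere_measure. (\<integral>y. G (\<xi>, y) \<partial>?R) = (\<integral>y. H (\<xi>, y) \<partial>lborel)"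
      using AE_sphere_norm by eventually_elim (simp add: restr GH)
  qed
  also have "\<dots> = (\<integral>w. H w \<partial>(sphere_measure \<Otimes>\<^sub>M lborel))"
    by (rule P.integral_fst'[OF intH])
  finally show ?thesis by (simp add: H_def)
qed


lemma continuous_AE_zero:
  fixes f :: "'a::euclidean_space \<Rightarrow> real"
  assumes U: "open U" and f: "continuous_on U f" and ae: "AE x in lborel. x \<in> U \<longrightarrow> f x = 0"
      and x: "x \<in> U"
  shows "f x = 0"
proof -
  let ?V = "{x \<in> U. f x \<noteq> 0}"
  have "open ?V"
  proof -
    have "open (U \<inter> f -` (- {0}))" by (intro continuous_open_preimage f U) auto
    moreover have "U \<inter> f -` (- {0}) = ?V" by auto
    ultimately show ?thesis by simp
  qed
  moreover have "negligible ?V"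
  proof -
    have "AE x in lborel. x \<notin> ?V" using ae by eventually_elim auto
    then have "?V \<in> null_sets lborel"
      using \<open>open ?V\<close> by (subst AE_iff_null_sets) auto
    then show ?thesis by (simp add: negligible_iff_null_sets null_sets_completionI)
  qed
  ultimately have "?V = {}" using open_not_negligible by blast
  then show ?thesis using x by blast
qed

lemma simplex_subset_closure_open_simplex: "simplex_set \<subseteq> closure (open_simplex :: (real ^ 'd) set)"
proof
  fix y :: "real ^ 'd" assume y: "y \<in> simplex_set"
  define b :: "real ^ 'd" where "b = (\<chi> i. 1 / (2 * real CARD('d)))"
  have cb: "coord_sum b = 1 / 2" by (simp add: b_def coord_sum_def)
  define z where "z n = y + inverse (real (Suc n)) *\<^sub>R (b - y)" for n
  have "z \<longlonglongrightarrow> y + 0 *\<^sub>R (b - y)"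
    unfolding z_def by (intro tendsto_intros LIMSEQ_inverse_real_of_nat)
  moreover have "z n \<in> open_simplex" for n
  proof -
    define t where "t = inverse (real (Suc n))"
    have t: "0 < t" "t \<le> 1" by (auto simp: t_def divide_simps)
    have zn: "z n = (1 - t) *\<^sub>R y + t *\<^sub>R b" by (simp add: z_def t_def algebra_simps)
    have "0 < z n $ i" for i
      using y t by (auto simp: zn simplex_set_def b_def intro!: add_nonneg_pos mult_pos_pos)
    moreover have "coord_sum (z n) < 1"
    proof -
      have "(1 - t) * coord_sum y \<le> (1 - t) * 1"
        using y t by (intro mult_left_mono) (auto simp: simplex_set_def)
      then show ?thesis using t by (simp add: zn cb)
    qed
    ultimately show ?thesis by (simp add: open_simplex_def)
  qed
  ultimately show "y \<in> closure open_simplex" by (auto simp: closure_sequential intro!: exI[of _ z])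
qed

lemma dirichlet_pos: "y \<in> open_simplex \<Longrightarrow> 0 < dirichlet a k y"
proof -
  assume y: "y \<in> open_simplex"
  then have "0 < (y $ i) powr (a $ i)" for i
    by (simp add: open_simplex_def less_imp_neq[symmetric])
  then show ?thesis using y by (simp add: dirichlet_def open_simplex_def prod_pos)
qed

text \<open>The integrand is continuous, so vanishing almost everywhere implies vanishing first for all \<open>y\<close> in
  the open simplex, then for all \<open>\<xi>\<close>, and by continuity also on the boundary of the simplex.\<close>

lemma square_integral_zero_imp_zero:
  fixes v :: "(real ^ 'm) \<times> (real ^ 'd) \<Rightarrow> real" and \<kappa> :: "real ^ 'd"
  assumes v: "rpoly v" and \<kappa>: "\<And>i. \<kappa> $ i > -1"
    and zero: "(\<integral>w. v (surface_param w) * v (surface_param w)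
        * dirichlet \<kappa> k (snd w) \<partial>(sphere_measure \<Otimes>\<^sub>M lborel)) = 0"
    and xi: "norm \<xi> = 1" and y: "y \<in> simplex_set"
  shows "v (surface_param (\<xi>, y)) = 0"
proof -
  interpret P: pair_sigma_finite "sphere_measure :: (real ^ 'm) measure" "lborel :: (real ^ 'd) measure"
    by (rule pair_sigma_finite_sphere) (rule sigma_finite_lborel)
  let ?F = "\<lambda>w. v (surface_param w) * v (surface_param w) * dirichlet \<kappa> k (snd w)"
  have int: "integrable (sphere_measure \<Otimes>\<^sub>M lborel) ?F"
    by (intro integrable_sphere_dirichlet \<kappa> continuous_intros rpoly_surface_continuous v)
  have "AE w in sphere_measure \<Otimes>\<^sub>M lborel. ?F w = 0"
    using zero by (subst (asm) integral_nonneg_eq_0_iff_AE[OF int]) (auto simp: dirichlet_nonneg)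
  from P.AE_pair[OF this]
  have "AE \<xi> in sphere_measure. AE y in lborel. ?F (\<xi>, y) = 0" .
  then have ae: "AE \<xi> in sphere_measure. \<forall>y\<in>open_simplex. v (surface_param (\<xi>, y)) = 0"
  proof eventually_elim
    case (elim \<xi>)
    show ?case
    proof
      fix y :: "real ^ 'd" assume y: "y \<in> open_simplex"
      show "v (surface_param (\<xi>, y)) = 0"
      proof (rule continuous_AE_zero[OF open_open_simplex _ _ y])
        show "continuous_on open_simplex (\<lambda>y. v (surface_param (\<xi>, y)))"
          by (rule rpoly_continuous_on[OF rpoly_param_y[OF v]])
        show "AE y in lborel. y \<in> open_simplex \<longrightarrow> v (surface_param (\<xi>, y)) = 0"
          using elim by eventually_elim (auto dest: dirichlet_pos[where a = \<kappa> and k = k])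
      qed
    qed
  qed
  have interior: "v (surface_param (\<xi>, y)) = 0" if y: "y \<in> open_simplex" for y
  proof -
    \<comment> \<open>The measure on the sphere is an image of Lebesgue measure on the ball, and away from the origin
      the projection \<open>sgn\<close> is continuous. The point \<open>\<xi>\<close> is hit from \<open>\<xi> / 2\<close>.\<close>
    let ?U = "ball 0 1 - {0 :: real ^ 'm}"
    have "AE \<xi> in distr (unit_ball :: (real ^ 'm) measure) borel sgn. v (surface_param (\<xi>, y)) = 0"
      using ae unfolding sphere_measure_density
      by (subst (asm) AE_density) (use y in \<open>auto elim!: eventually_mono\<close>)
    then have "AE x in (unit_ball :: (real ^ 'm) measure). v (surface_param (sgn x, y)) = 0"
      by (rule AE_distrD[rotated]) measurable
    then have "AE x in lborel. x \<in> ?U \<longrightarrow> v (surface_param (sgn x, y)) = 0"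
      unfolding unit_ball_def by (subst (asm) AE_restrict_space_iff) (auto elim!: eventually_mono)
    then have "v (surface_param (sgn ((1 / 2) *\<^sub>R \<xi>), y)) = 0"
    proof (rule continuous_AE_zero[rotated 2])
      show "open ?U" by auto
      have "continuous_on ?U (\<lambda>x. inverse (norm x) *\<^sub>R x)"
        by (intro continuous_intros) auto
      then have "continuous_on ?U sgn" by (simp add: sgn_div_norm[abs_def])
      then show "continuous_on ?U (\<lambda>x. v (surface_param (sgn x, y)))"
        by (intro continuous_on_compose2[OF rpoly_continuous_on[OF rpoly_param_x[OF v], of UNIV]]) auto
      show "(1 / 2) *\<^sub>R \<xi> \<in> ?U" using xi by auto
    qed
    moreover have "sgn ((1 / 2) *\<^sub>R \<xi>) = \<xi>" using xi by (simp add: sgn_div_norm)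
    ultimately show ?thesis by simp
  qed
  have "closed {y. v (surface_param (\<xi>, y)) = 0}"
    by (intro closed_Collect_eq continuous_on_const rpoly_continuous_on rpoly_param_y v)
  then have "closure open_simplex \<subseteq> {y. v (surface_param (\<xi>, y)) = 0}"
    by (intro closure_minimal) (auto intro: interior)
  then show ?thesis using y simplex_subset_closure_open_simplex by blast
qed

section \<open>The eigenvalue equation\<close>

theorem theorem7p3:
  fixes \<kappa> :: "real ^ 'd2" and n :: nat
    and u :: "(real ^ 'd1) \<times> (real ^ 'd2) \<Rightarrow> real"
  assumes "CARD('d1) \<ge> 2"
    and "\<And>i. \<kappa> $ i > -1"
    and "u \<in> orth_space n (weight \<kappa>)"
  shows "\<forall>(x, y)\<in>surface. coord_sum y < 1 \<longrightarrow>
    diff_op \<kappa> u (x, y) =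
      - (real n * (real n + coord_sum \<kappa> + real CARD('d1) + real CARD('d2) - 2)) * u (x, y)"
proof -
  let ?k = "CARD('d1) - 2"
  let ?ev = "\<lambda>n. real n * (real n + coord_sum \<kappa> + real CARD('d1) + real CARD('d2) - 2)"
  let ?s = "surface_param :: (real ^ 'd1) \<times> (real ^ 'd2) \<Rightarrow> _"
  note m = assms(1) and \<kappa> = assms(2)
  obtain p where "p \<in> polys_upto n" and up: "\<And>z. z \<in> surface \<Longrightarrow> u z = p z"
    using assms(3) by (auto simp: orth_space_def)
  then have pn: "deg_less (Suc n) p" by (intro polys_upto_imp_deg_less)
  have p: "rpoly p" by (rule deg_less_rpoly[OF pn])
  have orth: "(\<integral>w. p (?s w) * q (?s w) * dirichlet \<kappa> ?k (snd w) \<partial>(sphere_measure \<Otimes>\<^sub>M lborel)) = 0"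
    if q: "deg_less n q" for q
  proof (cases n)
    case 0
    with q show ?thesis by (simp add: deg_less_0)
  next
    case (Suc j)
    then have "q \<in> polys_upto j" "j < n" using q by (auto intro: deg_less_imp_polys_upto)
    then have "(LINT z:surface|surface_measure. u z * q z * weight \<kappa> z) = 0"
      using assms(3) by (auto simp: orth_space_def)
    moreover have "(LINT z:surface|surface_measure. u z * q z * weight \<kappa> z)
        = sqrt (1 + real CARD('d2)) * (\<integral>w. (p (?s w) * q (?s w))
            * dirichlet \<kappa> ?k (snd w) \<partial>(sphere_measure \<Otimes>\<^sub>M lborel))"
      by (rule surface_integral[OF m \<kappa>, where h = "\<lambda>z. p z * q z"])
         (auto simp: up intro: rpoly_intros p deg_less_rpoly[OF q])
    ultimately show ?thesis by simp
  qed
  \<comment> \<open>The defect of the eigenvalue equation; it remains to show that it vanishes on the surface.\<close>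
  define v where "v z = surface_op \<kappa> p z + ?ev n * p z" for z
  have vn: "deg_less n v" unfolding v_def by (rule surface_op_degree[OF pn])
  have v: "rpoly v" by (rule deg_less_rpoly[OF vn])
  have Lvn: "deg_less n (surface_op \<kappa> v)"
  proof (cases n)
    case 0
    then have "v = (\<lambda>z. 0)" using vn by (simp add: deg_less_0)
    then have "surface_op \<kappa> v = (\<lambda>z. 0)"
      by (simp add: surface_op_def[abs_def] dder_const euler_def hess_rad_def)
    then show ?thesis by (simp add: deg_less.zero)
  next
    case (Suc j)
    have "deg_less n (\<lambda>z. surface_op \<kappa> v z + ?ev j * v z)"
      using deg_less_mono[OF surface_op_degree[of j v \<kappa>]] vn Suc by simp
    from deg_less_diff[OF this deg_less_cmult[OF vn, of "?ev j"]] show ?thesis by simp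
  qed
  let ?I = "\<lambda>F. \<integral>w. F w * dirichlet \<kappa> ?k (snd w) \<partial>(sphere_measure \<Otimes>\<^sub>M lborel)"
  have "?I (\<lambda>w. v (?s w) * v (?s w)) = 0"
  proof -
    have int: "integrable (sphere_measure \<Otimes>\<^sub>M lborel)
        (\<lambda>w. (v (?s w) * surface_op \<kappa> p (?s w)) * dirichlet \<kappa> ?k (snd w))"
      "integrable (sphere_measure \<Otimes>\<^sub>M lborel) (\<lambda>w. (p (?s w) * v (?s w)) * dirichlet \<kappa> ?k (snd w))"
      by (intro integrable_sphere_dirichlet \<kappa> continuous_intros rpoly_surface_continuous
          rpoly_surface_op p v)+
    have "v (?s w) * v (?s w) * dirichlet \<kappa> ?k (snd w)
        = v (?s w) * surface_op \<kappa> p (?s w) * dirichlet \<kappa> ?k (snd w)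
            + ?ev n * (p (?s w) * v (?s w) * dirichlet \<kappa> ?k (snd w))" for w
      by (subst (2) v_def) (simp add: algebra_simps)
    then have "?I (\<lambda>w. v (?s w) * v (?s w))
        = ?I (\<lambda>w. v (?s w) * surface_op \<kappa> p (?s w)) + ?ev n * ?I (\<lambda>w. p (?s w) * v (?s w))"
      using int by simp
    \<comment> \<open>Symmetry moves the operator to \<open>v\<close>, after which both summands are orthogonality relations
      for \<open>p\<close>.\<close>
    also have "?I (\<lambda>w. v (?s w) * surface_op \<kappa> p (?s w)) = ?I (\<lambda>w. p (?s w) * surface_op \<kappa> v (?s w))"
      by (rule surface_op_symmetric[OF v p m \<kappa>])
    finally show ?thesis by (simp add: orth[OF vn] orth[OF Lvn])
  qed
  note v0 = square_integral_zero_imp_zero[OF v \<kappa> this]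
  show ?thesis
  proof (intro ballI, clarify)
    fix x :: "real ^ 'd1" and y :: "real ^ 'd2" assume xy: "(x, y) \<in> surface" "coord_sum y < 1"
    then have nx: "norm x = 1 - coord_sum y" and y: "y \<in> simplex_set" by (auto simp: surface_def)
    then have "norm x \<noteq> 0" using xy(2) by linarith
    then have "norm (sgn x) = 1" "surface_param (sgn x, y) = (x, y)"
      by (auto simp: norm_sgn surface_param_def sgn_div_norm nx[symmetric])
    then have "v (x, y) = 0" using v0[of "sgn x" y] y by simp
    then show "diff_op \<kappa> u (x, y) = - ?ev n * u (x, y)"
      using diff_op_eq_surface_op[OF m p up xy, of \<kappa>] up[OF xy(1)] by (simp add: v_def)
  qed
qed

end
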